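(* Let $T>0$ and let $u$ be the (real-valued, $2\pi$-periodic, zero-mean) solution of the KdV equation $$\partial_t u(t,x)+\partial_x^3u(t,x)=\tfrac12\,\partial_x\big(u(t,x)\big)^2,\qquad u(0,x)=u_0(x),\qquad x\in\mathbb{T}=[-\pi,\pi],$$ where $\int_{\mathbb{T}}u_0\,\mathrm{d}x=0$. Assume that $u(t)\in H^3$ for $0\le t\le T$. For a time step $\tau>0$ set $t_n=n\tau$, $u^0=u_0$, and define for $n\ge 0$ $$u^{n+1}=\mathrm{e}^{-\tau\partial_x^3}u^n+\tfrac16\Big(\mathrm{e}^{-\tau\partial_x^3}\partial_x^{-1}u^n\Big)^2-\tfrac16\,\mathrm{e}^{-\tau\partial_x^3}\Big(\partial_x^{-1}u^n\Big)^2 .$$ Then there exists $\tau_0>0$ such that for all $\tau\le\tau_0$ and all $t_n\le T$ this scheme is first-order convergent in $H^1$, i.e. $$\Vert u(t_n)-u^n\Vert_{H^1}\le c\,\tau ,$$ where $c$ depends on $\sup_{0\le t\le t_n}\Vert u(t)\Vert_{H^3}$ and $t_n$, but can be chosen independently of $\tau$.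
   Context: Functions are real-valued on the torus $\mathbb{T}=[-\pi,\pi]$ with periodic boundary conditions, with Fourier expansion $f(x)=\sum_{k\in\mathbb{Z}}\hat f_k\mathrm{e}^{ikx}$; $H^r=H^r(\mathbb{T})$ is the usual Sobolev space. The operator $\mathrm{e}^{t\partial_x^3}$ is the Fourier multiplier $\hat f_k\mapsto \mathrm{e}^{-itk^3}\hat f_k$. The operator $\partial_x^{-1}$ is defined by $\partial_x^{-1}f(x)=\sum_{k\neq0}(ik)^{-1}\hat f_k\mathrm{e}^{ikx}$ (the zero mode is mapped to $0$). A solution of the KdV equation is understood in the sense of Duhamel's formula $u(t)=\mathrm{e}^{-t\partial_x^3}u_0+\frac12\int_0^t\mathrm{e}^{-(t-s)\partial_x^3}\partial_x(u(s))^2\,\mathrm{d}s$; it preserves the zero mean. *)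

theory Defs
  imports "HOL-Analysis.Analysis"
begin

text \<open>
  Functions on the torus are represented by \<open>2\<pi>\<close>-periodic functions on the real line;
  elements of \<open>L\<^sup>2\<close> and of the Sobolev spaces by arbitrary Borel representatives.
\<close>

definition fourier_coeff :: "(real \<Rightarrow> real) \<Rightarrow> int \<Rightarrow> complex" where
  "fourier_coeff f k =
     (LINT x:{-pi..pi}|lborel. complex_of_real (f x) * exp (- (\<i> * of_int k * of_real x)))
       / of_real (2 * pi)"

definition sobolev_space :: "nat \<Rightarrow> (real \<Rightarrow> real) set" where
  "sobolev_space r = {f.
     (\<forall>x. f (x + 2 * pi) = f x) \<and>
     f \<in> borel_measurable borel \<and>
     set_integrable lborel {-pi..pi} (\<lambda>x. (f x)\<^sup>2) \<and>
     (\<lambda>k::int. (1 + (real_of_int k)\<^sup>2) ^ r * (cmod (fourier_coeff f k))\<^sup>2) summable_on UNIV}"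

text \<open>Only meaningful on \<^term>\<open>sobolev_space r\<close>: a divergent sum has the default value 0.\<close>
definition sobolev_norm :: "nat \<Rightarrow> (real \<Rightarrow> real) \<Rightarrow> real" where
  "sobolev_norm r f =
     sqrt (\<Sum>\<^sub>\<infinity>k::int. (1 + (real_of_int k)\<^sup>2) ^ r * (cmod (fourier_coeff f k))\<^sup>2)"

text \<open>
  The pointwise Fourier series is used only for \<open>m k * fourier_coeff f k\<close> that are
  coefficients of an \<open>H\<^sup>1\<close> function, where it converges absolutely. For the symbols
  below, \<open>m (- k) = cnj (m k)\<close>, so the sum is real and \<^term>\<open>Re\<close> only changes the type.
\<close>
definition fourier_multiplier :: "(int \<Rightarrow> complex) \<Rightarrow> (real \<Rightarrow> real) \<Rightarrow> real \<Rightarrow> real" where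
  "fourier_multiplier m f x =
     Re (\<Sum>\<^sub>\<infinity>k::int. m k * fourier_coeff f k * exp (\<i> * of_int k * of_real x))"

text \<open>\<open>exp (t \<partial>\<^sub>x\<^sup>3)\<close>\<close>
definition airy_group :: "real \<Rightarrow> (real \<Rightarrow> real) \<Rightarrow> real \<Rightarrow> real" where
  "airy_group t = fourier_multiplier (\<lambda>k. exp (- (\<i> * of_real t * of_int k ^ 3)))"

definition dx :: "(real \<Rightarrow> real) \<Rightarrow> real \<Rightarrow> real" where
  "dx = fourier_multiplier (\<lambda>k. \<i> * of_int k)"

definition dx_inv :: "(real \<Rightarrow> real) \<Rightarrow> real \<Rightarrow> real" where
  "dx_inv = fourier_multiplier (\<lambda>k. if k = 0 then 0 else inverse (\<i> * of_int k))"

text \<open>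
  Duhamel's formula as an identity between functions on the torus, i.e. for almost every \<open>x\<close>.
  Integrability is required explicitly since a non-integrable function has integral 0.
\<close>
definition kdv_solution :: "real \<Rightarrow> (real \<Rightarrow> real) \<Rightarrow> (real \<Rightarrow> real \<Rightarrow> real) \<Rightarrow> bool" where
  "kdv_solution T u0 u \<longleftrightarrow>
     u 0 = u0 \<and>
     (\<forall>t\<in>{0..T}. AE x in lborel.
        set_integrable lborel {0..t} (\<lambda>s. airy_group (- (t - s)) (dx (\<lambda>y. (u s y)\<^sup>2)) x) \<and>
        u t x = airy_group (- t) u0 x
          + 1/2 * (LINT s:{0..t}|lborel. airy_group (- (t - s)) (dx (\<lambda>y. (u s y)\<^sup>2)) x))"

primrec kdv_scheme :: "real \<Rightarrow> (real \<Rightarrow> real) \<Rightarrow> nat \<Rightarrow> real \<Rightarrow> real" where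
  "kdv_scheme \<tau> u0 0 = u0"
| "kdv_scheme \<tau> u0 (Suc n) = (\<lambda>x.
     airy_group (- \<tau>) (kdv_scheme \<tau> u0 n) x
     + 1/6 * (airy_group (- \<tau>) (dx_inv (kdv_scheme \<tau> u0 n)) x)\<^sup>2
     - 1/6 * airy_group (- \<tau>) (\<lambda>y. (dx_inv (kdv_scheme \<tau> u0 n) y)\<^sup>2) x)"

end

theory Submission
  imports Defs
begin

text \<open>
  Everything happens on Fourier coefficients. Write \<open>w\<^sub>k(t) = exp (- i t k\<^sup>3) u\<^sub>k(t)\<close>. Since
  \<open>k\<^sup>3 - a\<^sup>3 - b\<^sup>3 = 3 k a b\<close> for \<open>a + b = k\<close>, the twisted solution satisfies
  \<open>w\<^sub>k' = (i k / 2) \<Sum> exp (- 3 i t k a b) w\<^sub>a w\<^sub>b\<close>. For functions of zero mean the factor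
  \<open>exp (- 3 i t k a b)\<close> can be integrated over a time step in closed form, the result being
  divided by \<open>k a b\<close>; the derivative \<open>i k\<close> cancels against this denominator, and what remains is the
  pair of squares of \<open>\<partial>\<^sub>x\<^sup>-\<^sup>1 u\<close> in the scheme. In the twisted variable the scheme therefore
  is \<open>W \<mapsto> W + B W W\<close>, where \<open>B\<close> (the constant \<open>exp_step\<close> below) integrates the phase exactly
  and freezes \<open>w\<close> at the left end point.

  Consistency: the equation bounds \<open>w'\<close> in \<open>H\<^sup>2\<close> in terms of the \<open>H\<^sup>3\<close> norm, so freezing \<open>w\<close>
  costs \<open>O(\<tau>\<^sup>2)\<close> in \<open>H\<^sup>1\<close> per step (\<open>local_error\<close>).

  Stability: the error \<open>e = w - W\<close> obeys \<open>e \<mapsto> e + 2 B e w - B e e\<close> up to the local error.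
  Two different bounds on \<open>B\<close> are combined. Interpolating between \<open>\<bar>k\<bar> \<tau>\<close> and
  \<open>1 / \<bar>a b\<bar>\<close> shows that \<open>B\<close> maps \<open>H\<^sup>1 \<times> H\<^sup>1\<close> to \<open>H\<^sup>1\<close> with norm
  \<open>O(\<surd>\<tau>)\<close> (\<open>H_norm_exp_step\<close>); this controls the square of the increment. The scalar product
  of \<open>e\<close> with \<open>B e w\<close> is even \<open>O(\<tau>)\<close>: exchanging the two occurrences of \<open>e\<close> is
  the discrete integration by parts that moves the lost derivative onto the smooth factor \<open>w\<close>
  (\<open>energy_estimate\<close>). The term \<open>B e e\<close> has no smooth factor, but as long as
  \<open>\<parallel>e\<parallel> \<le> \<surd>\<tau>\<close> the \<open>\<surd>\<tau>\<close> bound suffices for it as well. The resulting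
  first-order estimate is far smaller than \<open>\<surd>\<tau>\<close> once \<open>\<tau>\<close> is small, so this smallness
  propagates along the induction over the time steps (\<open>error_bound\<close>).

  Two analytic facts connect this with Borel functions that satisfy Duhamel's formula almost
  everywhere. A function with summable Fourier coefficients equals its Fourier series almost everywhere
  (\<open>sobolev_space_AE_eq_fourier_series\<close>), which gives the coefficients of \<open>u\<^sup>2\<close>. The integrand in
  Duhamel's formula is continuous in \<open>x\<close> and measurable in time for almost every \<open>x\<close>, hence jointly
  measurable (\<open>Caratheodory_measurable\<close>), so that Fubini's theorem applies.
\<close>

section \<open>Square-summable families\<close>

definition square_summable :: "('i \<Rightarrow> 'a::real_normed_vector) \<Rightarrow> bool" where
  "square_summable f \<longleftrightarrow> (\<lambda>k. (norm (f k))\<^sup>2) summable_on UNIV"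

definition l2_norm :: "('i \<Rightarrow> 'a::real_normed_vector) \<Rightarrow> real" where
  "l2_norm f = sqrt (\<Sum>\<^sub>\<infinity>k. (norm (f k))\<^sup>2)"

lemma l2_norm_nonneg [simp]: "0 \<le> l2_norm f"
  unfolding l2_norm_def by (simp add: infsum_nonneg)

lemma l2_norm_power2: "(l2_norm f)\<^sup>2 = (\<Sum>\<^sub>\<infinity>k. (norm (f k))\<^sup>2)"
  unfolding l2_norm_def by (simp add: infsum_nonneg)

lemma square_summable_norm_iff [simp]: "square_summable (\<lambda>k. norm (f k)) \<longleftrightarrow> square_summable f"
  by (simp add: square_summable_def)

lemma l2_norm_norm [simp]: "l2_norm (\<lambda>k. norm (f k)) = l2_norm f"
  by (simp add: l2_norm_def)

lemma L2_set_le_l2_norm: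
  assumes "square_summable f" "finite K"
  shows "L2_set (\<lambda>k. norm (f k)) K \<le> l2_norm f"
  unfolding L2_set_def l2_norm_def
  using assms by (intro real_sqrt_le_mono finite_sum_le_infsum) (auto simp: square_summable_def)

text \<open>
  Almost every estimate below is proved for finite sets of frequencies first, where sums and integrals
  commute freely, and passes to the full \<open>\<ell>\<^sup>2\<close> norm by this criterion.
\<close>
lemma
  assumes "\<And>K. finite K \<Longrightarrow> L2_set (\<lambda>k. norm (f k)) K \<le> R"
  shows square_summableI: "square_summable f" and l2_norm_leI: "l2_norm f \<le> R"
proof -
  have R: "0 \<le> R" using assms[of "{}"] by simp
  have *: "(\<Sum>k\<in>K. (norm (f k))\<^sup>2) \<le> R\<^sup>2" if "finite K" for K
    using assms[OF that] real_sqrt_le_iff sqrt_le_D unfolding L2_set_def by blast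
  show 1: "square_summable f"
    unfolding square_summable_def
    by (rule nonneg_bdd_above_summable_on) (auto intro!: bdd_aboveI2 *)
  have "(\<Sum>\<^sub>\<infinity>k. (norm (f k))\<^sup>2) \<le> R\<^sup>2"
    using 1 * by (intro infsum_le_finite_sums) (auto simp: square_summable_def)
  then show "l2_norm f \<le> R"
    unfolding l2_norm_def using R by (simp add: real_le_lsqrt)
qed

lemma norm_le_l2_norm:
  assumes "square_summable f"
  shows "norm (f k) \<le> l2_norm f"
  using L2_set_le_l2_norm[OF assms, of "{k}"] by simp

lemma
  assumes "square_summable g" "\<And>k. norm (f k) \<le> norm (g k)"
  shows square_summable_mono: "square_summable f" and l2_norm_mono: "l2_norm f \<le> l2_norm g"
proof -
  have *: "L2_set (\<lambda>k. norm (f k)) K \<le> l2_norm g" if "finite K" for K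
    by (rule order_trans[OF L2_set_mono L2_set_le_l2_norm[OF assms(1) that]]) (use assms(2) in auto)
  from square_summableI[OF *] l2_norm_leI[OF *]
  show "square_summable f" "l2_norm f \<le> l2_norm g" by auto
qed

lemma
  assumes "square_summable f" "square_summable g"
  shows square_summable_add: "square_summable (\<lambda>k. f k + g k)"
    and l2_norm_triangle: "l2_norm (\<lambda>k. f k + g k) \<le> l2_norm f + l2_norm g"
proof -
  have *: "L2_set (\<lambda>k. norm (f k + g k)) K \<le> l2_norm f + l2_norm g" if "finite K" for K
  proof -
    have "L2_set (\<lambda>k. norm (f k + g k)) K \<le> L2_set (\<lambda>k. norm (f k) + norm (g k)) K"
      by (intro L2_set_mono) (auto simp: norm_triangle_ineq)
    also have "\<dots> \<le> L2_set (\<lambda>k. norm (f k)) K + L2_set (\<lambda>k. norm (g k)) K"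
      by (rule L2_set_triangle_ineq)
    finally show ?thesis
      using L2_set_le_l2_norm[OF assms(1) that] L2_set_le_l2_norm[OF assms(2) that] by simp
  qed
  from square_summableI[OF *] l2_norm_leI[OF *]
  show "square_summable (\<lambda>k. f k + g k)" "l2_norm (\<lambda>k. f k + g k) \<le> l2_norm f + l2_norm g" by auto
qed

lemma square_summable_scaleR: "square_summable f \<Longrightarrow> square_summable (\<lambda>k. c *\<^sub>R f k)"
  unfolding square_summable_def
  using summable_on_cmult_right[of "\<lambda>k. (norm (f k))\<^sup>2" UNIV "c\<^sup>2"] by (simp add: power_mult_distrib)

lemma l2_norm_scaleR: "l2_norm (\<lambda>k. c *\<^sub>R f k) = \<bar>c\<bar> * l2_norm f"
  unfolding l2_norm_def by (simp add: power_mult_distrib infsum_cmult_right' real_sqrt_mult)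

lemma
  fixes f g :: "'i \<Rightarrow> 'a::{real_normed_algebra,banach}"
  assumes "square_summable f" "square_summable g"
  shows abs_summable_mult_l2: "(\<lambda>k. norm (f k) * norm (g k)) summable_on UNIV"
    and Cauchy_Schwarz_infsum: "(\<Sum>\<^sub>\<infinity>k. norm (f k) * norm (g k)) \<le> l2_norm f * l2_norm g"
proof -
  have *: "(\<Sum>k\<in>K. norm (f k) * norm (g k)) \<le> l2_norm f * l2_norm g" if "finite K" for K
  proof -
    have "(\<Sum>k\<in>K. norm (f k) * norm (g k)) \<le> L2_set (\<lambda>k. norm (f k)) K * L2_set (\<lambda>k. norm (g k)) K"
      using L2_set_mult_ineq[of "\<lambda>k. norm (f k)" "\<lambda>k. norm (g k)" K] by simp
    also have "\<dots> \<le> l2_norm f * l2_norm g"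
      using assms that by (intro mult_mono L2_set_le_l2_norm) auto
    finally show ?thesis .
  qed
  show 1: "(\<lambda>k. norm (f k) * norm (g k)) summable_on UNIV"
    by (rule nonneg_bdd_above_summable_on) (auto intro!: bdd_aboveI2 *)
  show "(\<Sum>\<^sub>\<infinity>k. norm (f k) * norm (g k)) \<le> l2_norm f * l2_norm g"
    using 1 * by (intro infsum_le_finite_sums) auto
qed

section \<open>Convolution and integrals of sequences\<close>

definition conv :: "(int \<Rightarrow> 'a) \<Rightarrow> (int \<Rightarrow> 'a) \<Rightarrow> int \<Rightarrow> 'a::real_normed_algebra" where
  "conv f g k = (\<Sum>\<^sub>\<infinity>a. f a * g (k - a))"

lemma bij_shift: "bij_betw (\<lambda>a. k - a) UNIV (UNIV::int set)"
  by (rule bij_betwI[of _ _ _ "\<lambda>a. k - a"]) auto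

lemma summable_on_reflect: "(\<lambda>a. f (k - a)) summable_on UNIV \<longleftrightarrow> f summable_on (UNIV::int set)"
  by (rule summable_on_reindex_bij_betw[OF bij_shift])

lemma infsum_reflect: "(\<Sum>\<^sub>\<infinity>a. f (k - a)) = (\<Sum>\<^sub>\<infinity>a::int. f a)"
  by (rule infsum_reindex_bij_betw[OF bij_shift])

lemma
  fixes f :: "'k \<Rightarrow> 'i \<Rightarrow> 'a::real_normed_vector"
  assumes "finite K" "\<And>k. k \<in> K \<Longrightarrow> f k summable_on A"
  shows summable_on_finite_sum: "(\<lambda>a. \<Sum>k\<in>K. f k a) summable_on A"
    and infsum_finite_sum: "(\<Sum>\<^sub>\<infinity>a\<in>A. \<Sum>k\<in>K. f k a) = (\<Sum>k\<in>K. \<Sum>\<^sub>\<infinity>a\<in>A. f k a)"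
proof -
  have "((\<lambda>a. \<Sum>k\<in>K. f k a) has_sum (\<Sum>k\<in>K. \<Sum>\<^sub>\<infinity>a\<in>A. f k a)) A"
    using assms by (induction K) (auto intro!: has_sum_add has_sum_infsum)
  then show "(\<lambda>a. \<Sum>k\<in>K. f k a) summable_on A"
    "(\<Sum>\<^sub>\<infinity>a\<in>A. \<Sum>k\<in>K. f k a) = (\<Sum>k\<in>K. \<Sum>\<^sub>\<infinity>a\<in>A. f k a)"
    by (auto simp: summable_on_def infsumI)
qed

lemma conv_commute:
  fixes f g :: "int \<Rightarrow> 'a::{real_normed_algebra,comm_ring}"
  shows "conv f g k = conv g f k"
  unfolding conv_def using infsum_reflect[of "\<lambda>a. f a * g (k - a)" k] by (simp add: mult.commute)

lemma conv_nonneg: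
  fixes f g :: "int \<Rightarrow> real"
  assumes "\<And>a. 0 \<le> f a" "\<And>a. 0 \<le> g a"
  shows "0 \<le> conv f g k"
  unfolding conv_def using assms by (intro infsum_nonneg) simp

text \<open>
  Young's inequality \<open>\<ell>\<^sup>1 * \<ell>\<^sup>2 \<subseteq> \<ell>\<^sup>2\<close>. By Cauchy--Schwarz with weight \<open>f\<close>, the square
  of the convolution is at most \<open>\<parallel>f\<parallel>\<^sub>1\<close> times the convolution of \<open>f\<close> with \<open>g\<^sup>2\<close>; the sum of the
  latter over finitely many \<open>k\<close> is bounded by translation invariance.
\<close>
lemma
  fixes f g :: "int \<Rightarrow> real"
  assumes f: "f summable_on UNIV" "\<And>a. 0 \<le> f a" and g: "square_summable g" "\<And>a. 0 \<le> g a"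
  shows Young_summable: "(\<lambda>a. f a * g (k - a)) summable_on UNIV"
    and Young_square_summable: "square_summable (conv f g)"
    and Young_l2_norm: "l2_norm (conv f g) \<le> (\<Sum>\<^sub>\<infinity>a. f a) * l2_norm g"
proof -
  have gle: "g b \<le> l2_norm g" for b
    using norm_le_l2_norm[OF g(1), of b] by simp
  define F where "F = (\<Sum>\<^sub>\<infinity>a. f a)"
  have F0: "0 \<le> F" unfolding F_def using f by (simp add: infsum_nonneg)
  show s1: "(\<lambda>a. f a * g (k - a)) summable_on UNIV" for k
  proof (rule summable_on_comparison_test)
    show "(\<lambda>a. f a * l2_norm g) summable_on UNIV" using f(1) by (rule summable_on_cmult_left)
  qed (use f g gle in \<open>auto intro!: mult_left_mono\<close>)
  have s2: "(\<lambda>a. f a * (g (k - a))\<^sup>2) summable_on UNIV" for k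
  proof (rule summable_on_comparison_test)
    show "(\<lambda>a. f a * (l2_norm g)\<^sup>2) summable_on UNIV" using f(1) by (rule summable_on_cmult_left)
  qed (use f g gle in \<open>auto intro!: mult_left_mono power_mono\<close>)
  have pt: "(conv f g k)\<^sup>2 \<le> F * (\<Sum>\<^sub>\<infinity>a. f a * (g (k - a))\<^sup>2)" for k
  proof -
    define p where "p a = sqrt (f a)" for a
    define q where "q a = sqrt (f a) * g (k - a)" for a
    have pp: "(norm (p a))\<^sup>2 = f a" "(norm (q a))\<^sup>2 = f a * (g (k - a))\<^sup>2"
      "norm (p a) * norm (q a) = f a * g (k - a)" for a
      using f(2)[of a] g(2)[of "k - a"]
      by (auto simp: p_def q_def power_mult_distrib abs_mult simp flip: mult.assoc)
    have "square_summable p" "square_summable q"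
      unfolding square_summable_def pp using f s2 by auto
    from Cauchy_Schwarz_infsum[OF this]
    have "conv f g k \<le> l2_norm p * l2_norm q"
      unfolding pp conv_def .
    then have "(conv f g k)\<^sup>2 \<le> (l2_norm p * l2_norm q)\<^sup>2"
      using f g by (intro power_mono conv_nonneg) auto
    also have "\<dots> = F * (\<Sum>\<^sub>\<infinity>a. f a * (g (k - a))\<^sup>2)"
      unfolding power_mult_distrib l2_norm_power2 pp F_def ..
    finally show ?thesis .
  qed
  have main: "L2_set (\<lambda>k. norm (conv f g k)) K \<le> F * l2_norm g" if K: "finite K" for K
  proof -
    have sg: "(\<Sum>k\<in>K. (g (k - a))\<^sup>2) \<le> (l2_norm g)\<^sup>2" for a
    proof -
      have "(\<Sum>k\<in>K. (g (k - a))\<^sup>2) = (\<Sum>k\<in>(\<lambda>k. k - a) ` K. (g k)\<^sup>2)"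
        by (subst sum.reindex) (auto simp: inj_on_def)
      also have "\<dots> \<le> (\<Sum>\<^sub>\<infinity>k. (g k)\<^sup>2)"
        using g K by (intro finite_sum_le_infsum) (auto simp: square_summable_def)
      finally show ?thesis unfolding l2_norm_power2 by simp
    qed
    have "(\<Sum>k\<in>K. (conv f g k)\<^sup>2) \<le> (\<Sum>k\<in>K. F * (\<Sum>\<^sub>\<infinity>a. f a * (g (k - a))\<^sup>2))"
      by (intro sum_mono pt)
    also have "\<dots> = F * (\<Sum>\<^sub>\<infinity>a. \<Sum>k\<in>K. f a * (g (k - a))\<^sup>2)"
      unfolding infsum_finite_sum[OF K s2] sum_distrib_left ..
    also have "(\<Sum>\<^sub>\<infinity>a. \<Sum>k\<in>K. f a * (g (k - a))\<^sup>2) \<le> (\<Sum>\<^sub>\<infinity>a. f a * (l2_norm g)\<^sup>2)"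
    proof (rule infsum_mono)
      show "(\<lambda>a. \<Sum>k\<in>K. f a * (g (k - a))\<^sup>2) summable_on UNIV"
        by (intro summable_on_finite_sum s2 K)
      show "(\<lambda>a. f a * (l2_norm g)\<^sup>2) summable_on UNIV"
        using f(1) by (rule summable_on_cmult_left)
    qed (use f sg in \<open>auto simp flip: sum_distrib_left intro!: mult_left_mono\<close>)
    also have "\<dots> = F * (l2_norm g)\<^sup>2" by (simp add: F_def infsum_cmult_left')
    finally have "(\<Sum>k\<in>K. (conv f g k)\<^sup>2) \<le> F * (F * (l2_norm g)\<^sup>2)"
      using F0 by (auto intro: mult_left_mono)
    also have "\<dots> = (F * l2_norm g)\<^sup>2" by (simp add: power2_eq_square)
    finally have "(\<Sum>k\<in>K. (conv f g k)\<^sup>2) \<le> (F * l2_norm g)\<^sup>2" .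
    then show ?thesis
      unfolding L2_set_def using F0 by (simp add: real_le_lsqrt)
  qed
  from square_summableI[OF main] l2_norm_leI[OF main]
  show "square_summable (conv f g)" "l2_norm (conv f g) \<le> (\<Sum>\<^sub>\<infinity>a. f a) * l2_norm g"
    by (auto simp: F_def)
qed

text \<open>
  Dividing \<open>\<parallel>z\<parallel>\<^sup>2 = \<langle>z, z\<rangle> \<le> R \<parallel>z\<parallel>\<close> by \<open>\<parallel>z\<parallel>\<close>. It reduces a norm bound to a bound on
  one scalar, here used for Minkowski's integral inequality: the pairing with the fixed vector \<open>z\<close>
  commutes with the integral.
\<close>
lemma L2_set_duality:
  fixes z :: "'i \<Rightarrow> complex"
  assumes "finite K" "0 \<le> R"
    "Re (\<Sum>k\<in>K. cnj (z k) * z k) \<le> R * L2_set (\<lambda>k. norm (z k)) K"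
  shows "L2_set (\<lambda>k. norm (z k)) K \<le> R"
proof -
  have "Re (\<Sum>k\<in>K. cnj (z k) * z k) = (L2_set (\<lambda>k. norm (z k)) K)\<^sup>2"
    unfolding L2_set_def by (simp add: sum_nonneg cmod_power2) (simp add: power2_eq_square)
  with assms(3) show ?thesis
    by (smt (verit, best) L2_set_nonneg assms(2) mult_le_cancel_right power2_eq_square)
qed

lemma L2_set_integral_le:
  fixes g :: "'i \<Rightarrow> real \<Rightarrow> complex"
  assumes K: "finite K" and ab: "a \<le> b" and cont: "\<And>k. k \<in> K \<Longrightarrow> continuous_on {a..b} (g k)"
    and le: "\<And>s. s \<in> {a..b} \<Longrightarrow> L2_set (\<lambda>k. norm (g k s)) K \<le> R"
  shows "L2_set (\<lambda>k. norm (integral {a..b} (g k))) K \<le> (b - a) * R"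
proof (rule L2_set_duality[OF K])
  have R: "0 \<le> R" using order_trans[OF L2_set_nonneg le[of a]] ab by simp
  then show "0 \<le> (b - a) * R" using ab by simp
  define z where "z k = integral {a..b} (g k)" for k
  define N where "N = L2_set (\<lambda>k. norm (z k)) K"
  have "((\<lambda>s. \<Sum>k\<in>K. cnj (z k) * g k s) has_integral (\<Sum>k\<in>K. cnj (z k) * z k)) {a..b}"
    unfolding z_def using cont
    by (intro has_integral_sum K has_integral_mult_right integrable_integral integrable_continuous_real)
  then have "(\<Sum>k\<in>K. cnj (z k) * z k) = integral {a..b} (\<lambda>s. \<Sum>k\<in>K. cnj (z k) * g k s)"
    by (simp add: integral_unique)
  moreover have "norm (integral {a..b} (\<lambda>s. \<Sum>k\<in>K. cnj (z k) * g k s)) \<le> (N * R) * (b - a)"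
  proof (rule integral_bound[OF ab])
    show "continuous_on {a..b} (\<lambda>s. \<Sum>k\<in>K. cnj (z k) * g k s)"
      using cont by (intro continuous_intros) auto
  next
    fix s assume s: "s \<in> {a..b}"
    have "norm (\<Sum>k\<in>K. cnj (z k) * g k s) \<le> (\<Sum>k\<in>K. \<bar>norm (z k)\<bar> * \<bar>norm (g k s)\<bar>)"
      by (rule order_trans[OF norm_sum]) (simp add: norm_mult)
    also have "\<dots> \<le> N * L2_set (\<lambda>k. norm (g k s)) K"
      unfolding N_def by (rule L2_set_mult_ineq)
    also have "\<dots> \<le> N * R" using s le by (intro mult_left_mono) (auto simp: N_def)
    finally show "norm (\<Sum>k\<in>K. cnj (z k) * g k s) \<le> N * R" .
  qed
  ultimately have "Re (\<Sum>k\<in>K. cnj (z k) * z k) \<le> (b - a) * R * N"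
    using complex_Re_le_cmod[of "\<Sum>k\<in>K. cnj (z k) * z k"] by (simp add: mult_ac)
  then show "Re (\<Sum>k\<in>K. cnj (integral {a..b} (g k)) * integral {a..b} (g k))
      \<le> (b - a) * R * L2_set (\<lambda>k. norm (integral {a..b} (g k))) K"
    unfolding z_def N_def .
qed

section \<open>Weighted spaces of coefficient sequences\<close>

text \<open>
  The weight \<open>\<langle>k\<rangle> = (1 + k\<^sup>2)\<^sup>1\<^sup>/\<^sup>2\<close>. Unlike \<open>\<bar>k\<bar>\<close> it does not vanish at
  \<open>k = 0\<close>, and with it the weighted \<open>\<ell>\<^sup>2\<close> norms are exactly the Sobolev norms.
\<close>
definition bracket :: "int \<Rightarrow> real" where "bracket k = sqrt (1 + (real_of_int k)\<^sup>2)"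

lemma bracket_ge1 [simp]: "1 \<le> bracket k" by (simp add: bracket_def)
lemma bracket_pos [simp]: "0 < bracket k" by (rule less_le_trans[OF zero_less_one]) simp
lemma bracket_nonneg [simp]: "0 \<le> bracket k" by (simp add: bracket_def)
lemma bracket_power2: "(bracket k)\<^sup>2 = 1 + (real_of_int k)\<^sup>2"
  by (simp add: bracket_def)
lemma abs_le_bracket: "\<bar>real_of_int k\<bar> \<le> bracket k"
  unfolding bracket_def by (rule real_le_rsqrt) simp
lemma bracket_minus [simp]: "bracket (- k) = bracket k"
  by (simp add: bracket_def)

lemma bracket_add: "bracket (a + b) \<le> bracket a + bracket b"
proof -
  have "\<bar>real_of_int a\<bar> * \<bar>real_of_int b\<bar> \<le> bracket a * bracket b"
    by (intro mult_mono abs_le_bracket) auto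
  then have "real_of_int a * real_of_int b \<le> bracket a * bracket b"
    by (metis abs_le_iff abs_mult dual_order.trans)
  then have "(bracket (a + b))\<^sup>2 \<le> (bracket a + bracket b)\<^sup>2"
    by (simp add: power2_sum bracket_power2)
  then show ?thesis by (rule power2_le_imp_le) simp
qed

lemma bracket_power_add: "bracket k ^ r \<le> 2 ^ r * (bracket a ^ r + bracket (k - a) ^ r)"
proof -
  have "bracket k \<le> 2 * max (bracket a) (bracket (k - a))"
    using bracket_add[of a "k - a"] by simp
  then have "bracket k ^ r \<le> (2 * max (bracket a) (bracket (k - a))) ^ r"
    by (intro power_mono) auto
  also have "\<dots> = 2 ^ r * max (bracket a) (bracket (k - a)) ^ r" by (simp add: power_mult_distrib)
  also have "max (bracket a) (bracket (k - a)) ^ r \<le> bracket a ^ r + bracket (k - a) ^ r"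
    by (simp add: max_def)
  finally show ?thesis by simp
qed

definition in_H :: "nat \<Rightarrow> (int \<Rightarrow> 'a::real_normed_vector) \<Rightarrow> bool" where
  "in_H r f \<longleftrightarrow> square_summable (\<lambda>k. (bracket k ^ r) *\<^sub>R f k)"

definition H_norm :: "nat \<Rightarrow> (int \<Rightarrow> 'a::real_normed_vector) \<Rightarrow> real" where
  "H_norm r f = l2_norm (\<lambda>k. (bracket k ^ r) *\<^sub>R f k)"

lemma H_norm_nonneg [simp]: "0 \<le> H_norm r f" by (simp add: H_norm_def)

lemma
  assumes "in_H r g" "\<And>k. bracket k ^ s * norm (f k) \<le> bracket k ^ r * norm (g k)"
  shows in_H_mono: "in_H s f" and H_norm_mono: "H_norm s f \<le> H_norm r g"
  unfolding in_H_def H_norm_def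
   by (rule square_summable_mono[OF assms(1)[unfolded in_H_def]],
       use assms(2) in simp)
      (rule l2_norm_mono[OF assms(1)[unfolded in_H_def]], use assms(2) in simp)

lemma
  assumes "in_H r f" "s \<le> r"
  shows in_H_le: "in_H s f" and H_norm_le: "H_norm s f \<le> H_norm r f"
proof -
  have *: "bracket k ^ s * norm (f k) \<le> bracket k ^ r * norm (f k)" for k
    using assms(2) by (intro mult_right_mono power_increasing) auto
  show "in_H s f" "H_norm s f \<le> H_norm r f"
    using in_H_mono[OF assms(1) *] H_norm_mono[OF assms(1) *] by auto
qed

lemma in_H_norm_iff [simp]: "in_H r (\<lambda>k. norm (f k)) \<longleftrightarrow> in_H r f"
  by (simp add: in_H_def square_summable_def)

lemma H_norm_norm [simp]: "H_norm r (\<lambda>k. norm (f k)) = H_norm r f"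
  by (simp add: H_norm_def l2_norm_def)

lemma
  assumes "in_H r f" "in_H r g"
  shows in_H_add: "in_H r (\<lambda>k. f k + g k)"
    and H_norm_triangle: "H_norm r (\<lambda>k. f k + g k) \<le> H_norm r f + H_norm r g"
  using assms square_summable_add[of "\<lambda>k. (bracket k ^ r) *\<^sub>R f k" "\<lambda>k. (bracket k ^ r) *\<^sub>R g k"]
   l2_norm_triangle[of "\<lambda>k. (bracket k ^ r) *\<^sub>R f k" "\<lambda>k. (bracket k ^ r) *\<^sub>R g k"]
  by (auto simp: in_H_def H_norm_def scaleR_add_right)

lemma in_H_scaleR: "in_H r f \<Longrightarrow> in_H r (\<lambda>k. c *\<^sub>R f k)"
  unfolding in_H_def using square_summable_scaleR[of "\<lambda>k. (bracket k ^ r) *\<^sub>R f k" c]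
  by (simp add: mult.commute)

lemma H_norm_scaleR: "H_norm r (\<lambda>k. c *\<^sub>R f k) = \<bar>c\<bar> * H_norm r f"
  unfolding H_norm_def using l2_norm_scaleR[of c "\<lambda>k. (bracket k ^ r) *\<^sub>R f k"]
  by (simp add: mult.commute)

lemma
  assumes "in_H r f" "in_H r g"
  shows in_H_diff: "in_H r (\<lambda>k. f k - g k)"
    and H_norm_triangle_diff: "H_norm r (\<lambda>k. f k - g k) \<le> H_norm r f + H_norm r g"
  using in_H_add[OF assms(1) in_H_scaleR[OF assms(2), of "-1"]]
    H_norm_triangle[OF assms(1) in_H_scaleR[OF assms(2), of "-1"]] H_norm_scaleR[of r "-1" g]
  by auto

lemma norm_le_H_norm: "in_H r f \<Longrightarrow> bracket k ^ r * norm (f k) \<le> H_norm r f"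
  unfolding in_H_def H_norm_def by (drule norm_le_l2_norm[of _ k]) simp

lemma inverse_bracket_square_summable: "square_summable (\<lambda>k. inverse (bracket k))"
proof -
  define h where "h = (\<lambda>k::int. inverse ((bracket k)\<^sup>2))"
  have "summable (\<lambda>n::nat. inverse (real n ^ 2))"
    using inverse_power_summable[of 2] by simp
  then have "summable (\<lambda>n::nat. h (int n))"
    by (rule summable_comparison_test'[where N=1])
       (auto simp: h_def bracket_power2 intro!: le_imp_inverse_le)
  then have s: "(\<lambda>n::nat. h (int n)) summable_on UNIV"
    by (subst summable_on_UNIV_nonneg_real_iff) (auto simp: h_def)
  have inj: "inj_on int UNIV" "inj_on (\<lambda>n. - int n) UNIV" by (auto simp: inj_on_def)
  have "h summable_on (int ` UNIV)"
    using s summable_on_reindex[OF inj(1), of h] by (simp add: o_def)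
  moreover have "h summable_on ((\<lambda>n. - int n) ` UNIV)"
    using s summable_on_reindex[OF inj(2), of h] by (simp add: o_def h_def)
  ultimately have "h summable_on (int ` UNIV \<union> (\<lambda>n. - int n) ` UNIV)"
    by (rule summable_on_union)
  moreover have "int ` UNIV \<union> (\<lambda>n. - int n) ` UNIV = UNIV"
  proof -
    have "x \<in> int ` UNIV \<union> (\<lambda>n. - int n) ` UNIV" for x
      by (cases x rule: int_cases2) auto
    then show ?thesis by blast
  qed
  ultimately show ?thesis
    by (simp add: square_summable_def h_def power_inverse)
qed

definition kappa :: real where "kappa = l2_norm (\<lambda>k. inverse (bracket k))"

lemma kappa_nonneg [simp]: "0 \<le> kappa" by (simp add: kappa_def)

text \<open>
  The one-dimensional Sobolev embedding: one derivative in \<open>\<ell>\<^sup>2\<close> pays for absolute summability,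
  because \<open>1 / \<langle>k\<rangle>\<close> is square summable.
\<close>
lemma
  fixes f :: "int \<Rightarrow> 'a::real_normed_vector"
  assumes "in_H (Suc r) f"
  shows in_H_abs_summable: "(\<lambda>k. bracket k ^ r * norm (f k)) summable_on UNIV"
    and infsum_norm_le: "(\<Sum>\<^sub>\<infinity>k. bracket k ^ r * norm (f k)) \<le> kappa * H_norm (Suc r) f"
proof -
  have eq: "norm (inverse (bracket k)) * norm (bracket k ^ Suc r * norm (f k)) = bracket k ^ r * norm (f k)" for k
  proof -
    have "bracket k \<noteq> 0" using bracket_pos[of k] by linarith
    then show ?thesis by (simp add: abs_mult)
  qed
  have "square_summable (\<lambda>k. bracket k ^ Suc r * norm (f k))"
    using assms by (simp add: in_H_def square_summable_def)
  from abs_summable_mult_l2[OF inverse_bracket_square_summable this]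
    Cauchy_Schwarz_infsum[OF inverse_bracket_square_summable this]
  show "(\<lambda>k. bracket k ^ r * norm (f k)) summable_on UNIV"
    "(\<Sum>\<^sub>\<infinity>k. bracket k ^ r * norm (f k)) \<le> kappa * H_norm (Suc r) f"
    unfolding eq kappa_def H_norm_def by (simp_all add: l2_norm_def)
qed

lemma
  assumes "in_H r f" "1 \<le> r"
  shows in_H_summable_norm: "(\<lambda>k. norm (f k)) summable_on UNIV"
    and infsum_norm_le': "(\<Sum>\<^sub>\<infinity>k. norm (f k)) \<le> kappa * H_norm r f"
proof -
  have 1: "in_H (Suc 0) f" "H_norm (Suc 0) f \<le> H_norm r f"
    using in_H_le[OF assms(1), of 1] H_norm_le[OF assms(1), of 1] assms(2) by auto
  show "(\<lambda>k. norm (f k)) summable_on UNIV" using in_H_abs_summable[OF 1(1)] by simp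
  show "(\<Sum>\<^sub>\<infinity>k. norm (f k)) \<le> kappa * H_norm r f"
    using infsum_norm_le[OF 1(1)] 1(2) mult_left_mono[OF 1(2) kappa_nonneg] by simp
qed

definition conv_const :: "nat \<Rightarrow> real" where "conv_const r = 2 ^ Suc r * kappa"

lemma conv_const_nonneg [simp]: "0 \<le> conv_const r" by (simp add: conv_const_def)

abbreviation abs_conv :: "(int \<Rightarrow> complex) \<Rightarrow> (int \<Rightarrow> complex) \<Rightarrow> int \<Rightarrow> real" where
  "abs_conv f g \<equiv> conv (\<lambda>a. norm (f a)) (\<lambda>a. norm (g a))"

text \<open>
  \<open>H\<^sup>r\<close> is an algebra for \<open>r \<ge> 1\<close>: the weight at \<open>k = a + b\<close> is dominated by the sum of the weights
  at \<open>a\<close> and \<open>b\<close>, and Young's inequality applies to each part with the other factor in \<open>\<ell>\<^sup>1\<close>.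
\<close>
lemma
  assumes f: "in_H r f" and g: "in_H r g" and r: "1 \<le> r"
  shows conv_summable: "(\<lambda>a. norm (f a) * norm (g (k - a))) summable_on UNIV"
    and in_H_abs_conv: "in_H r (abs_conv f g)"
    and H_norm_abs_conv: "H_norm r (abs_conv f g) \<le> conv_const r * H_norm r f * H_norm r g"
proof -
  define p where "p = (\<lambda>k. norm ((bracket k ^ r) *\<^sub>R f k))"
  define q where "q = (\<lambda>k. norm ((bracket k ^ r) *\<^sub>R g k))"
  define F where "F = (\<Sum>\<^sub>\<infinity>k. norm (f k))"
  define G where "G = (\<Sum>\<^sub>\<infinity>k. norm (g k))"
  have p: "square_summable p" "l2_norm p = H_norm r f" "\<And>k. 0 \<le> p k"
    using f unfolding p_def in_H_def H_norm_def by (simp_all del: norm_scaleR)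
  have q: "square_summable q" "l2_norm q = H_norm r g" "\<And>k. 0 \<le> q k"
    using g unfolding q_def in_H_def H_norm_def by (simp_all del: norm_scaleR)
  have g0: "square_summable (\<lambda>k. norm (g k))"
    using in_H_le[OF g, of 0] by (simp add: in_H_def)
  note sf = in_H_summable_norm[OF f r] and sg = in_H_summable_norm[OF g r]
  show s: "(\<lambda>a. norm (f a) * norm (g (k - a))) summable_on UNIV" for k
    by (rule Young_summable[OF sf _ g0]) auto
  have s1: "(\<lambda>a. norm (f a) * q (k - a)) summable_on UNIV" for k
    by (rule Young_summable[OF sf _ q(1)]) (auto simp: q)
  have s2': "(\<lambda>a. norm (g a) * p (k - a)) summable_on UNIV" for k
    by (rule Young_summable[OF sg _ p(1)]) (auto simp: p)
  have s2: "(\<lambda>a. p a * norm (g (k - a))) summable_on UNIV" for k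
    using s2' summable_on_reflect[of "\<lambda>a. p a * norm (g (k - a))" k] by (simp add: mult.commute)
  let ?h = "\<lambda>k. 2 ^ r *\<^sub>R (conv (\<lambda>a. norm (f a)) q k + conv (\<lambda>a. norm (g a)) p k)"
  have pt: "norm (bracket k ^ r *\<^sub>R abs_conv f g k) \<le> norm (?h k)" for k
  proof -
    have "bracket k ^ r * abs_conv f g k = (\<Sum>\<^sub>\<infinity>a. bracket k ^ r * (norm (f a) * norm (g (k - a))))"
      by (simp add: conv_def infsum_cmult_right')
    also have "\<dots> \<le> (\<Sum>\<^sub>\<infinity>a. 2 ^ r * (norm (f a) * q (k - a) + p a * norm (g (k - a))))"
    proof (rule infsum_mono)
      show "(\<lambda>a. bracket k ^ r * (norm (f a) * norm (g (k - a)))) summable_on UNIV"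
        by (intro summable_on_cmult_right s)
      show "(\<lambda>a. 2 ^ r * (norm (f a) * q (k - a) + p a * norm (g (k - a)))) summable_on UNIV"
        by (intro summable_on_cmult_right summable_on_add s1 s2)
      show "bracket k ^ r * (norm (f a) * norm (g (k - a)))
          \<le> 2 ^ r * (norm (f a) * q (k - a) + p a * norm (g (k - a)))" for a
        using mult_right_mono[OF bracket_power_add[of k r a], of "norm (f a) * norm (g (k - a))"]
        by (simp add: p_def q_def algebra_simps)
    qed
    also have "\<dots> = 2 ^ r * ((\<Sum>\<^sub>\<infinity>a. norm (f a) * q (k - a)) + (\<Sum>\<^sub>\<infinity>a. p a * norm (g (k - a))))"
      by (subst infsum_cmult_right') (simp add: infsum_add s1 s2)
    also have "\<dots> = ?h k"
      using conv_commute[of p "\<lambda>a. norm (g a)" k] by (simp add: conv_def)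
    finally show ?thesis
      by (simp add: conv_nonneg)
  qed
  have c1: "square_summable (conv (\<lambda>a. norm (f a)) q)" "l2_norm (conv (\<lambda>a. norm (f a)) q) \<le> F * H_norm r g"
    using Young_square_summable[OF sf _ q(1)] Young_l2_norm[OF sf _ q(1)] q by (auto simp: F_def)
  have c2: "square_summable (conv (\<lambda>a. norm (g a)) p)" "l2_norm (conv (\<lambda>a. norm (g a)) p) \<le> G * H_norm r f"
    using Young_square_summable[OF sg _ p(1)] Young_l2_norm[OF sg _ p(1)] p by (auto simp: G_def)
  have h: "square_summable ?h"
    by (intro square_summable_scaleR square_summable_add c1 c2)
  have "l2_norm ?h \<le> 2 ^ r * (F * H_norm r g + G * H_norm r f)"
    using l2_norm_triangle[OF c1(1) c2(1)] c1(2) c2(2) unfolding l2_norm_scaleR by simp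
  also have "\<dots> \<le> 2 ^ r * (kappa * H_norm r f * H_norm r g + kappa * H_norm r g * H_norm r f)"
    unfolding F_def G_def
    using infsum_norm_le'[OF f r] infsum_norm_le'[OF g r]
    by (intro mult_left_mono add_mono mult_right_mono) auto
  also have "\<dots> = conv_const r * H_norm r f * H_norm r g"
    by (simp add: conv_const_def algebra_simps)
  finally have "l2_norm ?h \<le> conv_const r * H_norm r f * H_norm r g" .
  then show "in_H r (abs_conv f g)" "H_norm r (abs_conv f g) \<le> conv_const r * H_norm r f * H_norm r g"
    unfolding in_H_def H_norm_def
    using square_summable_mono[OF h pt] l2_norm_mono[OF h pt] by auto
qed

section \<open>Absolutely convergent Fourier series\<close>

definition fourier_series :: "(int \<Rightarrow> complex) \<Rightarrow> real \<Rightarrow> complex" where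
  "fourier_series c x = (\<Sum>\<^sub>\<infinity>k. c k * exp (\<i> * of_int k * of_real x))"

text \<open>
  The symmetry of the Fourier coefficients of a real-valued function.
\<close>
definition hermitian :: "(int \<Rightarrow> complex) \<Rightarrow> bool" where
  "hermitian c \<longleftrightarrow> (\<forall>k. c (- k) = cnj (c k))"

lemma norm_char [simp]: "norm (exp (\<i> * of_int k * complex_of_real x)) = 1"
  using norm_exp_i_times[of "of_int k * x"] by (simp add: mult.assoc)

lemma norm_char_neg [simp]: "norm (exp (- (\<i> * of_int k * complex_of_real x))) = 1"
  using norm_char[of "-k" x] by simp

lemma fourier_series_summable:
  assumes "(\<lambda>k. norm (c k)) summable_on UNIV"
  shows "(\<lambda>k. c k * exp (\<i> * of_int k * of_real x)) summable_on UNIV"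
  by (rule abs_summable_summable) (use assms in \<open>simp add: norm_mult\<close>)

lemma norm_fourier_series_le:
  assumes "(\<lambda>k. norm (c k)) summable_on UNIV"
  shows "norm (fourier_series c x) \<le> (\<Sum>\<^sub>\<infinity>k. norm (c k))"
  unfolding fourier_series_def
  by (rule order_trans[OF norm_infsum_bound]) (use assms in \<open>simp_all add: norm_mult\<close>)

lemma continuous_on_infsum:
  fixes f :: "'i \<Rightarrow> 'a::topological_space \<Rightarrow> 'b::banach"
  assumes "\<And>k x. x \<in> S \<Longrightarrow> norm (f k x) \<le> M k" "M summable_on UNIV" "\<And>k. continuous_on S (f k)"
  shows "continuous_on S (\<lambda>x. \<Sum>\<^sub>\<infinity>k. f k x)"
proof (rule uniform_limit_theorem)
  show "uniform_limit S (\<lambda>X x. \<Sum>k\<in>X. f k x) (\<lambda>x. \<Sum>\<^sub>\<infinity>k. f k x) (finite_subsets_at_top UNIV)"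
    by (rule Weierstrass_m_test_general) (use assms in auto)
  show "\<forall>\<^sub>F X in finite_subsets_at_top UNIV. continuous_on S (\<lambda>x. \<Sum>k\<in>X. f k x)"
    using assms by (intro always_eventually allI continuous_on_sum) auto
qed auto

lemma has_sum_integral:
  fixes f :: "'i \<Rightarrow> real \<Rightarrow> 'b::banach"
  assumes M: "\<And>k x. x \<in> {a..b} \<Longrightarrow> norm (f k x) \<le> M k" "M summable_on UNIV"
    and cont: "\<And>k. continuous_on {a..b} (f k)"
  shows "((\<lambda>k. integral {a..b} (f k)) has_sum integral {a..b} (\<lambda>x. \<Sum>\<^sub>\<infinity>k. f k x)) UNIV"
proof -
  have u: "uniform_limit {a..b} (\<lambda>X x. \<Sum>k\<in>X. f k x) (\<lambda>x. \<Sum>\<^sub>\<infinity>k. f k x) (finite_subsets_at_top UNIV)"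
    by (rule Weierstrass_m_test_general) (use M in auto)
  obtain I J where I: "\<And>X. ((\<lambda>x. \<Sum>k\<in>X. f k x) has_integral I X) {a..b}"
    and J: "((\<lambda>x. \<Sum>\<^sub>\<infinity>k. f k x) has_integral J) {a..b}"
    and lim: "(I \<longlongrightarrow> J) (finite_subsets_at_top UNIV)"
    by (rule uniform_limit_integral[OF u]) (use cont in \<open>auto intro!: continuous_on_sum\<close>)
  have "I X = (\<Sum>k\<in>X. integral {a..b} (f k))" for X
  proof (cases "finite X")
    case True
    have "((\<lambda>x. \<Sum>k\<in>X. f k x) has_integral (\<Sum>k\<in>X. integral {a..b} (f k))) {a..b}"
      using cont True by (intro has_integral_sum integrable_integral integrable_continuous_real)
    with I[of X] show ?thesis by (rule has_integral_unique)
  next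
    case False
    with I[of X] show ?thesis by (simp add: has_integral_0_eq)
  qed
  then have "I = (\<lambda>X. \<Sum>k\<in>X. integral {a..b} (f k))" by (rule ext)
  with lim show ?thesis
    unfolding has_sum_def integral_unique[OF J] by simp
qed

lemma continuous_on_fourier_series:
  assumes "(\<lambda>k. norm (c k)) summable_on UNIV"
  shows "continuous_on S (fourier_series c)"
  unfolding fourier_series_def
  by (rule continuous_on_infsum[where M="\<lambda>k. norm (c k)"])
     (use assms in \<open>auto simp: norm_mult intro!: continuous_intros\<close>)

lemma fourier_series_measurable [measurable]:
  assumes "(\<lambda>k. norm (c k)) summable_on UNIV"
  shows "fourier_series c \<in> borel_measurable borel"
  using continuous_on_fourier_series[OF assms] by (rule borel_measurable_continuous_onI)

lemma fourier_series_periodic: "fourier_series c (x + 2 * pi) = fourier_series c x"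
proof -
  have "exp (\<i> * of_int k * of_real (x + 2 * pi)) = exp (\<i> * of_int k * of_real x)" for k
  proof -
    have "\<i> * of_int k * of_real (x + 2 * pi) = \<i> * of_int k * of_real x + (2 * of_int k * of_real pi) * \<i>"
      by (simp add: algebra_simps)
    then show ?thesis using exp_integer_2pi[of "of_int k"] by (simp add: exp_add)
  qed
  then show ?thesis by (simp add: fourier_series_def)
qed

lemma fourier_series_real:
  assumes "hermitian c"
  shows "complex_of_real (Re (fourier_series c x)) = fourier_series c x"
proof -
  have "cnj (fourier_series c x) = (\<Sum>\<^sub>\<infinity>k. c (- k) * exp (\<i> * of_int (- k) * of_real x))"
    unfolding fourier_series_def infsum_cnj[symmetric]
    using assms by (simp add: hermitian_def exp_cnj)
  also have "\<dots> = fourier_series c x"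
    unfolding fourier_series_def using infsum_reflect[of "\<lambda>k. c k * exp (\<i> * of_int k * of_real x)" 0] by simp
  finally show ?thesis
    by (simp add: complex_eq_iff)
qed

lemma integral_char:
  "integral {-pi..pi} (\<lambda>x. exp (\<i> * of_int k * complex_of_real x)) = (if k = 0 then of_real (2 * pi) else 0)"
proof (cases "k = 0")
  case False
  let ?F = "\<lambda>x. exp (\<i> * of_int k * complex_of_real x) / (\<i> * of_int k)"
  have "((\<lambda>x. exp (\<i> * of_int k * complex_of_real x)) has_integral ?F pi - ?F (-pi)) {-pi..pi}"
    using False
    by (intro fundamental_theorem_of_calculus
        has_vector_derivative_real_field[where f="\<lambda>z. exp (\<i> * of_int k * z) / (\<i> * of_int k)"])
       (auto intro!: derivative_eq_intros)
  moreover have "?F pi = ?F (-pi)"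
  proof -
    have "\<i> * of_int k * of_real pi = \<i> * of_int k * of_real (-pi) + (2 * of_int k * of_real pi) * \<i>"
      by (simp add: algebra_simps)
    then have "exp (\<i> * of_int k * of_real pi) = exp (\<i> * of_int k * of_real (-pi))"
      using exp_integer_2pi[of "of_int k"] by (simp only: exp_add) simp
    then show ?thesis by (rule arg_cong)
  qed
  ultimately show ?thesis using False by (simp add: integral_unique)
qed (simp add: algebra_simps scaleR_conv_of_real)

lemma LINT_continuous:
  fixes f :: "real \<Rightarrow> 'a::euclidean_space"
  assumes "continuous_on {a..b} f"
  shows "(LINT x:{a..b}|lborel. f x) = integral {a..b} f"
  using set_borel_integral_eq_integral(2)[OF borel_integrable_atLeastAtMost'[OF assms]] .

lemma fourier_coeff_fourier_series:
  assumes c: "(\<lambda>k. norm (c k)) summable_on UNIV" and h: "hermitian c"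
  shows "fourier_coeff (\<lambda>x. Re (fourier_series c x)) k = c k"
proof -
  let ?f = "\<lambda>j x. c j * exp (\<i> * of_int (j - k) * complex_of_real x)"
  have eq: "complex_of_real (Re (fourier_series c x)) * exp (- (\<i> * of_int k * of_real x)) = (\<Sum>\<^sub>\<infinity>j. ?f j x)" for x
  proof -
    have "?f j x = c j * exp (\<i> * of_int j * of_real x) * exp (- (\<i> * of_int k * of_real x))" for j
      by (simp add: mult.assoc exp_add[symmetric]) (simp add: algebra_simps)
    then show ?thesis
      unfolding fourier_series_real[OF h] unfolding fourier_series_def infsum_cmult_left'[symmetric] by presburger
  qed
  have cont: "continuous_on {-pi..pi} (\<lambda>x. \<Sum>\<^sub>\<infinity>j. ?f j x)"
    by (rule continuous_on_infsum[where M="\<lambda>k. norm (c k)"])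
       (use c in \<open>auto simp: norm_mult intro!: continuous_intros simp del: of_int_diff\<close>)
  have "((\<lambda>j. integral {-pi..pi} (?f j)) has_sum integral {-pi..pi} (\<lambda>x. \<Sum>\<^sub>\<infinity>j. ?f j x)) UNIV"
    by (rule has_sum_integral[where M="\<lambda>k. norm (c k)"])
       (use c in \<open>auto simp: norm_mult intro!: continuous_intros simp del: of_int_diff\<close>)
  moreover have "integral {-pi..pi} (?f j) = (if j = k then c k * of_real (2 * pi) else 0)" for j
    using integral_char[of "j - k"] by (simp del: of_int_diff add: integral_mult_right)
  ultimately have "((\<lambda>j. if j = k then c k * of_real (2 * pi) else 0) has_sum integral {-pi..pi} (\<lambda>x. \<Sum>\<^sub>\<infinity>j. ?f j x)) UNIV"
    by simp
  moreover have "((\<lambda>j. if j = k then c k * of_real (2 * pi) else 0) has_sum (c k * of_real (2 * pi))) UNIV"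
    by (rule has_sum_finite_neutralI[of "{k}"]) auto
  ultimately have "integral {-pi..pi} (\<lambda>x. \<Sum>\<^sub>\<infinity>j. ?f j x) = c k * of_real (2 * pi)"
    by (rule has_sum_unique)
  then show ?thesis
    unfolding fourier_coeff_def eq LINT_continuous[OF cont] by simp
qed

lemma hermitian_fourier_coeff: "hermitian (fourier_coeff f)"
proof -
  have "fourier_coeff f (- k) = cnj (fourier_coeff f k)" for k
  proof -
    have "cnj (LINT x:{-pi..pi}|lborel. complex_of_real (f x) * exp (- (\<i> * of_int k * of_real x)))
        = (LINT x:{-pi..pi}|lborel. complex_of_real (f x) * exp (- (\<i> * of_int (- k) * of_real x)))"
      unfolding set_lebesgue_integral_def Bochner_Integration.integral_cnj[symmetric]
      by (intro Bochner_Integration.integral_cong refl) (simp add: exp_cnj scaleR_conv_of_real)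
    then show ?thesis by (simp add: fourier_coeff_def)
  qed
  then show ?thesis by (simp add: hermitian_def)
qed

lemma fourier_coeff_cong_AE:
  assumes [measurable]: "f \<in> borel_measurable borel" "g \<in> borel_measurable borel"
    and "AE x in lborel. x \<in> {-pi..pi} \<longrightarrow> f x = g x"
  shows "fourier_coeff f k = fourier_coeff g k"
  unfolding fourier_coeff_def set_lebesgue_integral_def
  by (intro arg_cong2[where f="(/)"] refl integral_cong_AE)
     (use assms(3) in \<open>auto simp: indicator_def elim!: eventually_mono\<close>)

text \<open>
  The Cauchy product: the double series over \<open>(a, b)\<close> converges absolutely and is rearranged along
  the diagonals \<open>a + b = k\<close>.
\<close>
lemma
  fixes c d :: "int \<Rightarrow> complex"
  assumes c: "(\<lambda>k. norm (c k)) summable_on UNIV" and d: "(\<lambda>k. norm (d k)) summable_on UNIV"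
  shows fourier_series_mult: "fourier_series c x * fourier_series d x = fourier_series (conv c d) x"
    and conv_abs_summable: "(\<lambda>k. norm (conv c d k)) summable_on UNIV"
proof -
  let ?e = "\<lambda>k. exp (\<i> * of_int k * complex_of_real x)"
  have sN: "(\<lambda>p. norm ((\<lambda>(a,b). c a * d b) p)) summable_on UNIV \<times> UNIV"
    by (rule summable_on_SigmaI[where g="\<lambda>a. norm (c a) * (\<Sum>\<^sub>\<infinity>b. norm (d b))"])
       (auto simp: norm_mult intro!: has_sum_cmult_right has_sum_infsum d summable_on_cmult_left c)
  have bij: "bij_betw (\<lambda>(k,a). (a, k - a)) (UNIV \<times> UNIV) (UNIV \<times> (UNIV::int set))"
    by (rule bij_betwI[of _ _ _ "\<lambda>(a,b). (a + b, a)"]) auto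
  have sN': "(\<lambda>p. norm ((\<lambda>(k,a). c a * d (k - a)) p)) summable_on UNIV \<times> UNIV"
    using sN unfolding summable_on_reindex_bij_betw[OF bij, of "\<lambda>p. norm ((\<lambda>(a,b). c a * d b) p)", symmetric]
    by (simp add: case_prod_unfold)
  have s2: "(\<lambda>(k,a). c a * d (k - a)) summable_on UNIV \<times> UNIV"
    using sN' by (rule abs_summable_summable)
  have s2e: "(\<lambda>(k,a). c a * d (k - a) * ?e k) summable_on UNIV \<times> UNIV"
    by (rule abs_summable_summable) (use sN' in \<open>simp add: case_prod_unfold norm_mult\<close>)
  have n1: "\<And>k. (\<lambda>a. norm (c a * d (k - a))) summable_on UNIV"
    and n2: "(\<lambda>k. \<Sum>\<^sub>\<infinity>a. norm (c a * d (k - a))) summable_on UNIV"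
    using iffD1[OF Infinite_Sum.abs_summable_on_Sigma_iff sN'] by (simp_all add: infsum_nonneg)
  show "(\<lambda>k. norm (conv c d k)) summable_on UNIV"
    by (rule summable_on_comparison_test[OF n2]) (auto simp: conv_def intro!: norm_infsum_bound n1)
  have "fourier_series c x * fourier_series d x = (\<Sum>\<^sub>\<infinity>a. \<Sum>\<^sub>\<infinity>b. (c a * ?e a) * (d b * ?e b))"
    unfolding fourier_series_def by (simp add: infsum_cmult_right' infsum_cmult_left')
  also have "\<dots> = (\<Sum>\<^sub>\<infinity>(a,b)\<in>UNIV \<times> UNIV. (c a * ?e a) * (d b * ?e b))"
    by (rule infsum_Sigma'_banach, rule abs_summable_summable)
       (use sN in \<open>simp add: case_prod_unfold norm_mult\<close>)
  also have "\<dots> = (\<Sum>\<^sub>\<infinity>(k,a)\<in>UNIV \<times> UNIV. c a * d (k - a) * ?e k)"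
  proof -
    have "(\<Sum>\<^sub>\<infinity>(a,b)\<in>UNIV \<times> UNIV. (c a * ?e a) * (d b * ?e b))
        = (\<Sum>\<^sub>\<infinity>(k,a)\<in>UNIV \<times> UNIV. (c a * ?e a) * (d (k - a) * ?e (k - a)))"
      using infsum_reindex_bij_betw[OF bij, of "\<lambda>(a,b). (c a * ?e a) * (d b * ?e b)"]
      by (simp only: case_prod_unfold fst_conv snd_conv)
    moreover have "c a * ?e a * (d (k - a) * ?e (k - a)) = c a * d (k - a) * ?e k" for k a :: int
    proof -
      have "?e k = ?e a * ?e (k - a)"
        by (simp add: exp_add[symmetric]) (simp add: algebra_simps)
      then show ?thesis by (simp only: mult_ac)
    qed
    ultimately show ?thesis by presburger
  qed
  also have "\<dots> = (\<Sum>\<^sub>\<infinity>k. \<Sum>\<^sub>\<infinity>a. c a * d (k - a) * ?e k)"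
    by (rule infsum_Sigma'_banach[symmetric, OF s2e])
  also have "\<dots> = fourier_series (conv c d) x"
    unfolding fourier_series_def conv_def by (simp add: infsum_cmult_left')
  finally show "fourier_series c x * fourier_series d x = fourier_series (conv c d) x" .
qed

lemma hermitian_conv:
  assumes "hermitian c" "hermitian d"
  shows "hermitian (conv c d)"
proof -
  have "conv c d (- k) = cnj (conv c d k)" for k
  proof -
    have "conv c d (- k) = (\<Sum>\<^sub>\<infinity>a. c (0 - a) * d (- k - (0 - a)))"
      unfolding conv_def by (rule infsum_reflect[symmetric])
    also have "\<dots> = (\<Sum>\<^sub>\<infinity>a. cnj (c a * d (k - a)))"
    proof (rule infsum_cong)
      fix a :: int
      have "d (- k - (0 - a)) = d (- (k - a))" by simp
      then show "c (0 - a) * d (- k - (0 - a)) = cnj (c a * d (k - a))"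
        using assms by (simp add: hermitian_def del: minus_diff_eq)
    qed
    finally show ?thesis unfolding conv_def infsum_cnj .
  qed
  then show ?thesis by (simp add: hermitian_def)
qed

lemma power2_fourier_series:
  assumes c: "(\<lambda>k. norm (c k)) summable_on UNIV" and h: "hermitian c"
  shows "(Re (fourier_series c x))\<^sup>2 = Re (fourier_series (conv c c) x)"
proof -
  have "complex_of_real ((Re (fourier_series c x))\<^sup>2) = fourier_series (conv c c) x"
    using fourier_series_real[OF h, of x] by (simp add: power2_eq_square fourier_series_mult[OF c c])
  then show ?thesis by (metis Re_complex_of_real)
qed

lemma fourier_coeff_square:
  assumes c: "(\<lambda>k. norm (c k)) summable_on UNIV" and h: "hermitian c"
  shows "fourier_coeff (\<lambda>x. (Re (fourier_series c x))\<^sup>2) = conv c c"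
  unfolding power2_fourier_series[OF c h]
  using fourier_coeff_fourier_series[OF conv_abs_summable[OF c c] hermitian_conv[OF h h]] by blast

lemma fourier_multiplier_eq_fourier_series:
  "fourier_multiplier m f = (\<lambda>x. Re (fourier_series (\<lambda>k. m k * fourier_coeff f k) x))"
  by (simp add: fourier_multiplier_def fourier_series_def fun_eq_iff)

section \<open>Functions are determined by their Fourier coefficients\<close>

lemma integrable_mult_bounded:
  fixes f :: "real \<Rightarrow> 'a::{real_normed_algebra,banach,second_countable_topology}"
  assumes "integrable M f" and [measurable]: "h \<in> borel_measurable M" and "\<And>x. norm (h x) \<le> B"
  shows "integrable M (\<lambda>x. f x * h x)"
proof (rule Bochner_Integration.integrable_bound)
  show "integrable M (\<lambda>x. B * norm (f x))" using assms(1) by simp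
  show "(\<lambda>x. f x * h x) \<in> borel_measurable M"
    using assms(1) by measurable
  show "AE x in M. norm (f x * h x) \<le> norm (B * norm (f x))"
  proof (intro AE_I2)
    fix x
    have B: "0 \<le> B" using assms(3)[of x] norm_ge_zero[of "h x"] by linarith
    have "norm (f x * h x) \<le> norm (f x) * norm (h x)" by (rule norm_mult_ineq)
    also have "\<dots> \<le> norm (f x) * B" using assms(3)[of x] by (intro mult_left_mono) auto
    finally show "norm (f x * h x) \<le> norm (B * norm (f x))" using B by (simp add: mult.commute)
  qed
qed

text \<open>
  An integrable function \<open>G\<close> on \<open>[-\<pi>, \<pi>]\<close> with vanishing Fourier coefficients is zero almost everywhere.
  The test functions are \<open>\<psi> (cos (x - x0))\<close>: for polynomial \<open>\<psi>\<close> they are trigonometric polynomials,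
  hence orthogonal to \<open>G\<close>, and Weierstrass' theorem on \<open>[-1, 1]\<close> extends this to continuous \<open>\<psi>\<close>.
  Indicators of intervals centred at \<open>x0\<close> are pointwise limits of such functions, since
  \<open>\<bar>x - x0\<bar> < d\<close> is the condition \<open>cos (x - x0) > cos d\<close>. Going through the cosine avoids
  approximation of continuous functions on the circle.
\<close>
context
  fixes G :: "real \<Rightarrow> real"
  assumes G: "integrable lborel G"
    and vanish: "\<And>x. x \<notin> {-pi..pi} \<Longrightarrow> G x = 0"
    and coeff: "\<And>k. (LINT x|lborel. complex_of_real (G x) * exp (- (\<i> * of_int k * of_real x))) = 0"
begin

lemma zero_moment_cos_power:
  "(LINT x|lborel. complex_of_real (G x) * (complex_of_real (cos (x - x0)) ^ n * exp (- (\<i> * of_int k * of_real x)))) = 0"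
proof (induction n arbitrary: k)
  case 0
  then show ?case using coeff by simp
next
  case (Suc n)
  let ?P = "\<lambda>k x. complex_of_real (G x) * (complex_of_real (cos (x - x0)) ^ n * exp (- (\<i> * of_int k * of_real x)))"
  have int: "integrable lborel (?P k)" for k
    by (rule integrable_mult_bounded[where B=1])
       (use G in \<open>auto simp: norm_mult norm_power intro!: power_le_one\<close>)
  have eq: "complex_of_real (G x) * (complex_of_real (cos (x - x0)) ^ Suc n * exp (- (\<i> * of_int k * of_real x)))
     = (exp (- (\<i> * x0)) / 2) * ?P (k - 1) x + (exp (\<i> * x0) / 2) * ?P (k + 1) x" for x
  proof -
    have c: "complex_of_real (cos (x - x0)) = (exp (\<i> * (x - x0)) + exp (- (\<i> * (x - x0)))) / 2"
      by (simp add: cos_of_real[symmetric] cos_exp_eq)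
    have e1: "exp (\<i> * (x - x0)) * exp (- (\<i> * of_int k * of_real x)) = exp (- (\<i> * x0)) * exp (- (\<i> * of_int (k - 1) * of_real x))"
      by (simp add: exp_add[symmetric]) (simp add: algebra_simps)
    have e2: "exp (- (\<i> * (x - x0))) * exp (- (\<i> * of_int k * of_real x)) = exp (\<i> * x0) * exp (- (\<i> * of_int (k + 1) * of_real x))"
      by (simp add: exp_add[symmetric]) (simp add: algebra_simps)
    have "complex_of_real (cos (x - x0)) * exp (- (\<i> * of_int k * of_real x))
       = (exp (- (\<i> * x0)) / 2) * exp (- (\<i> * of_int (k - 1) * of_real x)) + (exp (\<i> * x0) / 2) * exp (- (\<i> * of_int (k + 1) * of_real x))"
      unfolding c add_divide_distrib distrib_right times_divide_eq_left e1 e2 by simp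
    then have "complex_of_real (G x) * complex_of_real (cos (x - x0)) ^ n * (complex_of_real (cos (x - x0)) * exp (- (\<i> * of_int k * of_real x)))
      = complex_of_real (G x) * complex_of_real (cos (x - x0)) ^ n * ((exp (- (\<i> * x0)) / 2) * exp (- (\<i> * of_int (k - 1) * of_real x)) + (exp (\<i> * x0) / 2) * exp (- (\<i> * of_int (k + 1) * of_real x)))"
      by presburger
    then show ?thesis
      by (simp only: power_Suc2 ring_distribs mult_ac)
  qed
  have "(LINT x|lborel. (exp (- (\<i> * x0)) / 2) * ?P (k - 1) x + (exp (\<i> * x0) / 2) * ?P (k + 1) x)
      = (exp (- (\<i> * x0)) / 2) * (LINT x|lborel. ?P (k - 1) x) + (exp (\<i> * x0) / 2) * (LINT x|lborel. ?P (k + 1) x)"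
    by (subst Bochner_Integration.integral_add) (auto intro!: integrable_mult_right int simp del: of_int_diff of_int_add)
  then show ?case
    unfolding eq by (simp only: Suc.IH) simp
qed

lemma zero_moment_cos_power_real: "(LINT x|lborel. G x * cos (x - x0) ^ n) = 0"
proof -
  have "complex_of_real (LINT x|lborel. G x * cos (x - x0) ^ n)
      = (LINT x|lborel. complex_of_real (G x * cos (x - x0) ^ n))"
    by (rule integral_complex_of_real[symmetric])
  also have "\<dots> = 0" using zero_moment_cos_power[of x0 n 0] by simp
  finally show ?thesis by simp
qed

lemma zero_moment_poly:
  assumes "real_polynomial_function p"
  shows "(LINT x|lborel. G x * p (cos (x - x0))) = 0"
proof -
  obtain a n where p: "p = (\<lambda>x. \<Sum>i\<le>n. a i * x ^ i)"
    using assms unfolding real_polynomial_function_iff_sum by blast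
  have int: "integrable lborel (\<lambda>x. G x * cos (x - x0) ^ i)" for i
    by (rule integrable_mult_bounded[where B=1])
       (use G in \<open>auto simp: power_abs intro!: power_le_one\<close>)
  have "(LINT x|lborel. G x * p (cos (x - x0))) = (LINT x|lborel. (\<Sum>i\<le>n. a i * (G x * cos (x - x0) ^ i)))"
    by (simp add: p sum_distrib_left mult_ac)
  also have "\<dots> = (\<Sum>i\<le>n. a i * (LINT x|lborel. G x * cos (x - x0) ^ i))"
    by (subst Bochner_Integration.integral_sum) (auto simp: int)
  finally show ?thesis by (simp add: zero_moment_cos_power_real)
qed

lemma zero_moment_continuous:
  assumes psi: "continuous_on {-1..1} \<psi>" and [measurable]: "\<psi> \<in> borel_measurable borel"
    and bd: "\<And>y. \<bar>\<psi> y\<bar> \<le> B"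
  shows "(LINT x|lborel. G x * \<psi> (cos (x - x0))) = 0"
proof -
  have "\<bar>LINT x|lborel. G x * \<psi> (cos (x - x0))\<bar> \<le> e * (LINT x|lborel. \<bar>G x\<bar>)" if e: "0 < e" for e
  proof -
    obtain p where p: "real_polynomial_function p" "\<And>y. y \<in> {-1..1} \<Longrightarrow> \<bar>\<psi> y - p y\<bar> < e"
      using Stone_Weierstrass_real_polynomial_function[OF _ psi e] by auto
    have pc: "continuous_on UNIV p"
      using p(1) by (metis continuous_on_polymonial_function real_polynomial_function_eq)
    have [measurable]: "p \<in> borel_measurable borel"
      using pc by (rule borel_measurable_continuous_onI)
    have i1: "integrable lborel (\<lambda>x. G x * \<psi> (cos (x - x0)))"
      by (rule integrable_mult_bounded[OF G, where B=B]) (use bd in auto)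
    have bp: "\<bar>p (cos (x - x0))\<bar> \<le> B + e" for x
      using p(2)[of "cos (x - x0)"] bd[of "cos (x - x0)"] by simp
    have i2: "integrable lborel (\<lambda>x. G x * p (cos (x - x0)))"
      by (rule integrable_mult_bounded[OF G, where B="B + e"]) (use bp in auto)
    have "(LINT x|lborel. G x * \<psi> (cos (x - x0))) = (LINT x|lborel. G x * \<psi> (cos (x - x0)) - G x * p (cos (x - x0)))"
      using Bochner_Integration.integral_diff[OF i1 i2] zero_moment_poly[OF p(1), of x0] by simp
    also have "\<bar>\<dots>\<bar> \<le> (LINT x|lborel. \<bar>G x * \<psi> (cos (x - x0)) - G x * p (cos (x - x0))\<bar>)"
      by (rule integral_abs_bound)
    also have "\<dots> \<le> (LINT x|lborel. e * \<bar>G x\<bar>)"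
    proof (rule integral_mono)
      show "integrable lborel (\<lambda>x. \<bar>G x * \<psi> (cos (x - x0)) - G x * p (cos (x - x0))\<bar>)"
        using i1 i2 by auto
      show "integrable lborel (\<lambda>x. e * \<bar>G x\<bar>)" using G by auto
      fix x
      have "\<bar>G x * \<psi> (cos (x - x0)) - G x * p (cos (x - x0))\<bar> = \<bar>\<psi> (cos (x - x0)) - p (cos (x - x0))\<bar> * \<bar>G x\<bar>"
        by (simp add: abs_mult[symmetric] algebra_simps)
      also have "\<dots> \<le> e * \<bar>G x\<bar>"
        using p(2)[of "cos (x - x0)"] by (intro mult_right_mono) auto
      finally show "\<bar>G x * \<psi> (cos (x - x0)) - G x * p (cos (x - x0))\<bar> \<le> e * \<bar>G x\<bar>" .
    qed
    finally show ?thesis by simp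
  qed
  note * = this
  show ?thesis
  proof (rule ccontr)
    assume ne: "\<not> ?thesis"
    define I where "I = (LINT x|lborel. G x * \<psi> (cos (x - x0)))"
    define J where "J = (LINT x|lborel. \<bar>G x\<bar>)"
    have I: "0 < \<bar>I\<bar>" using ne by (simp add: I_def)
    have J: "0 \<le> J" by (simp add: J_def)
    have "0 < \<bar>I\<bar> / (2 * (J + 1))" using I J by simp
    from *[OF this] have "\<bar>I\<bar> \<le> (\<bar>I\<bar> / (2 * (J + 1))) * J"
      unfolding I_def J_def .
    also have "\<dots> < \<bar>I\<bar>" using I J by (simp add: field_simps) (smt (verit, best) mult_nonneg_nonneg)
    finally show False by simp
  qed
qed

lemma zero_on_interval:
  assumes ab: "-pi \<le> a" "a < b" "b \<le> pi"
  shows "(LINT x|lborel. G x * indicator {a<..<b} x) = 0"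
proof -
  define x0 where "x0 = (a + b) / 2"
  define d where "d = (b - a) / 2"
  have d: "0 < d" "d \<le> pi" "a = x0 - d" "b = x0 + d" using ab by (auto simp: x0_def d_def field_simps)
  define \<psi> where "\<psi> n y = min 1 (max 0 (real n * (y - cos d)))" for n y
  have lim: "(\<lambda>n. \<psi> n y) \<longlonglongrightarrow> (if y > cos d then 1 else 0)" for y
  proof (cases "y > cos d")
    case True
    obtain N where N: "real N * (y - cos d) > 1" using reals_Archimedean3 True by (metis diff_gt_0_iff_gt)
    have "\<psi> n y = 1" if "n \<ge> N" for n
    proof -
      have "real n * (y - cos d) \<ge> real N * (y - cos d)" using that True by (intro mult_right_mono) auto
      then show ?thesis using N by (simp add: \<psi>_def)
    qed
    then have "eventually (\<lambda>n. \<psi> n y = 1) sequentially" using eventually_sequentially by blast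
    then show ?thesis using True by (simp add: tendsto_eventually)
  next
    case False
    then have "\<psi> n y = 0" for n
      by (simp add: \<psi>_def mult_nonneg_nonpos max_def) (smt (verit) mult_nonneg_nonpos of_nat_0_le_iff)
    then show ?thesis using False by simp
  qed
  have mem: "cos (x - x0) > cos d \<longleftrightarrow> x \<in> {a<..<b}" if x: "x \<in> {-pi..pi}" for x
  proof -
    define y where "y = \<bar>x - x0\<bar>"
    have cy: "cos (x - x0) = cos y" by (simp add: y_def)
    have y: "0 \<le> y" "y \<le> 2 * pi - d" using x ab d by (auto simp: y_def abs_le_iff)
    have "cos y > cos d \<longleftrightarrow> y < d"
    proof (cases "y \<le> pi")
      case True
      then show ?thesis using y d cos_mono_less_eq[of d y] by auto
    next
      case False
      have "cos y = cos (2 * pi - y)" by (simp add: cos_diff)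
      moreover have "cos (2 * pi - y) \<le> cos d"
        using False y d by (intro cos_monotone_0_pi_le) auto
      ultimately show ?thesis using False d by auto
    qed
    then show ?thesis unfolding cy using d by (auto simp: y_def abs_less_iff)
  qed
  have "(\<lambda>n. LINT x|lborel. G x * \<psi> n (cos (x - x0))) \<longlonglongrightarrow> (LINT x|lborel. G x * indicator {a<..<b} x)"
  proof (rule integral_dominated_convergence[where w="\<lambda>x. \<bar>G x\<bar>"])
    show "integrable lborel (\<lambda>x. \<bar>G x\<bar>)" using G by auto
    show "(\<lambda>x. G x * \<psi> n (cos (x - x0))) \<in> borel_measurable lborel" for n
      using G unfolding \<psi>_def by measurable
    show "(\<lambda>x. G x * indicator {a<..<b} x) \<in> borel_measurable lborel"
      using G by measurable
    show "AE x in lborel. norm (G x * \<psi> n (cos (x - x0))) \<le> \<bar>G x\<bar>" for n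
      by (auto simp: \<psi>_def abs_mult intro!: mult_left_le)
    show "AE x in lborel. (\<lambda>n. G x * \<psi> n (cos (x - x0))) \<longlonglongrightarrow> G x * indicator {a<..<b} x"
    proof (intro AE_I2)
      fix x
      show "(\<lambda>n. G x * \<psi> n (cos (x - x0))) \<longlonglongrightarrow> G x * indicator {a<..<b} x"
      proof (cases "x \<in> {-pi..pi}")
        case True
        have "(\<lambda>n. \<psi> n (cos (x - x0))) \<longlonglongrightarrow> indicator {a<..<b} x"
          using lim[of "cos (x - x0)"] unfolding mem[OF True] by (simp only: indicator_def of_bool_def)
        then show ?thesis by (rule tendsto_mult_left)
      next
        case False
        then show ?thesis using vanish[of x] by simp
      qed
    qed
  qed
  moreover have "(LINT x|lborel. G x * \<psi> n (cos (x - x0))) = 0" for n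
    by (rule zero_moment_continuous[where B=1]) (auto simp: \<psi>_def intro!: continuous_intros)
  ultimately have "(\<lambda>n. 0) \<longlonglongrightarrow> (LINT x|lborel. G x * indicator {a<..<b} x)" by simp
  then show ?thesis by (simp add: LIMSEQ_const_iff)
qed

text \<open>
  The positive and negative parts of \<open>G\<close> are densities of finite measures that agree on all half-lines,
  hence everywhere.
\<close>
lemma AE_zero_of_fourier_zero: "AE x in lborel. G x = 0"
proof -
  have [measurable]: "G \<in> borel_measurable borel" using G by auto
  have half: "(LINT x|lborel. G x * indicator {a<..} x) = 0" for a
  proof (cases "a < pi")
    case True
    have "(LINT x|lborel. G x * indicator {a<..} x) = (LINT x|lborel. G x * indicator {max a (-pi)<..<pi} x)"
    proof (rule integral_cong_AE)
      have "AE x in lborel. x \<noteq> pi \<and> x \<noteq> -pi" using AE_lborel_singleton by auto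
      then show "AE x in lborel. G x * indicator {a<..} x = G x * indicator {max a (-pi)<..<pi} x"
        by eventually_elim (use vanish in \<open>auto simp: indicator_def\<close>)
    qed auto
    also have "\<dots> = 0" using True by (intro zero_on_interval) auto
    finally show ?thesis .
  next
    case False
    have "(\<lambda>x. G x * indicator {a<..} x) = (\<lambda>x. 0)"
      using False vanish by (fastforce simp: indicator_def)
    then show ?thesis by simp
  qed
  define f where "f x = ennreal (G x)" for x
  define g where "g x = ennreal (- G x)" for x
  have [measurable]: "f \<in> borel_measurable borel" "g \<in> borel_measurable borel"
    unfolding f_def[abs_def] g_def[abs_def] by measurable
  have fin: "(\<integral>\<^sup>+x. f x \<partial>lborel) < \<infinity>" "(\<integral>\<^sup>+x. g x \<partial>lborel) < \<infinity>"
    using G unfolding f_def g_def real_integrable_def by (auto simp: less_top)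
  have le: "(\<integral>\<^sup>+x. f x * indicator A x \<partial>lborel) \<le> (\<integral>\<^sup>+x. f x \<partial>lborel)"
    "(\<integral>\<^sup>+x. g x * indicator A x \<partial>lborel) \<le> (\<integral>\<^sup>+x. g x \<partial>lborel)" for A
    by (auto intro!: nn_integral_mono simp: indicator_def)
  have eq: "density lborel f = density lborel g"
  proof (rule measure_eqI_lessThan)
    show "emeasure (density lborel f) {x<..} < \<infinity>" for x
      by (simp add: emeasure_density) (use le(1) fin(1) order_le_less_trans in fastforce)
    show "emeasure (density lborel f) {x<..} = emeasure (density lborel g) {x<..}" for x
    proof -
      have i: "integrable lborel (\<lambda>y. G y * indicator {x<..} y)"
        by (rule integrable_mult_bounded[OF G, where B=1]) (auto simp: indicator_def)
      have e1: "ennreal (G y * indicator {x<..} y) = f y * indicator {x<..} y"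
        "ennreal (- (G y * indicator {x<..} y)) = g y * indicator {x<..} y" for y
        by (auto simp: f_def g_def indicator_def)
      have "enn2real (\<integral>\<^sup>+y. f y * indicator {x<..} y \<partial>lborel) = enn2real (\<integral>\<^sup>+y. g y * indicator {x<..} y \<partial>lborel)"
        using real_lebesgue_integral_def[OF i] half[of x] unfolding e1 by simp
      moreover have "(\<integral>\<^sup>+y. f y * indicator {x<..} y \<partial>lborel) < \<infinity>" "(\<integral>\<^sup>+y. g y * indicator {x<..} y \<partial>lborel) < \<infinity>"
        using le fin order_le_less_trans by blast+
      ultimately have "(\<integral>\<^sup>+y. f y * indicator {x<..} y \<partial>lborel) = (\<integral>\<^sup>+y. g y * indicator {x<..} y \<partial>lborel)"
        by (metis ennreal_enn2real infinity_ennreal_def)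
      then show ?thesis by (simp add: emeasure_density)
    qed
  qed auto
  have "AE x in lborel. f x = g x"
    by (rule sigma_finite_measure.density_unique[OF lborel.sigma_finite_measure_axioms _ _ eq]) auto
  then show ?thesis
  proof eventually_elim
    case (elim x)
    then show ?case
      by (cases "G x \<ge> 0") (auto simp: f_def g_def ennreal_neg ennreal_eq_0_iff)
  qed
qed

end

lemma sobolev_space_set_integrable:
  assumes f: "f \<in> sobolev_space r"
  shows "set_integrable lborel {-pi..pi} f"
proof -
  have [measurable]: "f \<in> borel_measurable borel" and f2: "set_integrable lborel {-pi..pi} (\<lambda>x. (f x)\<^sup>2)"
    using f by (auto simp: sobolev_space_def)
  have "set_integrable lborel {-pi..pi} (\<lambda>x. 1 + (f x)\<^sup>2)"
    by (intro set_integral_add f2 borel_integrable_atLeastAtMost' continuous_intros)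
  then have 1: "integrable lborel (\<lambda>x. indicator {-pi..pi} x *\<^sub>R (1 + (f x)\<^sup>2))"
    by (simp add: set_integrable_def)
  have le: "\<bar>y\<bar> \<le> 1 + y\<^sup>2" for y :: real
    using sum_squares_bound[of 1 "\<bar>y\<bar>"] by simp
  show ?thesis
    unfolding set_integrable_def
  proof (rule Bochner_Integration.integrable_bound[OF 1])
    show "AE x in lborel. norm (indicator {-pi..pi} x *\<^sub>R f x) \<le> norm (indicator {-pi..pi} x *\<^sub>R (1 + (f x)\<^sup>2))"
      using le by (intro AE_I2) (auto simp: indicator_def abs_of_nonneg add_nonneg_nonneg)
  qed measurable
qed

text \<open>
  The difference between \<open>f\<close> and the sum of its Fourier series has vanishing coefficients.
\<close>
lemma sobolev_space_AE_eq_fourier_series: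
  assumes f: "f \<in> sobolev_space r"
    and c: "(\<lambda>k. norm (fourier_coeff f k)) summable_on UNIV"
  shows "AE x in lborel. x \<in> {-pi..pi} \<longrightarrow> f x = Re (fourier_series (fourier_coeff f) x)"
proof -
  let ?c = "fourier_coeff f"
  have [measurable]: "fourier_series ?c \<in> borel_measurable borel" by (rule fourier_series_measurable[OF c])
  define F where "F x = indicator {-pi..pi} x * f x" for x
  define S where "S x = indicator {-pi..pi} x * Re (fourier_series ?c x)" for x
  have F: "integrable lborel F"
    using sobolev_space_set_integrable[OF f] by (simp add: F_def[abs_def] set_integrable_def)
  have S: "integrable lborel S"
    using borel_integrable_atLeastAtMost'[of "-pi" pi "\<lambda>x. Re (fourier_series ?c x)"] continuous_on_fourier_series[OF c]
    by (simp add: S_def[abs_def] set_integrable_def continuous_on_Re)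
  have coef: "(LINT x|lborel. complex_of_real (F x) * exp (- (\<i> * of_int k * of_real x))) = ?c k * of_real (2 * pi)"
    "(LINT x|lborel. complex_of_real (S x) * exp (- (\<i> * of_int k * of_real x))) = ?c k * of_real (2 * pi)" for k
    using fourier_coeff_fourier_series[OF c hermitian_fourier_coeff, of k]
    by (auto simp: fourier_coeff_def set_lebesgue_integral_def F_def S_def scaleR_conv_of_real mult.assoc field_simps)
  have int: "integrable lborel (\<lambda>x. complex_of_real (g x) * exp (- (\<i> * of_int k * of_real x)))"
    if "integrable lborel g" for g k
    by (rule integrable_mult_bounded[where B=1]) (use that in auto)
  have "AE x in lborel. F x - S x = 0"
  proof (rule AE_zero_of_fourier_zero)
    show "integrable lborel (\<lambda>x. F x - S x)" using F S by auto
    show "F x - S x = 0" if "x \<notin> {-pi..pi}" for x using that by (simp add: F_def S_def)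
    show "(LINT x|lborel. complex_of_real (F x - S x) * exp (- (\<i> * of_int k * of_real x))) = 0" for k
      using Bochner_Integration.integral_diff[OF int[OF F, of k] int[OF S, of k]]
      by (simp add: coef left_diff_distrib)
  qed
  then show ?thesis
    by eventually_elim (auto simp: F_def S_def)
qed

section \<open>Fourier coefficients of time integrals\<close>

text \<open>
  The points \<open>x\<close> at which \<open>F\<close> is measurable in \<open>s\<close> are dense, because their complement is a null set.
  So \<open>x\<close> can be approximated by a step function \<open>g n x\<close> with countably many values among these points;
  \<open>F s (g n x)\<close> is jointly measurable and converges to \<open>F s x\<close> by continuity.
\<close>
lemma Caratheodory_measurable:
  fixes F :: "real \<Rightarrow> real \<Rightarrow> real"
  assumes cont: "\<And>s. continuous_on UNIV (F s)"
    and meas: "AE x in lborel. (\<lambda>s. F s x) \<in> borel_measurable lborel"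
  shows "case_prod F \<in> borel_measurable (lborel \<Otimes>\<^sub>M lborel)"
proof -
  obtain N where N: "N \<in> null_sets lborel" "\<And>x. x \<notin> N \<Longrightarrow> (\<lambda>s. F s x) \<in> borel_measurable lborel"
    using meas by (auto elim!: AE_E3)
  have ex: "\<exists>y. y \<notin> N \<and> y \<in> {real_of_int j / real (Suc n) .. real_of_int (j + 1) / real (Suc n)}" for n j
  proof (rule ccontr)
    assume "\<not> ?thesis"
    then have sub: "{real_of_int j / real (Suc n) .. real_of_int (j + 1) / real (Suc n)} \<subseteq> N" by auto
    then have "{real_of_int j / real (Suc n) .. real_of_int (j + 1) / real (Suc n)} \<in> null_sets lborel"
      using N(1) by (rule null_sets_subset[rotated 2]) auto
    moreover have "real_of_int j / real (Suc n) < real_of_int (j + 1) / real (Suc n)"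
      by (intro divide_strict_right_mono) auto
    ultimately show False
      by (simp add: null_sets_def)
  qed
  define h where "h n j = (SOME y. y \<notin> N \<and> y \<in> {real_of_int j / real (Suc n) .. real_of_int (j + 1) / real (Suc n)})"
    for n j
  have h: "h n j \<notin> N" "h n j \<in> {real_of_int j / real (Suc n) .. real_of_int (j + 1) / real (Suc n)}" for n j
    using someI_ex[OF ex, of j n] unfolding h_def by auto
  \<comment> \<open>replaces \<open>x\<close> by the chosen good point in its cell of length \<open>1 / (n + 1)\<close>\<close>
  define g where "g n x = h n \<lfloor>x * real (Suc n)\<rfloor>" for n x
  have gx: "\<bar>g n x - x\<bar> \<le> 1 / real (Suc n)" for n x
  proof -
    define j where "j = \<lfloor>x * real (Suc n)\<rfloor>"
    have "real_of_int j \<le> x * real (Suc n)" "x * real (Suc n) \<le> real_of_int (j + 1)"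
      unfolding j_def by linarith+
    then have "real_of_int j / real (Suc n) \<le> x" "x \<le> real_of_int (j + 1) / real (Suc n)"
      by (simp_all add: divide_le_eq le_divide_eq del: of_nat_Suc)
    moreover have "real_of_int (j + 1) / real (Suc n) = real_of_int j / real (Suc n) + 1 / real (Suc n)"
      by (simp add: add_divide_distrib)
    ultimately show ?thesis
      using h(2)[of n j] unfolding g_def j_def[symmetric] atLeastAtMost_iff abs_le_iff by linarith
  qed
  have glim: "(\<lambda>n. g n x) \<longlonglongrightarrow> x" for x
  proof (rule LIM_zero_cancel, rule Lim_null_comparison)
    show "\<forall>\<^sub>F n in sequentially. norm (g n x - x) \<le> 1 / real (Suc n)"
      using gx by auto
    show "(\<lambda>n. 1 / real (Suc n)) \<longlonglongrightarrow> 0"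
      using LIMSEQ_inverse_real_of_nat by (simp add: inverse_eq_divide)
  qed
  show ?thesis
  proof (rule borel_measurable_LIMSEQ_real)
    show "(\<lambda>n. (\<lambda>p. F (fst p) (g n (snd p))) p) \<longlonglongrightarrow> case_prod F p" for p
    proof -
      have "isCont (F (fst p)) (snd p)"
        using cont[of "fst p"] by (simp add: continuous_on_eq_continuous_at)
      then have "(\<lambda>n. F (fst p) (g n (snd p))) \<longlonglongrightarrow> F (fst p) (snd p)"
        using glim by (rule isCont_tendsto_compose)
      then show ?thesis by (simp add: case_prod_unfold)
    qed
    show "(\<lambda>p. F (fst p) (g n (snd p))) \<in> borel_measurable (lborel \<Otimes>\<^sub>M lborel)" for n
      unfolding g_def
    proof (rule measurable_compose_countable[where f="\<lambda>i p. F (fst p) (h n i)"])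
      show "(\<lambda>p. F (fst p) (h n i)) \<in> borel_measurable (lborel \<Otimes>\<^sub>M lborel)" for i
        using N(2)[OF h(1)[of n i]] by (rule measurable_compose[OF measurable_fst])
      have "(\<lambda>p::real\<times>real. snd p * real (Suc n)) \<in> borel_measurable (lborel \<Otimes>\<^sub>M lborel)"
        by measurable
      then show "(\<lambda>p::real\<times>real. \<lfloor>snd p * real (Suc n)\<rfloor>) \<in> measurable (lborel \<Otimes>\<^sub>M lborel) (count_space UNIV)"
        by (rule measurable_compose[OF _ measurable_real_floor])
    qed
  qed
qed

text \<open>
  Fubini's theorem on the rectangle \<open>[a, b] \<times> [-\<pi>, \<pi>]\<close>. Integrability in \<open>s\<close> is assumed for almost every
  \<open>x\<close> only, which is what Duhamel's formula provides.
\<close>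
lemma
  fixes F :: "real \<Rightarrow> real \<Rightarrow> real"
  assumes cont: "\<And>s. s \<in> {a..b} \<Longrightarrow> continuous_on UNIV (F s)"
    and bd: "\<And>s x. s \<in> {a..b} \<Longrightarrow> \<bar>F s x\<bar> \<le> B"
    and int: "AE x in lborel. set_integrable lborel {a..b} (\<lambda>s. F s x)"
  shows fourier_coeff_integrable: "set_integrable lborel {a..b} (\<lambda>s. fourier_coeff (F s) k)"
    and integral_measurable: "(\<lambda>x. LINT s:{a..b}|lborel. F s x) \<in> borel_measurable borel"
    and fourier_coeff_integral: "fourier_coeff (\<lambda>x. LINT s:{a..b}|lborel. F s x) k
      = (LINT s:{a..b}|lborel. fourier_coeff (F s) k)"
proof -
  define F' where "F' s x = indicator {a..b} s * F s x" for s x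
  have cp: "case_prod F' \<in> borel_measurable (lborel \<Otimes>\<^sub>M lborel)"
  proof (rule Caratheodory_measurable)
    show "continuous_on UNIV (F' s)" for s
      unfolding F'_def[abs_def] using cont[of s]
      by (cases "s \<in> {a..b}") (auto intro!: continuous_intros)
    show "AE x in lborel. (\<lambda>s. F' s x) \<in> borel_measurable lborel"
      using int by eventually_elim (auto simp: F'_def set_integrable_def)
  qed
  note [measurable] = cp
  have LF: "(LINT s:{a..b}|lborel. F s x) = (LINT s|lborel. F' s x)" for x
    by (simp add: F'_def set_lebesgue_integral_def)
  have "(\<lambda>x. LINT s|lborel. F' s x) \<in> borel_measurable lborel"
    by measurable
  then show "(\<lambda>x. LINT s:{a..b}|lborel. F s x) \<in> borel_measurable borel"
    unfolding LF by simp
  define e where "e x = exp (- (\<i> * of_int k * complex_of_real x))" for x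
  have [measurable]: "e \<in> borel_measurable borel" unfolding e_def[abs_def] by measurable
  define H where "H s x = complex_of_real (F' s x) * (indicator {-pi..pi} x *\<^sub>R e x)" for s x
  have Hm: "case_prod H \<in> borel_measurable (lborel \<Otimes>\<^sub>M lborel)"
    unfolding H_def[abs_def] by measurable
  have Hi: "integrable (lborel \<Otimes>\<^sub>M lborel) (case_prod H)"
  proof (rule Bochner_Integration.integrable_bound[OF _ Hm])
    show "integrable (lborel \<Otimes>\<^sub>M lborel) (\<lambda>p. B * indicator ({a..b} \<times> {-pi..pi}) p :: real)"
    proof (intro integrable_mult_right integrable_real_indicator)
      show "{a..b} \<times> {-pi..pi} \<in> sets (lborel \<Otimes>\<^sub>M (lborel::real measure))" by simp
      show "emeasure (lborel \<Otimes>\<^sub>M lborel) ({a..b} \<times> {-pi..pi}) < \<infinity>"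
        by (subst lborel.emeasure_pair_measure_Times) (auto simp: ennreal_mult_less_top emeasure_lborel_Icc_eq)
    qed
    show "AE p in lborel \<Otimes>\<^sub>M lborel. norm (case_prod H p) \<le> norm (B * indicator ({a..b} \<times> {-pi..pi}) p :: real)"
    proof (intro AE_I2)
      fix p :: "real \<times> real"
      obtain s x where p: "p = (s, x)" by (cases p)
      show "norm (case_prod H p) \<le> norm (B * indicator ({a..b} \<times> {-pi..pi}) p :: real)"
        using bd[of s x] by (auto simp: p H_def F'_def e_def norm_mult indicator_def)
    qed
  qed
  have Hx: "(LINT x|lborel. H s x) = indicator {a..b} s *\<^sub>R (fourier_coeff (F s) k * of_real (2 * pi))" for s
    by (cases "s \<in> {a..b}")
       (auto simp: H_def F'_def fourier_coeff_def set_lebesgue_integral_def e_def scaleR_conv_of_real mult_ac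
         intro!: Bochner_Integration.integral_cong)
  have Hs: "(LINT s|lborel. H s x) = indicator {-pi..pi} x *\<^sub>R (complex_of_real (LINT s:{a..b}|lborel. F s x) * e x)" for x
  proof -
    have "(LINT s|lborel. H s x) = (LINT s|lborel. complex_of_real (F' s x)) * (indicator {-pi..pi} x *\<^sub>R e x)"
      unfolding H_def by (rule integral_mult_left_zero)
    also have "(LINT s|lborel. complex_of_real (F' s x)) = complex_of_real (LINT s:{a..b}|lborel. F s x)"
      unfolding LF by (rule integral_complex_of_real)
    finally show ?thesis by (simp add: scaleR_conv_of_real mult_ac)
  qed
  have "integrable lborel (\<lambda>s. (LINT x|lborel. H s x) / of_real (2 * pi))"
    using lborel_pair.integrable_fst[OF Hi] by (rule integrable_divide)
  then show "set_integrable lborel {a..b} (\<lambda>s. fourier_coeff (F s) k)"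
    unfolding Hx set_integrable_def by (simp add: scaleR_conv_of_real)
  have "(LINT x|lborel. LINT s|lborel. H s x) = (LINT s|lborel. LINT x|lborel. H s x)"
    by (rule lborel_pair.Fubini_integral[OF Hi])
  then have "fourier_coeff (\<lambda>x. LINT s:{a..b}|lborel. F s x) k * of_real (2 * pi)
      = (LINT s:{a..b}|lborel. fourier_coeff (F s) k * of_real (2 * pi))"
    unfolding Hx Hs fourier_coeff_def set_lebesgue_integral_def e_def by simp
  also have "\<dots> = (LINT s:{a..b}|lborel. fourier_coeff (F s) k) * of_real (2 * pi)"
    by (rule set_integral_mult_left) 
  finally show "fourier_coeff (\<lambda>x. LINT s:{a..b}|lborel. F s x) k
      = (LINT s:{a..b}|lborel. fourier_coeff (F s) k)"
    by simp
qed

section \<open>The KdV equation in twisted Fourier variables\<close>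

lemma
  assumes "\<And>k. norm (f k) = norm (g k)"
  shows in_H_cong_norm: "in_H r f \<longleftrightarrow> in_H r g" and H_norm_cong_norm: "H_norm r f = H_norm r g"
  using assms by (simp_all add: in_H_def square_summable_def H_norm_def l2_norm_def)

lemma weight_eq: "(norm (bracket k ^ r *\<^sub>R z))\<^sup>2 = (1 + (real_of_int k)\<^sup>2) ^ r * (norm z)\<^sup>2"
proof -
  have "(bracket k ^ r)\<^sup>2 = ((bracket k)\<^sup>2) ^ r"
    by (simp only: power_mult[symmetric] mult.commute)
  then show ?thesis by (simp add: power_mult_distrib bracket_power2)
qed

lemma sobolev_norm_eq_H_norm: "sobolev_norm r f = H_norm r (fourier_coeff f)"
  unfolding sobolev_norm_def H_norm_def l2_norm_def weight_eq ..

lemma in_H_fourier_coeff: "f \<in> sobolev_space r \<Longrightarrow> in_H r (fourier_coeff f)"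
  unfolding sobolev_space_def in_H_def square_summable_def weight_eq by simp

lemma fourier_coeff_power2:
  assumes f: "f \<in> sobolev_space r" and r: "1 \<le> r"
  shows "fourier_coeff (\<lambda>x. (f x)\<^sup>2) = conv (fourier_coeff f) (fourier_coeff f)"
proof -
  let ?c = "fourier_coeff f"
  have s: "(\<lambda>k. norm (?c k)) summable_on UNIV"
    by (rule in_H_summable_norm[OF in_H_fourier_coeff[OF f] r])
  have [measurable]: "f \<in> borel_measurable borel" using f by (simp add: sobolev_space_def)
  have [measurable]: "fourier_series ?c \<in> borel_measurable borel" by (rule fourier_series_measurable[OF s])
  have "fourier_coeff (\<lambda>x. (f x)\<^sup>2) k = fourier_coeff (\<lambda>x. (Re (fourier_series ?c x))\<^sup>2) k" for k
    by (rule fourier_coeff_cong_AE) (use sobolev_space_AE_eq_fourier_series[OF f s] in \<open>auto elim!: eventually_mono\<close>)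
  then show ?thesis
    using fourier_coeff_square[OF s hermitian_fourier_coeff] by auto
qed

text \<open>
  The resonance factor \<open>exp (- 3 i s y)\<close>, used with \<open>y = k a (k - a)\<close>.
\<close>
definition phase :: "real \<Rightarrow> int \<Rightarrow> complex" where
  "phase s y = exp (- (3 * \<i> * of_real s * of_int y))"

lemma norm_phase [simp]: "norm (phase s y) = 1"
  using norm_exp_i_times[of "- 3 * s * of_int y"] by (simp add: phase_def mult_ac)

lemma continuous_on_phase [continuous_intros]: "continuous_on S (\<lambda>s. phase s y)"
  unfolding phase_def by (intro continuous_intros)

text \<open>
  The coefficients of \<open>exp (s \<partial>\<^sub>x\<^sup>3) \<partial>\<^sub>x (f' g')\<close> in terms of the twisted coefficients of the factors
  \<open>f'\<close> and \<open>g'\<close>.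
\<close>
definition twisted_flux :: "real \<Rightarrow> (int \<Rightarrow> complex) \<Rightarrow> (int \<Rightarrow> complex) \<Rightarrow> int \<Rightarrow> complex" where
  "twisted_flux s f g k = \<i> * of_int k * (\<Sum>\<^sub>\<infinity>a. phase s (k * a * (k - a)) * (f a * g (k - a)))"

lemma norm_infsum_phase_le:
  assumes "in_H r f" "in_H r g" "1 \<le> r"
  shows "norm (\<Sum>\<^sub>\<infinity>a. phase s (k * a * (k - a)) * (f a * g (k - a))) \<le> abs_conv f g k"
  unfolding conv_def
  by (rule order_trans[OF norm_infsum_bound])
     (use conv_summable[OF assms, of k] in \<open>simp_all add: norm_mult\<close>)

lemma
  assumes f: "in_H (Suc r) f" and g: "in_H (Suc r) g"
  shows in_H_twisted_flux: "in_H r (twisted_flux s f g)"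
    and H_norm_twisted_flux: "H_norm r (twisted_flux s f g) \<le> conv_const (Suc r) * H_norm (Suc r) f * H_norm (Suc r) g"
proof -
  have *: "bracket k ^ r * norm (twisted_flux s f g k) \<le> bracket k ^ Suc r * norm (abs_conv f g k)" for k
  proof -
    have "norm (twisted_flux s f g k) \<le> bracket k * abs_conv f g k"
      unfolding twisted_flux_def norm_mult
      using norm_infsum_phase_le[OF f g] abs_le_bracket[of k]
      by (intro mult_mono) auto
    then have "bracket k ^ r * norm (twisted_flux s f g k) \<le> bracket k ^ r * (bracket k * abs_conv f g k)"
      by (intro mult_left_mono) auto
    then show ?thesis by (simp add: conv_nonneg mult_ac)
  qed
  have c: "in_H (Suc r) (abs_conv f g)" by (rule in_H_abs_conv[OF f g]) simp
  show "in_H r (twisted_flux s f g)" by (rule in_H_mono[OF c *])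
  have "H_norm r (twisted_flux s f g) \<le> H_norm (Suc r) (abs_conv f g)" by (rule H_norm_mono[OF c *])
  also have "\<dots> \<le> conv_const (Suc r) * H_norm (Suc r) f * H_norm (Suc r) g"
    by (rule H_norm_abs_conv[OF f g]) simp
  finally show "H_norm r (twisted_flux s f g) \<le> conv_const (Suc r) * H_norm (Suc r) f * H_norm (Suc r) g" .
qed

lemma continuous_on_twisted_flux:
  assumes cont: "\<And>k. continuous_on S (\<lambda>s. p s k)" "\<And>k. continuous_on S (\<lambda>s. q s k)"
    and p: "\<And>s. s \<in> S \<Longrightarrow> in_H 2 (p s)" "\<And>s. s \<in> S \<Longrightarrow> H_norm 2 (p s) \<le> P"
    and q: "\<And>s. s \<in> S \<Longrightarrow> in_H 2 (q s)" "\<And>s. s \<in> S \<Longrightarrow> H_norm 2 (q s) \<le> Q"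
  shows "continuous_on S (\<lambda>s. twisted_flux s (p s) (q s) k)"
  unfolding twisted_flux_def
proof (rule continuous_on_mult[OF continuous_on_const], rule continuous_on_infsum)
  show "(\<lambda>a. P * Q * (norm (inverse (bracket a)))\<^sup>2) summable_on UNIV"
    using inverse_bracket_square_summable unfolding square_summable_def by (rule summable_on_cmult_right)
  show "continuous_on S (\<lambda>s. phase s (k * a * (k - a)) * (p s a * q s (k - a)))" for a
    by (intro continuous_intros cont)
  fix a s assume s: "s \<in> S"
  have "bracket a ^ 2 * norm (p s a) \<le> P"
    using norm_le_H_norm[OF p(1)[OF s], of a] p(2)[OF s] by linarith
  then have 1: "norm (p s a) \<le> P * (inverse (bracket a))\<^sup>2"
    using zero_less_power[OF bracket_pos[of a], of 2] by (simp add: power_inverse divide_inverse[symmetric] pos_le_divide_eq mult.commute)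
  have "1 * norm (q s (k - a)) \<le> bracket (k - a) ^ 2 * norm (q s (k - a))"
    by (intro mult_right_mono one_le_power) auto
  then have 2: "norm (q s (k - a)) \<le> Q"
    using norm_le_H_norm[OF q(1)[OF s], of "k - a"] q(2)[OF s] by linarith
  have P: "0 \<le> P" using order_trans[OF H_norm_nonneg p(2)[OF s]] .
  have "norm (p s a) * norm (q s (k - a)) \<le> (P * (inverse (bracket a))\<^sup>2) * Q"
    using 1 2 P by (intro mult_mono) auto
  then show "norm (phase s (k * a * (k - a)) * (p s a * q s (k - a))) \<le> P * Q * (norm (inverse (bracket a)))\<^sup>2"
    by (simp add: norm_mult mult_ac)
qed

text \<open>
  The identity \<open>k\<^sup>3 = a\<^sup>3 + (k - a)\<^sup>3 + 3 k a (k - a)\<close>, exponentiated.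
\<close>
lemma phase_cube:
  "exp (- (\<i> * of_real s * of_int k ^ 3)) * (f a * g (k - a))
    = phase s (k * a * (k - a)) *
      ((exp (- (\<i> * of_real s * of_int a ^ 3)) * f a) * (exp (- (\<i> * of_real s * of_int (k - a) ^ 3)) * g (k - a)))"
proof -
  have "exp (- (\<i> * of_real s * of_int k ^ 3)) = phase s (k * a * (k - a)) *
      (exp (- (\<i> * of_real s * of_int a ^ 3)) * exp (- (\<i> * of_real s * of_int (k - a) ^ 3)))"
    unfolding phase_def exp_add[symmetric]
    by (rule arg_cong[where f=exp]) (simp add: power3_eq_cube algebra_simps)
  then show ?thesis by simp
qed

lemma norm_exp_cube [simp]:
  "norm (exp (- (\<i> * complex_of_real t * of_int k ^ 3))) = 1" 
  "norm (exp (\<i> * complex_of_real t * of_int k ^ 3)) = 1"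
  using norm_exp_i_times[of "- t * of_int k ^ 3"] norm_exp_i_times[of "t * of_int k ^ 3"] by (simp_all add: mult_ac)

text \<open>
  The action of the Airy group on coefficients. It changes phases only, so all the norms are preserved.
\<close>
definition twist :: "real \<Rightarrow> (int \<Rightarrow> complex) \<Rightarrow> int \<Rightarrow> complex" where
  "twist t c k = exp (- (\<i> * of_real t * of_int k ^ 3)) * c k"

lemma norm_twist [simp]: "norm (twist t c k) = norm (c k)"
  by (simp add: twist_def norm_mult)

lemma twist_twisted_flux: "exp (- (\<i> * of_real s * of_int k ^ 3)) * (\<i> * of_int k * conv c c k) = twisted_flux s (twist s c) (twist s c) k"
proof -
  have "exp (- (\<i> * of_real s * of_int k ^ 3)) * (\<i> * of_int k * conv c c k)
    = \<i> * of_int k * (\<Sum>\<^sub>\<infinity>a. exp (- (\<i> * of_real s * of_int k ^ 3)) * (c a * c (k - a)))"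
    unfolding infsum_cmult_right' by (simp add: conv_def mult_ac)
  also have "\<dots> = twisted_flux s (twist s c) (twist s c) k"
    unfolding twisted_flux_def phase_cube twist_def ..
  finally show ?thesis .
qed

text \<open>
  The bound \<open>M\<close> is a parameter of its own because the error estimate is applied on each interval \<open>[0, t\<^sub>n]\<close> with
  the supremum over that interval.
\<close>
locale kdv_bounded =
  fixes T :: real and u0 :: "real \<Rightarrow> real" and u :: "real \<Rightarrow> real \<Rightarrow> real" and M :: real
  assumes sol: "kdv_solution T u0 u"
    and mean0: "(LINT x:{-pi..pi}|lborel. u0 x) = 0"
    and H3: "\<And>t. t \<in> {0..T} \<Longrightarrow> u t \<in> sobolev_space 3"
    and bound: "\<And>t. t \<in> {0..T} \<Longrightarrow> sobolev_norm 3 (u t) \<le> M"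
begin

definition w :: "real \<Rightarrow> int \<Rightarrow> complex" where
  "w t = twist t (fourier_coeff (u t))"

lemma in_H_w: "t \<in> {0..T} \<Longrightarrow> in_H 3 (w t)"
  unfolding w_def using in_H_fourier_coeff[OF H3]
    in_H_cong_norm[of "twist t (fourier_coeff (u t))" "fourier_coeff (u t)", OF norm_twist] by blast

lemma H_norm_w: "t \<in> {0..T} \<Longrightarrow> H_norm 3 (w t) \<le> M"
  unfolding w_def H_norm_cong_norm[of "twist t (fourier_coeff (u t))" "fourier_coeff (u t)", OF norm_twist] sobolev_norm_eq_H_norm[symmetric] by (rule bound)

text \<open>
  For each \<open>s\<close> the integrand of Duhamel's formula is an absolutely convergent Fourier series in \<open>x\<close>, bounded
  uniformly in \<open>s\<close> and \<open>x\<close> because \<open>H\<^sup>3\<close> is an algebra. Hence the formula may be read off coefficient by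
  coefficient, and multiplying it by \<open>exp (- i t k\<^sup>3)\<close> removes the group from the integrand.
\<close>
lemma Duhamel_twisted:
  assumes t: "t \<in> {0..T}"
  shows "set_integrable lborel {0..t} (\<lambda>s. twisted_flux s (w s) (w s) k)"
    and "w t k = w 0 k + 1/2 * (LINT s:{0..t}|lborel. twisted_flux s (w s) (w s) k)"
proof -
  define U where "U s = fourier_coeff (u s)" for s
  define G where "G s k = \<i> * of_int k * conv (U s) (U s) k" for s k
  define F where "F s x = airy_group (- (t - s)) (dx (\<lambda>y. (u s y)\<^sup>2)) x" for s x
  define E where "E r k = exp (- (\<i> * complex_of_real r * of_int k ^ 3))" for r k
  have sT: "s \<in> {0..T}" if "s \<in> {0..t}" for s using that t by auto
  have tG: "twisted_flux s (w s) (w s) k = E s k * G s k" for s k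
    unfolding w_def twist_twisted_flux[symmetric] G_def E_def U_def ..
  define B where "B = kappa * (conv_const (Suc 2) * M * M)"
  have sumG: "(\<lambda>k. norm (G s k)) summable_on UNIV" and normG: "(\<Sum>\<^sub>\<infinity>k. norm (G s k)) \<le> B" if s: "s \<in> {0..t}" for s
  proof -
    have w3: "in_H (Suc 2) (w s)" "H_norm (Suc 2) (w s) \<le> M"
      using in_H_w[OF sT[OF s]] H_norm_w[OF sT[OF s]] by (simp_all add: numeral_3_eq_3 numeral_2_eq_2)
    have M: "0 \<le> M" using w3(2) H_norm_nonneg[of "Suc 2" "w s"] by linarith
    have nG: "norm (twisted_flux s (w s) (w s) k) = norm (G s k)" for k
      by (simp add: tG norm_mult E_def)
    note i = in_H_twisted_flux[OF w3(1) w3(1), of s]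
    show "(\<lambda>k. norm (G s k)) summable_on UNIV"
      using in_H_summable_norm[OF i] unfolding nG by simp
    have "(\<Sum>\<^sub>\<infinity>k. norm (G s k)) \<le> kappa * H_norm 2 (twisted_flux s (w s) (w s))"
      using infsum_norm_le'[OF i] unfolding nG by simp
    also have "\<dots> \<le> kappa * (conv_const (Suc 2) * H_norm (Suc 2) (w s) * H_norm (Suc 2) (w s))"
      by (intro mult_left_mono H_norm_twisted_flux w3) simp
    also have "\<dots> \<le> B"
      unfolding B_def using w3(2) M by (intro mult_left_mono mult_mono) (auto intro: mult_nonneg_nonneg)
    finally show "(\<Sum>\<^sub>\<infinity>k. norm (G s k)) \<le> B" .
  qed
  have hU: "hermitian (U s)" for s unfolding U_def by (rule hermitian_fourier_coeff)
  have hG: "hermitian (G s)" for s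
    using hermitian_conv[OF hU hU, of s s] by (simp add: hermitian_def G_def)
  have hEG: "hermitian (\<lambda>k. E r k * G s k)" for r s
    using hG[of s] by (simp add: hermitian_def E_def exp_cnj)
  have sEG: "(\<lambda>k. norm (E r k * G s k)) summable_on UNIV" if "s \<in> {0..t}" for r s
    using sumG[OF that] by (simp add: norm_mult E_def)
  have dx: "dx (\<lambda>y. (u s y)\<^sup>2) = (\<lambda>x. Re (fourier_series (G s) x))" if s: "s \<in> {0..t}" for s
    unfolding dx_def fourier_multiplier_eq_fourier_series fourier_coeff_power2[OF H3[OF sT[OF s]], simplified]
    by (simp add: G_def[abs_def] U_def)
  have F: "F s = (\<lambda>x. Re (fourier_series (\<lambda>k. E (s - t) k * G s k) x))" if s: "s \<in> {0..t}" for s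
    unfolding F_def[abs_def] dx[OF s] airy_group_def fourier_multiplier_eq_fourier_series fourier_coeff_fourier_series[OF sumG[OF s] hG]
    by (simp add: E_def)
  have coefF: "fourier_coeff (F s) k = E (s - t) k * G s k" if s: "s \<in> {0..t}" for s k
    unfolding F[OF s] by (rule fourier_coeff_fourier_series[OF sEG[OF s] hEG])
  have cont: "continuous_on UNIV (F s)" if s: "s \<in> {0..t}" for s
    unfolding F[OF s] by (intro continuous_on_Re continuous_on_fourier_series sEG s)
  have bd: "\<bar>F s x\<bar> \<le> B" if s: "s \<in> {0..t}" for s x
  proof -
    have "\<bar>F s x\<bar> \<le> norm (fourier_series (\<lambda>k. E (s - t) k * G s k) x)"
      unfolding F[OF s] by (rule abs_Re_le_cmod)
    also have "\<dots> \<le> (\<Sum>\<^sub>\<infinity>k. norm (E (s - t) k * G s k))"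
      by (rule norm_fourier_series_le[OF sEG[OF s]])
    also have "\<dots> \<le> B" using normG[OF s] by (simp add: norm_mult E_def)
    finally show ?thesis .
  qed
  have ae: "AE x in lborel. set_integrable lborel {0..t} (\<lambda>s. F s x) \<and>
      u t x = airy_group (- t) u0 x + 1/2 * (LINT s:{0..t}|lborel. F s x)"
    using sol t unfolding kdv_solution_def F_def by blast
  have int: "AE x in lborel. set_integrable lborel {0..t} (\<lambda>s. F s x)"
    using ae by eventually_elim simp
  have FI: "set_integrable lborel {0..t} (\<lambda>s. fourier_coeff (F s) k)"
    "(\<lambda>x. LINT s:{0..t}|lborel. F s x) \<in> borel_measurable borel"
    "fourier_coeff (\<lambda>x. LINT s:{0..t}|lborel. F s x) k = (LINT s:{0..t}|lborel. fourier_coeff (F s) k)" for k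
    by (rule fourier_coeff_integrable[OF _ _ int] integral_measurable[OF _ _ int]
          fourier_coeff_integral[OF _ _ int]; rule cont bd; assumption)+
  have EE: "E s k = E t k * E (s - t) k" for s k
    unfolding E_def exp_add[symmetric] by (rule arg_cong[where f=exp]) (simp add: algebra_simps)
  have eqB: "twisted_flux s (w s) (w s) k = E t k * fourier_coeff (F s) k" if "s \<in> {0..t}" for s k
    unfolding tG coefF[OF that] EE[of s] by simp
  have "set_integrable lborel {0..t} (\<lambda>s. E t k * fourier_coeff (F s) k)"
    using FI(1) by (rule set_integrable_mult_right)
  moreover have "set_integrable lborel {0..t} (\<lambda>s. E t k * fourier_coeff (F s) k)
      \<longleftrightarrow> set_integrable lborel {0..t} (\<lambda>s. twisted_flux s (w s) (w s) k)"
    by (rule set_integrable_cong) (simp_all add: eqB)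
  ultimately show "set_integrable lborel {0..t} (\<lambda>s. twisted_flux s (w s) (w s) k)" by blast
  have u00: "u0 = u 0" using sol by (simp add: kdv_solution_def)
  have s0: "(\<lambda>k. norm (E (-t) k * U 0 k)) summable_on UNIV"
    using in_H_summable_norm[OF in_H_fourier_coeff[OF H3[of 0]]] t by (simp add: norm_mult E_def U_def)
  have h0: "hermitian (\<lambda>k. E (-t) k * U 0 k)"
    using hU[of 0] by (simp add: hermitian_def E_def exp_cnj)
  have ai: "airy_group (- t) u0 = (\<lambda>x. Re (fourier_series (\<lambda>k. E (-t) k * U 0 k) x))"
    unfolding airy_group_def fourier_multiplier_eq_fourier_series u00 U_def E_def by simp
  let ?A = "\<lambda>x. Re (fourier_series (\<lambda>k. E (-t) k * U 0 k) x)"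
  let ?I = "\<lambda>x. LINT s:{0..t}|lborel. F s x"
  have mA: "?A \<in> borel_measurable borel" using fourier_series_measurable[OF s0] by measurable
  have mI: "?I \<in> borel_measurable borel" by (rule FI(2))
  have mu: "u t \<in> borel_measurable borel" using H3[OF t] by (simp add: sobolev_space_def)
  have e1: "fourier_coeff (u t) k = fourier_coeff (\<lambda>x. ?A x + 1/2 * ?I x) k" for k
  proof (rule fourier_coeff_cong_AE[OF mu])
    show "(\<lambda>x. ?A x + 1/2 * ?I x) \<in> borel_measurable borel" using mA mI by measurable
    show "AE x in lborel. x \<in> {-pi..pi} \<longrightarrow> u t x = ?A x + 1/2 * ?I x"
      using ae by eventually_elim (simp add: ai)
  qed
  have e2: "fourier_coeff (\<lambda>x. ?A x + 1/2 * ?I x) k = fourier_coeff ?A k + 1/2 * fourier_coeff ?I k" for k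
  proof -
    let ?e = "\<lambda>x. exp (- (\<i> * of_int k * complex_of_real x))"
    have iA: "set_integrable lborel {-pi..pi} (\<lambda>x. complex_of_real (?A x) * ?e x)"
      by (intro borel_integrable_atLeastAtMost' continuous_intros continuous_on_fourier_series s0)
    have iI: "set_integrable lborel {-pi..pi} (\<lambda>x. 1/2 * (complex_of_real (?I x) * ?e x))"
    proof (intro set_integrable_mult_right)
      show "set_integrable lborel {-pi..pi} (\<lambda>x. complex_of_real (?I x) * ?e x)"
        unfolding set_integrable_def
      proof (rule Bochner_Integration.integrable_bound)
        show "integrable lborel (\<lambda>x. B * t * indicator {-pi..pi} x :: real)" by simp
        show "(\<lambda>x. indicator {-pi..pi} x *\<^sub>R (complex_of_real (?I x) * ?e x)) \<in> borel_measurable lborel"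
          using mI by measurable
        have "\<bar>?I x\<bar> \<le> B * t" if "set_integrable lborel {0..t} (\<lambda>s. F s x)" for x
        proof -
          have "norm (?I x) \<le> (LINT s:{0..t}|lborel. norm (F s x))"
            by (rule set_integral_norm_bound[OF that])
          also have "\<dots> \<le> (LINT s:{0..t}|lborel. B)"
          proof (rule set_integral_mono)
            show "set_integrable lborel {0..t} (\<lambda>s. norm (F s x))"
              by (rule set_integrable_norm[OF that])
            show "set_integrable lborel {0..t} (\<lambda>s. B)"
              by (intro borel_integrable_atLeastAtMost' continuous_intros)
          qed (use bd in auto)
          also have "\<dots> = B * t" using t by (simp add: set_integral_const)
          finally show ?thesis by simp
        qed
        then show "AE x in lborel. norm (indicator {-pi..pi} x *\<^sub>R (complex_of_real (?I x) * ?e x)) \<le> norm (B * t * indicator {-pi..pi} x :: real)"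
          using int by (auto elim!: eventually_mono simp: norm_mult indicator_def intro: order_trans[OF _ abs_ge_self])
      qed
    qed
    have "complex_of_real (?A x + 1/2 * ?I x) * ?e x = complex_of_real (?A x) * ?e x + 1/2 * (complex_of_real (?I x) * ?e x)" for x
      by (simp add: algebra_simps)
    then show ?thesis
      unfolding fourier_coeff_def using set_integral_add(2)[OF iA iI]
      by (simp add: add_divide_distrib)
  qed
  have Ut: "U t k = E (-t) k * U 0 k + 1/2 * (LINT s:{0..t}|lborel. fourier_coeff (F s) k)"
    unfolding U_def[of t] e1 e2 fourier_coeff_fourier_series[OF s0 h0] FI(3) ..
  have "w t k = E t k * U t k" by (simp add: w_def twist_def E_def U_def)
  also have "\<dots> = E t k * E (-t) k * U 0 k + 1/2 * (E t k * (LINT s:{0..t}|lborel. fourier_coeff (F s) k))"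
    unfolding Ut by (simp add: algebra_simps)
  also have "E t k * E (-t) k = 1" unfolding E_def exp_add[symmetric] by simp
  also have "1 * U 0 k = w 0 k" by (simp add: w_def twist_def U_def)
  also have "E t k * (LINT s:{0..t}|lborel. fourier_coeff (F s) k) = (LINT s:{0..t}|lborel. E t k * fourier_coeff (F s) k)"
    by (rule set_integral_mult_right[symmetric])
  also have "\<dots> = (LINT s:{0..t}|lborel. twisted_flux s (w s) (w s) k)"
    by (rule set_lebesgue_integral_cong) (simp_all add: eqB)
  finally show "w t k = w 0 k + 1/2 * (LINT s:{0..t}|lborel. twisted_flux s (w s) (w s) k)" .
qed

lemma
  assumes t: "t \<in> {0..T}"
  shows integrable_twisted_flux_w: "(\<lambda>s. twisted_flux s (w s) (w s) k) integrable_on {0..t}"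
    and Duhamel_integral: "w t k = w 0 k + 1/2 * integral {0..t} (\<lambda>s. twisted_flux s (w s) (w s) k)"
  using set_borel_integral_eq_integral[OF Duhamel_twisted(1)[OF t, of k]] Duhamel_twisted(2)[OF t, of k] by auto

text \<open>
  Each coefficient is an indefinite integral by Duhamel's formula. Its continuity in turn makes the integrand
  continuous, so that from here on only integrals of continuous functions occur.
\<close>
lemma continuous_on_w: "continuous_on {0..T} (\<lambda>t. w t k)"
proof (cases "0 \<le> T")
  case True
  have "continuous_on {0..T} (\<lambda>t. w 0 k + 1/2 * integral {0..t} (\<lambda>s. twisted_flux s (w s) (w s) k))"
    using True by (intro continuous_intros indefinite_integral_continuous_1 integrable_twisted_flux_w) auto
  then show ?thesis
    by (subst continuous_on_cong[OF refl Duhamel_integral]) auto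
qed simp

lemma M_nonneg: "0 \<le> T \<Longrightarrow> 0 \<le> M"
  using order_trans[OF H_norm_nonneg H_norm_w[of 0]] by simp

lemma
  assumes "t \<in> {0..T}"
  shows in_H2_w: "in_H 2 (w t)" and H2_norm_w: "H_norm 2 (w t) \<le> M"
    and in_H1_w: "in_H 1 (w t)"
  using in_H_le[OF in_H_w[OF assms], of 2] H_norm_le[OF in_H_w[OF assms], of 2]
    in_H_le[OF in_H_w[OF assms], of 1] H_norm_w[OF assms]
  by auto

lemma continuous_twisted_flux_w: "continuous_on {0..T} (\<lambda>s. twisted_flux s (w s) (w s) k)"
  by (rule continuous_on_twisted_flux[where P=M and Q=M]) (auto intro: continuous_on_w in_H2_w H2_norm_w)

lemma w_increment:
  assumes "0 \<le> t" "t \<le> t'" "t' \<le> T"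
  shows "w t' k - w t k = 1/2 * integral {t..t'} (\<lambda>s. twisted_flux s (w s) (w s) k)"
proof -
  have "integral {0..t'} (\<lambda>s. twisted_flux s (w s) (w s) k)
    = integral {0..t} (\<lambda>s. twisted_flux s (w s) (w s) k) + integral {t..t'} (\<lambda>s. twisted_flux s (w s) (w s) k)"
    using assms by (intro Henstock_Kurzweil_Integration.integral_combine[symmetric] integrable_twisted_flux_w) auto
  then show ?thesis
    using Duhamel_integral[of t k] Duhamel_integral[of t' k] assms by (simp add: algebra_simps)
qed

lemma w_zero_mode: assumes "t \<in> {0..T}" shows "w t 0 = 0"
proof -
  have "w 0 0 = 0"
    using mean0 sol by (simp add: w_def twist_def fourier_coeff_def kdv_solution_def set_lebesgue_integral_def
      integral_complex_of_real scaleR_conv_of_real flip: of_real_mult)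
  then show ?thesis
    using Duhamel_integral[OF assms, of 0] by (simp add: twisted_flux_def)
qed

text \<open>
  One derivative is lost in the flux, so \<open>H\<^sup>3\<close> regularity gives Lipschitz continuity in \<open>H\<^sup>2\<close>.
\<close>
lemma H2_increment:
  assumes "0 \<le> t" "t \<le> t'" "t' \<le> T"
  shows "in_H 2 (\<lambda>k. w t' k - w t k)"
    and "H_norm 2 (\<lambda>k. w t' k - w t k) \<le> (t' - t) * (conv_const 3 * M\<^sup>2)"
proof -
  have *: "L2_set (\<lambda>k. norm (bracket k ^ 2 *\<^sub>R (w t' k - w t k))) K \<le> (t' - t) * (conv_const 3 * M\<^sup>2)"
    if K: "finite K" for K
  proof -
    let ?g = "\<lambda>k s. bracket k ^ 2 *\<^sub>R (1/2 * twisted_flux s (w s) (w s) k)"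
    have sub: "{t..t'} \<subseteq> {0..T}" using assms by auto
    have eq: "bracket k ^ 2 *\<^sub>R (w t' k - w t k) = integral {t..t'} (?g k)" for k
      unfolding w_increment[OF assms] by simp
    have "L2_set (\<lambda>k. norm (?g k s)) K \<le> conv_const 3 * M\<^sup>2" if s: "s \<in> {t..t'}" for s
    proof -
      have sT: "s \<in> {0..T}" using s sub by auto
      have w3: "in_H (Suc 2) (w s)" "H_norm (Suc 2) (w s) \<le> M"
        using in_H_w[OF sT] H_norm_w[OF sT] by (simp_all add: numeral_3_eq_3 numeral_2_eq_2)
      have "L2_set (\<lambda>k. norm (?g k s)) K \<le> L2_set (\<lambda>k. norm (bracket k ^ 2 *\<^sub>R twisted_flux s (w s) (w s) k)) K"
        by (intro L2_set_mono) (auto simp: norm_mult)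
      also have "\<dots> \<le> H_norm 2 (twisted_flux s (w s) (w s))"
        unfolding H_norm_def using in_H_twisted_flux[OF w3(1) w3(1)] K
        by (intro L2_set_le_l2_norm) (auto simp: in_H_def)
      also have "\<dots> \<le> conv_const 3 * H_norm (Suc 2) (w s) * H_norm (Suc 2) (w s)"
        using H_norm_twisted_flux[OF w3(1) w3(1), of s] by (simp add: numeral_3_eq_3 numeral_2_eq_2)
      also have "\<dots> \<le> conv_const 3 * M * M"
        using w3(2) order_trans[OF H_norm_nonneg w3(2)] by (intro mult_mono) auto
      finally show ?thesis by (simp add: power2_eq_square)
    qed
    then show ?thesis
      unfolding eq using assms
      by (intro L2_set_integral_le K continuous_intros continuous_on_subset[OF continuous_twisted_flux_w sub]) auto
  qed
  show "in_H 2 (\<lambda>k. w t' k - w t k)" unfolding in_H_def by (rule square_summableI[OF *])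
  show "H_norm 2 (\<lambda>k. w t' k - w t k) \<le> (t' - t) * (conv_const 3 * M\<^sup>2)"
    unfolding H_norm_def by (rule l2_norm_leI[OF *])
qed

end

section \<open>One step of the exponential integrator\<close>

lemma has_sum_minus:
  fixes f g :: "'i \<Rightarrow> 'a::real_normed_vector"
  assumes "(f has_sum x) A" "(g has_sum y) A"
  shows "((\<lambda>i. f i - g i) has_sum (x - y)) A"
proof -
  have "((\<lambda>i. - g i) has_sum - y) A" using assms(2) by (simp add: has_sum_uminus)
  from has_sum_add[OF assms(1) this] show ?thesis by simp
qed

text \<open>
  The only time integral that the scheme evaluates.
\<close>
definition phase_integral :: "real \<Rightarrow> real \<Rightarrow> int \<Rightarrow> complex" where
  "phase_integral t \<tau> y = integral {t..t + \<tau>} (\<lambda>s. phase s y)"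

lemma norm_phase_integral_le: assumes "0 \<le> \<tau>" shows "norm (phase_integral t \<tau> y) \<le> \<tau>"
  unfolding phase_integral_def
  using integral_bound[of t "t + \<tau>" "\<lambda>s. phase s y" 1] assms by (simp add: continuous_on_phase)

lemma phase_integral_eq:
  assumes "0 \<le> \<tau>" "y \<noteq> 0"
  shows "phase_integral t \<tau> y = (phase t y - phase (t + \<tau>) y) / (3 * \<i> * of_int y)"
proof -
  let ?F = "\<lambda>z. - exp (- (3 * \<i> * z * of_int y)) / (3 * \<i> * of_int y)"
  have "((\<lambda>s. phase s y) has_integral ?F (of_real (t + \<tau>)) - ?F (of_real t)) {t..t + \<tau>}"
    unfolding phase_def using assms
    by (intro fundamental_theorem_of_calculus has_vector_derivative_real_field[where f="?F"])
       (auto intro!: derivative_eq_intros)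
  then have "phase_integral t \<tau> y = ?F (of_real (t + \<tau>)) - ?F (of_real t)"
    unfolding phase_integral_def by (rule integral_unique)
  then show ?thesis by (simp add: phase_def diff_divide_distrib)
qed

lemma cnj_phase: "cnj (phase s y) = phase s (- y)"
  by (simp add: phase_def exp_cnj)

lemma cnj_phase_integral: "cnj (phase_integral t \<tau> y) = phase_integral t \<tau> (- y)"
  unfolding phase_integral_def Henstock_Kurzweil_Integration.integral_cnj cnj_phase ..

text \<open>
  The key cancellation: the integrated phase compensates the derivative \<open>k\<close>. It is bounded both by \<open>\<tau>\<close> and
  by a multiple of \<open>1 / \<bar>k a (k - a)\<bar>\<close>; taking the geometric mean of the two, and
  \<open>\<bar>k\<bar> \<le> 2 \<bar>a\<bar> \<bar>k - a\<bar>\<close> for nonzero \<open>a\<close> and \<open>k - a\<close>, yields \<open>\<surd>\<tau>\<close> without loss of derivatives.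
\<close>
lemma resonance_bound:
  assumes "0 \<le> \<tau>" "a \<noteq> 0" "k - a \<noteq> 0"
  shows "\<bar>real_of_int k\<bar> * norm (phase_integral t \<tau> (k * a * (k - a))) \<le> 2 * sqrt \<tau>"
proof (cases "k = 0")
  case False
  define y where "y = k * a * (k - a)"
  have y: "y \<noteq> 0" using False assms by (simp add: y_def)
  have ab: "\<bar>real_of_int k\<bar> \<le> 2 * (\<bar>real_of_int a\<bar> * \<bar>real_of_int (k - a)\<bar>)"
  proof -
    have "1 \<le> \<bar>a\<bar>" "1 \<le> \<bar>k - a\<bar>" using assms by auto
    then have "0 \<le> (\<bar>a\<bar> - 1) * \<bar>k - a\<bar> + \<bar>a\<bar> * (\<bar>k - a\<bar> - 1)" by simp
    then have "\<bar>k\<bar> \<le> 2 * (\<bar>a\<bar> * \<bar>k - a\<bar>)" by (simp add: algebra_simps)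
    then have "real_of_int \<bar>k\<bar> \<le> real_of_int (2 * (\<bar>a\<bar> * \<bar>k - a\<bar>))" by (rule of_int_le_iff[THEN iffD2])
    then show ?thesis by simp
  qed
  have "norm (phase_integral t \<tau> y) = norm (phase t y - phase (t + \<tau>) y) / (3 * \<bar>real_of_int y\<bar>)"
    unfolding phase_integral_eq[OF assms(1) y] by (simp add: norm_divide norm_mult)
  also have "norm (phase t y - phase (t + \<tau>) y) \<le> 2"
    using norm_triangle_ineq4[of "phase t y" "phase (t + \<tau>) y"] by simp
  finally have 1: "norm (phase_integral t \<tau> y) \<le> 2 / (3 * \<bar>real_of_int y\<bar>)"
    by (simp add: divide_right_mono)
  have "(\<bar>real_of_int k\<bar> * norm (phase_integral t \<tau> y))\<^sup>2
      = (\<bar>real_of_int k\<bar> * \<bar>real_of_int k\<bar>) * (norm (phase_integral t \<tau> y) * norm (phase_integral t \<tau> y))"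
    by (simp add: power2_eq_square)
  also have "\<dots> \<le> (\<bar>real_of_int k\<bar> * \<bar>real_of_int k\<bar>) * (\<tau> * (2 / (3 * \<bar>real_of_int y\<bar>)))"
    using 1 norm_phase_integral_le[OF assms(1), of t y] assms by (intro mult_left_mono mult_mono) auto
  also have "\<dots> = \<tau> * (2 / 3) * (\<bar>real_of_int k\<bar> / (\<bar>real_of_int a\<bar> * \<bar>real_of_int (k - a)\<bar>))"
  proof -
    have cancel: "(A * A) * (\<tau> * (2 / (3 * (A * P)))) = \<tau> * (2 / 3) * (A / P)" if "A \<noteq> 0" for A P :: real
      using that by simp
    have y_abs: "\<bar>real_of_int y\<bar> = \<bar>real_of_int k\<bar> * (\<bar>real_of_int a\<bar> * \<bar>real_of_int (k - a)\<bar>)"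
      by (simp only: y_def of_int_mult abs_mult mult.assoc)
    show ?thesis unfolding y_abs by (rule cancel) (use False in simp)
  qed
  also have "\<dots> \<le> \<tau> * (2 / 3) * 2"
    using ab assms by (intro mult_left_mono) (auto simp: divide_le_eq zero_less_mult_iff)
  also have "\<dots> \<le> (2 * sqrt \<tau>)\<^sup>2" using assms(1) by (simp add: power_mult_distrib)
  finally show ?thesis
    unfolding y_def by (rule power2_le_imp_le) (use assms(1) in simp)
qed (use assms in simp)

text \<open>
  The increment of the twisted variable over \<open>[t, t + \<tau>]\<close> when both factors are frozen at their values at
  time \<open>t\<close>.
\<close>
definition exp_step :: "real \<Rightarrow> real \<Rightarrow> (int \<Rightarrow> complex) \<Rightarrow> (int \<Rightarrow> complex) \<Rightarrow> int \<Rightarrow> complex" where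
  "exp_step t \<tau> f g k = \<i> * of_int k / 2 * (\<Sum>\<^sub>\<infinity>a. phase_integral t \<tau> (k * a * (k - a)) * (f a * g (k - a)))"

lemma exp_step_summable:
  assumes "in_H r f" "in_H r g" "1 \<le> r" "0 \<le> \<tau>"
  shows "(\<lambda>a. phase_integral t \<tau> (k * a * (k - a)) * (f a * g (k - a))) summable_on UNIV"
proof (rule abs_summable_summable, rule summable_on_comparison_test)
  show "(\<lambda>a. \<tau> * (norm (f a) * norm (g (k - a)))) summable_on UNIV"
    by (intro summable_on_cmult_right conv_summable[OF assms(1,2,3)])
qed (use norm_phase_integral_le[OF assms(4)] in \<open>auto simp: norm_mult intro!: mult_right_mono\<close>)

lemma exp_step_eq_integral:
  assumes f: "in_H r f" and g: "in_H r g" and r: "1 \<le> r"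
  shows "exp_step t \<tau> f g k = 1/2 * integral {t..t + \<tau>} (\<lambda>s. twisted_flux s f g k)"
proof -
  have "((\<lambda>a. integral {t..t + \<tau>} (\<lambda>s. phase s (k * a * (k - a)) * (f a * g (k - a)))) has_sum
      integral {t..t + \<tau>} (\<lambda>s. \<Sum>\<^sub>\<infinity>a. phase s (k * a * (k - a)) * (f a * g (k - a)))) UNIV"
    by (rule has_sum_integral[where M="\<lambda>a. norm (f a) * norm (g (k - a))"])
       (use conv_summable[OF assms, of k] in \<open>auto simp: norm_mult intro!: continuous_intros\<close>)
  then have "(\<Sum>\<^sub>\<infinity>a. phase_integral t \<tau> (k * a * (k - a)) * (f a * g (k - a)))
      = integral {t..t + \<tau>} (\<lambda>s. \<Sum>\<^sub>\<infinity>a. phase s (k * a * (k - a)) * (f a * g (k - a)))"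
    unfolding phase_integral_def by (simp add: infsumI)
  then show ?thesis unfolding exp_step_def twisted_flux_def by simp
qed

lemma norm_exp_step_le:
  assumes f: "in_H r f" "f 0 = 0" and g: "in_H r g" "g 0 = 0" and r: "1 \<le> r" and \<tau>: "0 \<le> \<tau>"
  shows "norm (exp_step t \<tau> f g k) \<le> sqrt \<tau> * abs_conv f g k"
proof -
  have le: "\<bar>real_of_int k\<bar> / 2 * norm (phase_integral t \<tau> (k * a * (k - a)) * (f a * g (k - a)))
      \<le> sqrt \<tau> * (norm (f a) * norm (g (k - a)))" for a
  proof (cases "a = 0 \<or> k - a = 0")
    case False
    then have "\<bar>real_of_int k\<bar> * norm (phase_integral t \<tau> (k * a * (k - a))) * (norm (f a) * norm (g (k - a)))
      \<le> (2 * sqrt \<tau>) * (norm (f a) * norm (g (k - a)))"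
      using resonance_bound[OF \<tau>] by (intro mult_right_mono) auto
    then show ?thesis by (simp add: norm_mult mult_ac)
  qed (use f g in auto)
  have s: "(\<lambda>a. norm (phase_integral t \<tau> (k * a * (k - a)) * (f a * g (k - a)))) summable_on UNIV"
    using exp_step_summable[OF f(1) g(1) r \<tau>] by (simp only: summable_on_iff_abs_summable_on_complex)
  have "norm (exp_step t \<tau> f g k) = \<bar>real_of_int k\<bar> / 2 * norm (\<Sum>\<^sub>\<infinity>a. phase_integral t \<tau> (k * a * (k - a)) * (f a * g (k - a)))"
    unfolding exp_step_def by (simp add: norm_mult)
  also have "\<dots> \<le> \<bar>real_of_int k\<bar> / 2 * (\<Sum>\<^sub>\<infinity>a. norm (phase_integral t \<tau> (k * a * (k - a)) * (f a * g (k - a))))"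
    by (intro mult_left_mono norm_infsum_bound s) auto
  also have "\<dots> = (\<Sum>\<^sub>\<infinity>a. \<bar>real_of_int k\<bar> / 2 * norm (phase_integral t \<tau> (k * a * (k - a)) * (f a * g (k - a))))"
    by (rule infsum_cmult_right'[symmetric])
  also have "\<dots> \<le> (\<Sum>\<^sub>\<infinity>a. sqrt \<tau> * (norm (f a) * norm (g (k - a))))"
    by (intro infsum_mono summable_on_cmult_right s conv_summable[OF f(1) g(1) r] le)
  also have "\<dots> = sqrt \<tau> * abs_conv f g k"
    unfolding conv_def by (rule infsum_cmult_right')
  finally show ?thesis .
qed

text \<open>
  The factor \<open>\<surd>\<tau>\<close> makes the square of an increment of order \<open>\<tau>\<close>.
\<close>
lemma
  assumes f: "in_H r f" "f 0 = 0" and g: "in_H r g" "g 0 = 0" and r: "1 \<le> r" and \<tau>: "0 \<le> \<tau>"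
  shows in_H_exp_step: "in_H r (exp_step t \<tau> f g)"
    and H_norm_exp_step: "H_norm r (exp_step t \<tau> f g) \<le> sqrt \<tau> * (conv_const r * H_norm r f * H_norm r g)"
proof -
  let ?c = "\<lambda>k. sqrt \<tau> *\<^sub>R abs_conv f g k"
  have c: "in_H r ?c" by (intro in_H_scaleR in_H_abs_conv f g r)
  have *: "bracket k ^ r * norm (exp_step t \<tau> f g k) \<le> bracket k ^ r * norm (?c k)" for k
    using norm_exp_step_le[OF assms] \<tau> by (intro mult_left_mono) (auto simp: conv_nonneg)
  show "in_H r (exp_step t \<tau> f g)" by (rule in_H_mono[OF c *])
  have "H_norm r (exp_step t \<tau> f g) \<le> H_norm r ?c" by (rule H_norm_mono[OF c *])
  also have "\<dots> \<le> sqrt \<tau> * (conv_const r * H_norm r f * H_norm r g)"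
    unfolding H_norm_scaleR using \<tau> H_norm_abs_conv[OF f(1) g(1) r] by (auto intro: mult_left_mono)
  finally show "H_norm r (exp_step t \<tau> f g) \<le> sqrt \<tau> * (conv_const r * H_norm r f * H_norm r g)" .
qed

lemma exp_step_commute: "exp_step t \<tau> f g k = exp_step t \<tau> g f k"
proof -
  have swap: "phase_integral t \<tau> (k * (k - a) * (k - (k - a))) * (f (k - a) * g (k - (k - a)))
      = phase_integral t \<tau> (k * a * (k - a)) * (g a * f (k - a))" for a
  proof -
    have "k * (k - a) * (k - (k - a)) = k * a * (k - a)" by simp
    then show ?thesis by (simp only: diff_diff_eq2 add_diff_cancel_left' mult.commute)
  qed
  show ?thesis
    using infsum_reflect[of "\<lambda>a. phase_integral t \<tau> (k * a * (k - a)) * (f a * g (k - a))" k]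
    unfolding exp_step_def swap by simp
qed

text \<open>
  Applied to the exact solution \<open>w\<close> and the error \<open>e\<close>, this expresses the step of the scheme through \<open>e\<close>.
\<close>
lemma exp_step_diff_square:
  assumes w: "in_H r w" and e: "in_H r e" and r: "1 \<le> r" and \<tau>: "0 \<le> \<tau>"
  shows "exp_step t \<tau> (\<lambda>k. w k - e k) (\<lambda>k. w k - e k) k = exp_step t \<tau> w w k - 2 * exp_step t \<tau> e w k + exp_step t \<tau> e e k"
proof -
  let ?o = "\<lambda>f g a. phase_integral t \<tau> (k * a * (k - a)) * (f a * g (k - a))"
  note S = exp_step_summable[OF _ _ r \<tau>, of _ _ t k]
  have h: "((\<lambda>a. ?o w w a - ?o e w a - ?o w e a + ?o e e a) has_sum
      (\<Sum>\<^sub>\<infinity>a. ?o w w a) - (\<Sum>\<^sub>\<infinity>a. ?o e w a) - (\<Sum>\<^sub>\<infinity>a. ?o w e a) + (\<Sum>\<^sub>\<infinity>a. ?o e e a)) UNIV"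
    by (intro has_sum_add has_sum_minus has_sum_infsum S w e)
  have "(\<Sum>\<^sub>\<infinity>a. ?o (\<lambda>k. w k - e k) (\<lambda>k. w k - e k) a)
     = (\<Sum>\<^sub>\<infinity>a. ?o w w a) - (\<Sum>\<^sub>\<infinity>a. ?o e w a) - (\<Sum>\<^sub>\<infinity>a. ?o w e a) + (\<Sum>\<^sub>\<infinity>a. ?o e e a)"
    unfolding infsumI[OF h, symmetric] by (intro infsum_cong) (simp add: algebra_simps)
  then have "exp_step t \<tau> (\<lambda>k. w k - e k) (\<lambda>k. w k - e k) k
     = exp_step t \<tau> w w k - exp_step t \<tau> e w k - exp_step t \<tau> w e k + exp_step t \<tau> e e k"
    unfolding exp_step_def by (simp add: ring_distribs)
  then show ?thesis using exp_step_commute[of t \<tau> w e k] by simp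
qed

lemma twisted_flux_diff:
  assumes p: "in_H r p" and q: "in_H r q" and r: "1 \<le> r"
  shows "twisted_flux s p p k - twisted_flux s q q k = twisted_flux s (\<lambda>k. p k - q k) p k + twisted_flux s q (\<lambda>k. p k - q k) k"
proof -
  let ?o = "\<lambda>f g a. phase s (k * a * (k - a)) * (f a * g (k - a))"
  have S: "?o f g summable_on UNIV" if "in_H r f" "in_H r g" for f g
    by (rule abs_summable_summable) (use conv_summable[OF that r, of k] in \<open>simp add: norm_mult\<close>)
  have d: "in_H r (\<lambda>k. p k - q k)" by (rule in_H_diff[OF p q])
  have "(\<Sum>\<^sub>\<infinity>a. ?o p p a) - (\<Sum>\<^sub>\<infinity>a. ?o q q a) = (\<Sum>\<^sub>\<infinity>a. ?o p p a - ?o q q a)"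
    by (rule infsumI[symmetric]) (intro has_sum_minus has_sum_infsum S p q)
  also have "\<dots> = (\<Sum>\<^sub>\<infinity>a. ?o (\<lambda>k. p k - q k) p a + ?o q (\<lambda>k. p k - q k) a)"
    by (intro infsum_cong) (simp add: algebra_simps)
  also have "\<dots> = (\<Sum>\<^sub>\<infinity>a. ?o (\<lambda>k. p k - q k) p a) + (\<Sum>\<^sub>\<infinity>a. ?o q (\<lambda>k. p k - q k) a)"
    by (rule infsumI) (intro has_sum_add has_sum_infsum S p q d)
  finally show ?thesis
    unfolding twisted_flux_def right_diff_distrib[symmetric] distrib_left[symmetric] by (rule arg_cong)
qed

context kdv_bounded
begin

text \<open>
  The exact increment and \<open>exp_step\<close> differ by the integral of the flux of \<open>w s\<close> minus the flux of \<open>w t\<close>.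
  This difference is bilinear in \<open>w s - w t\<close>, which is \<open>O(\<tau>)\<close> in \<open>H\<^sup>2\<close>, and the flux maps \<open>H\<^sup>2\<close> to
  \<open>H\<^sup>1\<close>.
\<close>
lemma
  assumes t: "0 \<le> t" "0 \<le> \<tau>" "t + \<tau> \<le> T"
  defines "d \<equiv> \<lambda>k. w (t + \<tau>) k - w t k - exp_step t \<tau> (w t) (w t) k"
  shows in_H_local_error: "in_H 1 d"
    and local_error: "H_norm 1 d \<le> conv_const 2 * conv_const 3 * M ^ 3 * \<tau>\<^sup>2"
proof -
  let ?R = "conv_const 2 * conv_const 3 * M ^ 3 * \<tau>"
  let ?g = "\<lambda>k s. bracket k ^ 1 *\<^sub>R (1/2 * (twisted_flux s (w s) (w s) k - twisted_flux s (w t) (w t) k))"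
  have tT: "t \<in> {0..T}" using t by auto
  have M: "0 \<le> M" using t by (intro M_nonneg) auto
  have sub: "{t..t + \<tau>} \<subseteq> {0..T}" using t by auto
  have cont: "continuous_on {t..t + \<tau>} (\<lambda>s. twisted_flux s (w s) (w s) k)"
    "continuous_on {t..t + \<tau>} (\<lambda>s. twisted_flux s (w t) (w t) k)" for k
    by (rule continuous_on_subset[OF continuous_twisted_flux_w sub],
        rule continuous_on_twisted_flux[where P=M and Q=M])
       (use in_H2_w[OF tT] H2_norm_w[OF tT] in auto)
  have eq: "bracket k ^ 1 *\<^sub>R d k = integral {t..t + \<tau>} (?g k)" for k
  proof -
    have "d k = 1/2 * (integral {t..t + \<tau>} (\<lambda>s. twisted_flux s (w s) (w s) k) - integral {t..t + \<tau>} (\<lambda>s. twisted_flux s (w t) (w t) k))"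
      unfolding d_def exp_step_eq_integral[OF in_H1_w[OF tT] in_H1_w[OF tT] order_refl]
      using w_increment[of t "t + \<tau>" k] t by (simp add: right_diff_distrib)
    also have "\<dots> = 1/2 * integral {t..t + \<tau>} (\<lambda>s. twisted_flux s (w s) (w s) k - twisted_flux s (w t) (w t) k)"
      using cont by (subst Henstock_Kurzweil_Integration.integral_diff) (auto intro: integrable_continuous_real)
    finally show ?thesis by simp
  qed
  have le: "L2_set (\<lambda>k. norm (?g k s)) K \<le> ?R" if s: "s \<in> {t..t + \<tau>}" and K: "finite K" for s K
  proof -
    let ?d = "\<lambda>k. w s k - w t k"
    have sT: "s \<in> {0..T}" using s sub by auto
    have two: "Suc 1 = 2" by simp
    have dd: "in_H (Suc 1) ?d" "H_norm (Suc 1) ?d \<le> \<tau> * (conv_const 3 * M\<^sup>2)"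
    proof -
      have st: "t \<le> s" "s \<le> T" using s t by auto
      show "in_H (Suc 1) ?d" unfolding two using H2_increment(1)[OF t(1) st] .
      have "H_norm 2 ?d \<le> (s - t) * (conv_const 3 * M\<^sup>2)" by (rule H2_increment(2)[OF t(1) st])
      also have "\<dots> \<le> \<tau> * (conv_const 3 * M\<^sup>2)" using s by (intro mult_right_mono) auto
      finally show "H_norm (Suc 1) ?d \<le> \<tau> * (conv_const 3 * M\<^sup>2)" unfolding two .
    qed
    have ws: "in_H (Suc 1) (w s)" "H_norm (Suc 1) (w s) \<le> M" and wt: "in_H (Suc 1) (w t)" "H_norm (Suc 1) (w t) \<le> M"
      unfolding two by (intro in_H2_w H2_norm_w sT tT)+
    let ?b1 = "twisted_flux s ?d (w s)" and ?b2 = "twisted_flux s (w t) ?d"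
    have b1: "in_H 1 ?b1" and b2: "in_H 1 ?b2"
      by (intro in_H_twisted_flux dd ws wt)+
    have N: "0 \<le> \<tau> * (conv_const 3 * M\<^sup>2)" using t by simp
    have n1: "H_norm 1 ?b1 \<le> conv_const 2 * (\<tau> * (conv_const 3 * M\<^sup>2)) * M"
    proof -
      have "H_norm 1 ?b1 \<le> conv_const 2 * H_norm 2 ?d * H_norm 2 (w s)"
        using H_norm_twisted_flux[OF dd(1) ws(1), of s] unfolding two .
      also have "\<dots> \<le> conv_const 2 * (\<tau> * (conv_const 3 * M\<^sup>2)) * M"
        using dd(2) ws(2) N t unfolding two by (intro mult_mono mult_left_mono mult_nonneg_nonneg) auto
      finally show ?thesis .
    qed
    have n2: "H_norm 1 ?b2 \<le> conv_const 2 * M * (\<tau> * (conv_const 3 * M\<^sup>2))"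
    proof -
      have "H_norm 1 ?b2 \<le> conv_const 2 * H_norm 2 (w t) * H_norm 2 ?d"
        using H_norm_twisted_flux[OF wt(1) dd(1), of s] unfolding two .
      also have "\<dots> \<le> conv_const 2 * M * (\<tau> * (conv_const 3 * M\<^sup>2))"
        using dd(2) wt(2) M unfolding two by (intro mult_mono mult_left_mono mult_nonneg_nonneg) auto
      finally show ?thesis .
    qed
    have ptw: "norm (?g k s) \<le> norm (bracket k ^ 1 *\<^sub>R ((1/2) *\<^sub>R (?b1 k + ?b2 k)))" for k
      unfolding twisted_flux_diff[OF in_H1_w[OF sT] in_H1_w[OF tT] order_refl]
      by (simp only: norm_scaleR norm_mult) simp
    have "L2_set (\<lambda>k. norm (?g k s)) K \<le> L2_set (\<lambda>k. norm (bracket k ^ 1 *\<^sub>R ((1/2) *\<^sub>R (?b1 k + ?b2 k)))) K"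
      by (rule L2_set_mono[OF ptw norm_ge_zero])
    also have "\<dots> \<le> H_norm 1 (\<lambda>k. (1/2) *\<^sub>R (?b1 k + ?b2 k))"
      unfolding H_norm_def using K in_H_scaleR[OF in_H_add[OF b1 b2], of "1/2"]
      by (intro L2_set_le_l2_norm) (auto simp: in_H_def)
    also have "\<dots> \<le> 1/2 * (H_norm 1 ?b1 + H_norm 1 ?b2)"
      unfolding H_norm_scaleR using H_norm_triangle[OF b1 b2] by simp
    also have "\<dots> \<le> ?R" using n1 n2 by (simp add: power3_eq_cube power2_eq_square mult_ac)
    finally show ?thesis .
  qed
  have *: "L2_set (\<lambda>k. norm (bracket k ^ 1 *\<^sub>R d k)) K \<le> \<tau> * ?R" if K: "finite K" for K
  proof -
    have "L2_set (\<lambda>k. norm (integral {t..t + \<tau>} (?g k))) K \<le> (t + \<tau> - t) * ?R"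
      using t by (intro L2_set_integral_le K le continuous_intros cont) auto
    then show ?thesis unfolding eq by simp
  qed
  show "in_H 1 d" unfolding in_H_def by (rule square_summableI[OF *])
  have "H_norm 1 d \<le> \<tau> * ?R" unfolding H_norm_def by (rule l2_norm_leI[OF *])
  then show "H_norm 1 d \<le> conv_const 2 * conv_const 3 * M ^ 3 * \<tau>\<^sup>2"
    by (simp add: power2_eq_square mult_ac)
qed

end

section \<open>Stability\<close>

definition H1_inner :: "(int \<Rightarrow> complex) \<Rightarrow> (int \<Rightarrow> complex) \<Rightarrow> real" where
  "H1_inner f g = (\<Sum>\<^sub>\<infinity>k. (bracket k)\<^sup>2 * Re (cnj (f k) * g k))"

lemma
  assumes f: "in_H 1 f" and g: "in_H 1 g"
  shows H1_inner_abs_summable: "(\<lambda>k. (bracket k)\<^sup>2 * (norm (f k) * norm (g k))) summable_on UNIV"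
    and H1_inner_summable: "(\<lambda>k. (bracket k)\<^sup>2 * Re (cnj (f k) * g k)) summable_on UNIV"
    and H1_inner_le: "\<bar>H1_inner f g\<bar> \<le> H_norm 1 f * H_norm 1 g"
proof -
  have sq: "square_summable (\<lambda>k. (bracket k ^ 1) *\<^sub>R f k)" "square_summable (\<lambda>k. (bracket k ^ 1) *\<^sub>R g k)"
    using f g by (auto simp: in_H_def)
  have eq: "norm ((bracket k ^ 1) *\<^sub>R f k) * norm ((bracket k ^ 1) *\<^sub>R g k) = (bracket k)\<^sup>2 * (norm (f k) * norm (g k))" for k
    by (simp add: power2_eq_square)
  show s: "(\<lambda>k. (bracket k)\<^sup>2 * (norm (f k) * norm (g k))) summable_on UNIV"
    using abs_summable_mult_l2[OF sq] unfolding eq .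
  have le: "\<bar>(bracket k)\<^sup>2 * Re (cnj (f k) * g k)\<bar> \<le> (bracket k)\<^sup>2 * (norm (f k) * norm (g k))" for k
  proof -
    have "\<bar>Re (cnj (f k) * g k)\<bar> \<le> norm (f k) * norm (g k)"
      using abs_Re_le_cmod[of "cnj (f k) * g k"] unfolding norm_mult complex_mod_cnj .
    then show ?thesis unfolding abs_mult abs_power2 by (rule mult_left_mono) simp
  qed
  have sa: "(\<lambda>k. norm ((bracket k)\<^sup>2 * Re (cnj (f k) * g k))) summable_on UNIV"
    by (rule summable_on_comparison_test[OF s]) (use le in \<open>auto simp only: real_norm_def abs_ge_zero\<close>)
  then show "(\<lambda>k. (bracket k)\<^sup>2 * Re (cnj (f k) * g k)) summable_on UNIV"
    by (rule abs_summable_summable)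
  have "\<bar>H1_inner f g\<bar> \<le> (\<Sum>\<^sub>\<infinity>k. norm ((bracket k)\<^sup>2 * Re (cnj (f k) * g k)))"
    unfolding H1_inner_def using norm_infsum_bound[OF sa] by (simp only: real_norm_def)
  also have "\<dots> \<le> (\<Sum>\<^sub>\<infinity>k. (bracket k)\<^sup>2 * (norm (f k) * norm (g k)))"
    by (rule infsum_mono[OF sa s]) (use le in \<open>simp only: real_norm_def\<close>)
  also have "\<dots> \<le> H_norm 1 f * H_norm 1 g"
    using Cauchy_Schwarz_infsum[OF sq] unfolding eq H_norm_def .
  finally show "\<bar>H1_inner f g\<bar> \<le> H_norm 1 f * H_norm 1 g" .
qed

lemma H_norm1_power2: "(H_norm 1 f)\<^sup>2 = (\<Sum>\<^sub>\<infinity>k. (bracket k)\<^sup>2 * (norm (f k))\<^sup>2)"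
  unfolding H_norm_def l2_norm_power2 by (simp add: power_mult_distrib)

lemma in_H1_summable: "in_H 1 f \<Longrightarrow> (\<lambda>k. (bracket k)\<^sup>2 * (norm (f k))\<^sup>2) summable_on UNIV"
  unfolding in_H_def square_summable_def by (simp add: power_mult_distrib)

lemma H_norm1_add_power2:
  assumes f: "in_H 1 f" and g: "in_H 1 g"
  shows "(H_norm 1 (\<lambda>k. f k + g k))\<^sup>2 = (H_norm 1 f)\<^sup>2 + 2 * H1_inner f g + (H_norm 1 g)\<^sup>2"
proof -
  have pt: "(bracket k)\<^sup>2 * (norm (f k + g k))\<^sup>2 = (bracket k)\<^sup>2 * (norm (f k))\<^sup>2 + 2 * ((bracket k)\<^sup>2 * Re (cnj (f k) * g k)) + (bracket k)\<^sup>2 * (norm (g k))\<^sup>2" for k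
    unfolding cmod_power2 by (simp add: power2_eq_square algebra_simps)
  have "((\<lambda>k. (bracket k)\<^sup>2 * (norm (f k + g k))\<^sup>2) has_sum ((H_norm 1 f)\<^sup>2 + 2 * H1_inner f g + (H_norm 1 g)\<^sup>2)) UNIV"
    unfolding pt H_norm1_power2 H1_inner_def
    by (intro has_sum_add has_sum_cmult_right has_sum_infsum in_H1_summable H1_inner_summable f g)
  then show ?thesis unfolding H_norm1_power2 by (rule infsumI)
qed

lemma
  assumes f: "in_H 1 f" and g: "in_H 1 g" and h: "in_H 1 h"
  shows H1_inner_add: "H1_inner f (\<lambda>k. g k + h k) = H1_inner f g + H1_inner f h"
    and H1_inner_diff: "H1_inner f (\<lambda>k. g k - h k) = H1_inner f g - H1_inner f h"
proof -
  have "((\<lambda>k. (bracket k)\<^sup>2 * Re (cnj (f k) * (g k + h k))) has_sum (H1_inner f g + H1_inner f h)) UNIV"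
    unfolding H1_inner_def distrib_left plus_complex.sel
    by (intro has_sum_add has_sum_infsum H1_inner_summable f g h)
  then show "H1_inner f (\<lambda>k. g k + h k) = H1_inner f g + H1_inner f h"
    by (simp only: H1_inner_def infsumI)
  have "((\<lambda>k. (bracket k)\<^sup>2 * Re (cnj (f k) * (g k - h k))) has_sum (H1_inner f g - H1_inner f h)) UNIV"
    unfolding H1_inner_def right_diff_distrib minus_complex.sel
    by (intro has_sum_minus has_sum_infsum H1_inner_summable f g h)
  then show "H1_inner f (\<lambda>k. g k - h k) = H1_inner f g - H1_inner f h"
    by (simp only: H1_inner_def infsumI)
qed

lemma
  fixes x p q :: "int \<Rightarrow> real"
  assumes x: "square_summable x" "\<And>k. 0 \<le> x k" and pq: "\<And>k. 0 \<le> p k" "\<And>k. 0 \<le> q k"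
    and s: "\<And>k. (\<lambda>b. p b * q (k - b)) summable_on UNIV"
    and c: "square_summable (conv p q)" "l2_norm (conv p q) \<le> N"
  shows trilinear_summable: "(\<lambda>(k,b). x k * (p b * q (k - b))) summable_on UNIV \<times> UNIV"
    and trilinear_le: "(\<Sum>\<^sub>\<infinity>(k,b)\<in>UNIV \<times> UNIV. x k * (p b * q (k - b))) \<le> l2_norm x * N"
proof -
  have nn: "norm (x k) * norm (conv p q k) = x k * conv p q k" for k
    using x pq conv_nonneg[of p q k, OF pq] by simp
  have s1: "(\<lambda>k. x k * conv p q k) summable_on UNIV"
    using abs_summable_mult_l2[OF x(1) c(1)] unfolding nn .
  show S: "(\<lambda>(k,b). x k * (p b * q (k - b))) summable_on UNIV \<times> UNIV"
    by (rule summable_on_SigmaI[OF _ s1])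
       (use x pq in \<open>auto simp: conv_def intro!: has_sum_cmult_right has_sum_infsum s\<close>)
  have "(\<Sum>\<^sub>\<infinity>(k,b)\<in>UNIV \<times> UNIV. x k * (p b * q (k - b))) = (\<Sum>\<^sub>\<infinity>k. \<Sum>\<^sub>\<infinity>b. x k * (p b * q (k - b)))"
    by (rule infsum_Sigma'_banach[OF S, symmetric])
  also have "\<dots> = (\<Sum>\<^sub>\<infinity>k. x k * conv p q k)"
    by (simp add: conv_def infsum_cmult_right')
  also have "\<dots> \<le> l2_norm x * l2_norm (conv p q)"
    using Cauchy_Schwarz_infsum[OF x(1) c(1)] unfolding nn .
  also have "\<dots> \<le> l2_norm x * N" using c(2) by (intro mult_left_mono) auto
  finally show "(\<Sum>\<^sub>\<infinity>(k,b)\<in>UNIV \<times> UNIV. x k * (p b * q (k - b))) \<le> l2_norm x * N" .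
qed

text \<open>
  With \<open>a = k - b\<close> the left-hand side is \<open>a (1 + a\<^sup>2 + 3 k b)\<close>: every term carries a factor \<open>a\<close>, the
  frequency of the smooth function, and at most one power each of \<open>k\<close> and \<open>b\<close>.
\<close>
lemma symmetrised_weight_le:
  "\<bar>(bracket k)\<^sup>2 * real_of_int k - (bracket b)\<^sup>2 * real_of_int b\<bar> \<le> bracket (k - b) ^ 3 + 3 * (bracket k * bracket b * bracket (k - b))"
proof -
  define a where "a = k - b"
  have "(bracket k)\<^sup>2 * real_of_int k - (bracket b)\<^sup>2 * real_of_int b
      = real_of_int a * (bracket a)\<^sup>2 + 3 * (real_of_int k * real_of_int b * real_of_int a)"
    unfolding bracket_power2 a_def by (simp add: power2_eq_square algebra_simps)
  also have "\<bar>\<dots>\<bar> \<le> \<bar>real_of_int a\<bar> * (bracket a)\<^sup>2 + 3 * (\<bar>real_of_int k\<bar> * \<bar>real_of_int b\<bar> * \<bar>real_of_int a\<bar>)"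
    by (rule order_trans[OF abs_triangle_ineq]) (simp add: abs_mult)
  also have "\<dots> \<le> bracket a * (bracket a)\<^sup>2 + 3 * (bracket k * bracket b * bracket a)"
    by (intro add_mono mult_mono abs_le_bracket order_refl mult_nonneg_nonneg) auto
  finally show ?thesis by (simp add: a_def power3_eq_cube power2_eq_square)
qed

lemma Re_of_real_mult: "Re (complex_of_real x * z) = x * Re z"
  by simp

text \<open>
  The scalar product is a double sum over \<open>(k, b)\<close> with weight \<open>\<langle>k\<rangle>\<^sup>2 k\<close>, where \<open>e\<close> is evaluated at
  \<open>k\<close> and \<open>b\<close> and \<open>w\<close> at \<open>k - b\<close>. Exchanging \<open>k\<close> and \<open>b\<close> and conjugating reproduces the same
  summand with the opposite sign and weight \<open>\<langle>b\<rangle>\<^sup>2 b\<close>, because \<open>w\<close> is the transform of a real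
  function. Twice the real part is therefore the sum with the difference of the weights, in which each \<open>e\<close> bears
  at most one derivative. The trivial bound \<open>\<tau>\<close> on the integrated phase now suffices. The exchange needs
  absolute convergence of the original double sum, which the smoothing expressed by \<open>resonance_bound\<close> provides.
\<close>
lemma energy_estimate:
  assumes e: "in_H 1 e" "e 0 = 0" and w: "in_H 3 w" "w 0 = 0" "hermitian w" and \<tau>: "0 \<le> \<tau>"
  shows "\<bar>H1_inner e (exp_step t \<tau> e w)\<bar> \<le> kappa * H_norm 3 w * \<tau> * (H_norm 1 e)\<^sup>2"
proof -
  define S where "S k b = \<i> / 2 * cnj (e k) * e b * w (k - b) * phase_integral t \<tau> (k * b * (k - b))" for k b
  define Z where "Z k b = complex_of_real ((bracket k)\<^sup>2 * real_of_int k) * S k b" for k b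
  have w1: "in_H 1 w" and w2: "in_H (Suc 1) w" and w2_le: "H_norm (Suc 1) w \<le> H_norm 3 w"
    using in_H_le[OF w(1), of 1] in_H_le[OF w(1), of "Suc 1"] H_norm_le[OF w(1), of "Suc 1"] by auto
  have Zsum: "(bracket k)\<^sup>2 * Re (cnj (e k) * exp_step t \<tau> e w k) = Re (\<Sum>\<^sub>\<infinity>b. Z k b)" for k
  proof -
    have "(\<Sum>\<^sub>\<infinity>b. Z k b) = (\<Sum>\<^sub>\<infinity>b. (complex_of_real ((bracket k)\<^sup>2) * (cnj (e k) * (\<i> * of_int k / 2)))
        * (phase_integral t \<tau> (k * b * (k - b)) * (e b * w (k - b))))"
      unfolding Z_def S_def by (intro infsum_cong) (simp add: mult_ac)
    also have "\<dots> = complex_of_real ((bracket k)\<^sup>2) * (cnj (e k) * exp_step t \<tau> e w k)"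
      unfolding infsum_cmult_right' exp_step_def by (simp only: mult.assoc)
    finally show ?thesis by (simp only: Re_of_real_mult)
  qed
  have normZ: "norm (Z k b) \<le> sqrt \<tau> * ((bracket k)\<^sup>2 * norm (e k) * (norm (e b) * norm (w (k - b))))" for k b
  proof (cases "b = 0 \<or> k - b = 0")
    case False
    have "norm (Z k b) = (\<bar>real_of_int k\<bar> * norm (phase_integral t \<tau> (k * b * (k - b)))) * ((bracket k)\<^sup>2 * norm (e k) * (norm (e b) * norm (w (k - b))) / 2)"
      unfolding Z_def S_def by (simp only: norm_mult norm_of_real norm_divide abs_mult abs_power2) simp
    also have "\<dots> \<le> (2 * sqrt \<tau>) * ((bracket k)\<^sup>2 * norm (e k) * (norm (e b) * norm (w (k - b))) / 2)"
      using resonance_bound[OF \<tau>, of b k t] False by (intro mult_right_mono) auto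
    finally show ?thesis by simp
  qed (use e w \<tau> in \<open>auto simp: Z_def S_def\<close>)
  have ec: "in_H 1 (\<lambda>k. complex_of_real (abs_conv e w k))"
    using in_H_abs_conv[OF e(1) w1] in_H_cong_norm[of "\<lambda>k. complex_of_real (abs_conv e w k)" "abs_conv e w" 1] by simp
  have Zs: "(\<lambda>p. norm ((\<lambda>(k,b). Z k b) p)) summable_on UNIV \<times> UNIV"
  proof (rule summable_on_comparison_test)
    have gs: "(\<lambda>k. (bracket k)\<^sup>2 * (norm (e k) * norm (complex_of_real (abs_conv e w k)))) summable_on UNIV"
      by (rule H1_inner_abs_summable[OF e(1) ec])
    have "(\<lambda>(k,b). (bracket k)\<^sup>2 * norm (e k) * (norm (e b) * norm (w (k - b)))) summable_on UNIV \<times> UNIV"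
    proof (rule summable_on_SigmaI[OF _ gs])
      fix k
      have "((\<lambda>b. (bracket k)\<^sup>2 * norm (e k) * (norm (e b) * norm (w (k - b)))) has_sum (bracket k)\<^sup>2 * norm (e k) * abs_conv e w k) UNIV"
        unfolding conv_def by (intro has_sum_cmult_right has_sum_infsum conv_summable[OF e(1) w1]) simp
      then show "((\<lambda>b. (\<lambda>(k,b). (bracket k)\<^sup>2 * norm (e k) * (norm (e b) * norm (w (k - b)))) (k, b))
          has_sum (bracket k)\<^sup>2 * (norm (e k) * norm (complex_of_real (abs_conv e w k)))) UNIV"
        by (simp add: conv_nonneg mult.assoc)
    qed auto
    then show "(\<lambda>p. sqrt \<tau> * (\<lambda>(k,b). (bracket k)\<^sup>2 * norm (e k) * (norm (e b) * norm (w (k - b)))) p) summable_on UNIV \<times> UNIV"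
      by (rule summable_on_cmult_right)
  qed (use normZ in auto)
  have Zs': "(\<lambda>(k,b). Z k b) summable_on UNIV \<times> UNIV"
    by (rule abs_summable_summable[OF Zs])
  define X where "X = (\<Sum>\<^sub>\<infinity>(k,b)\<in>UNIV \<times> UNIV. Z k b)"
  have inner: "H1_inner e (exp_step t \<tau> e w) = Re X"
  proof -
    have "X = (\<Sum>\<^sub>\<infinity>k. \<Sum>\<^sub>\<infinity>b. Z k b)"
      unfolding X_def by (rule infsum_Sigma'_banach[OF Zs', symmetric])
    then have "Re X = (\<Sum>\<^sub>\<infinity>k. Re (\<Sum>\<^sub>\<infinity>b. Z k b))"
      using infsum_Re[OF summable_on_Sigma_banach[OF Zs']] by simp
    then show ?thesis unfolding H1_inner_def Zsum ..
  qed
  have anti: "Z k b + cnj (Z b k) = complex_of_real ((bracket k)\<^sup>2 * real_of_int k - (bracket b)\<^sup>2 * real_of_int b) * S k b" for k b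
  proof -
    have ph: "- (b * k * (b - k)) = k * b * (k - b)" by (simp add: algebra_simps)
    have cw: "cnj (w (b - k)) = w (k - b)"
      using w(3) unfolding hermitian_def by (metis minus_diff_eq)
    have "cnj (S b k) = - S k b"
      unfolding S_def complex_cnj_mult cnj_phase_integral ph cw by simp
    then have "cnj (Z b k) = - complex_of_real ((bracket b)\<^sup>2 * real_of_int b) * S k b"
      unfolding Z_def complex_cnj_mult complex_cnj_complex_of_real by simp
    then show ?thesis unfolding Z_def by (simp add: algebra_simps)
  qed
  have hs: "((\<lambda>(k,b). Z k b) has_sum X) (UNIV \<times> UNIV)"
    unfolding X_def by (rule has_sum_infsum[OF Zs'])
  have "((\<lambda>(k,b). Z b k) has_sum X) (UNIV \<times> UNIV)"
    using iffD1[OF has_sum_swap hs] by (simp add: case_prod_unfold)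
  then have "((\<lambda>p. cnj ((\<lambda>(k,b). Z b k) p)) has_sum cnj X) (UNIV \<times> UNIV)"
    by (simp only: has_sum_cnj_iff)
  from has_sum_add[OF hs this]
  have hs2: "((\<lambda>(k,b). Z k b + cnj (Z b k)) has_sum (X + cnj X)) (UNIV \<times> UNIV)"
    by (simp add: case_prod_unfold)
  \<comment> \<open>the two parts of the bound on the difference of the weights: three derivatives on \<open>w\<close>, or one on each factor\<close>
  define A where "A = (\<lambda>(k,b). norm (e k) * (norm (e b) * (bracket (k - b) ^ 3 * norm (w (k - b)))))"
  define B where "B = (\<lambda>(k,b). (bracket k * norm (e k)) * ((bracket b * norm (e b)) * (bracket (k - b) * norm (w (k - b)))))"
  define E where "E = H_norm 1 e"
  define W where "W = H_norm 3 w"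
  have e0: "in_H 0 e" "H_norm 0 e \<le> E"
    using in_H_le[OF e(1), of 0] H_norm_le[OF e(1), of 0] by (auto simp: E_def)
  have se: "(\<lambda>k. norm (e k)) summable_on UNIV" "(\<Sum>\<^sub>\<infinity>k. norm (e k)) \<le> kappa * E"
    using in_H_summable_norm[OF e(1)] infsum_norm_le'[OF e(1)] by (auto simp: E_def)
  have sw: "(\<lambda>k. bracket k * norm (w k)) summable_on UNIV" "(\<Sum>\<^sub>\<infinity>k. bracket k * norm (w k)) \<le> kappa * W"
  proof -
    show "(\<lambda>k. bracket k * norm (w k)) summable_on UNIV"
      using in_H_abs_summable[OF w2] by simp
    have "(\<Sum>\<^sub>\<infinity>k. bracket k * norm (w k)) \<le> kappa * H_norm (Suc 1) w"
      using infsum_norm_le[OF w2] by simp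
    also have "\<dots> \<le> kappa * W" unfolding W_def by (intro mult_left_mono w2_le) simp
    finally show "(\<Sum>\<^sub>\<infinity>k. bracket k * norm (w k)) \<le> kappa * W" .
  qed
  have EW: "0 \<le> E" "0 \<le> W" by (simp_all add: E_def W_def)
  have x1: "square_summable (\<lambda>k. norm (e k))" "l2_norm (\<lambda>k. norm (e k)) \<le> E"
    using e0 by (auto simp: in_H_def H_norm_def)
  have z1: "square_summable (\<lambda>k. bracket k ^ 3 * norm (w k))" "l2_norm (\<lambda>k. bracket k ^ 3 * norm (w k)) = W"
    using w(1) by (simp_all add: in_H_def square_summable_def W_def H_norm_def l2_norm_def)
  have x2: "square_summable (\<lambda>k. bracket k * norm (e k))" "l2_norm (\<lambda>k. bracket k * norm (e k)) = E"
    using e(1) by (simp_all add: in_H_def square_summable_def E_def H_norm_def l2_norm_def)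
  have c1: "l2_norm (conv (\<lambda>b. norm (e b)) (\<lambda>a. bracket a ^ 3 * norm (w a))) \<le> kappa * E * W"
  proof -
    have "l2_norm (conv (\<lambda>b. norm (e b)) (\<lambda>a. bracket a ^ 3 * norm (w a))) \<le> (\<Sum>\<^sub>\<infinity>k. norm (e k)) * W"
      using Young_l2_norm[OF se(1) _ z1(1)] by (simp add: z1(2))
    also have "\<dots> \<le> (kappa * E) * W" using se(2) EW by (intro mult_right_mono) auto
    finally show ?thesis .
  qed
  have A: "A summable_on UNIV \<times> UNIV" "infsum A (UNIV \<times> UNIV) \<le> kappa * E\<^sup>2 * W"
  proof -
    have c: "square_summable (conv (\<lambda>b. norm (e b)) (\<lambda>a. bracket a ^ 3 * norm (w a)))"
      by (rule Young_square_summable[OF se(1) _ z1(1)]) auto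
    have s: "(\<lambda>b. norm (e b) * (bracket (k - b) ^ 3 * norm (w (k - b)))) summable_on UNIV" for k
      by (rule Young_summable[OF se(1) _ z1(1)]) auto
    show "A summable_on UNIV \<times> UNIV"
      unfolding A_def by (rule trilinear_summable[OF x1(1) _ _ _ s c c1]) auto
    have "infsum A (UNIV \<times> UNIV) \<le> l2_norm (\<lambda>k. norm (e k)) * (kappa * E * W)"
      unfolding A_def by (rule trilinear_le[OF x1(1) _ _ _ s c c1]) auto
    also have "\<dots> \<le> E * (kappa * E * W)" using x1(2) EW by (intro mult_right_mono) auto
    finally show "infsum A (UNIV \<times> UNIV) \<le> kappa * E\<^sup>2 * W" by (simp add: power2_eq_square mult_ac)
  qed
  have B: "B summable_on UNIV \<times> UNIV" "infsum B (UNIV \<times> UNIV) \<le> kappa * E\<^sup>2 * W"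
  proof -
    let ?p = "\<lambda>b. bracket b * norm (e b)" and ?q = "\<lambda>a. bracket a * norm (w a)"
    have cm: "conv ?p ?q = conv ?q ?p" using conv_commute by blast
    have c: "square_summable (conv ?p ?q)"
      unfolding cm by (rule Young_square_summable[OF sw(1) _ x2(1)]) auto
    have c': "l2_norm (conv ?p ?q) \<le> kappa * W * E"
    proof -
      have "l2_norm (conv ?p ?q) \<le> (\<Sum>\<^sub>\<infinity>k. bracket k * norm (w k)) * E"
        unfolding cm using Young_l2_norm[OF sw(1) _ x2(1)] by (simp add: x2(2))
      also have "\<dots> \<le> (kappa * W) * E" using sw(2) EW by (intro mult_right_mono) auto
      finally show ?thesis .
    qed
    have s: "(\<lambda>b. ?p b * ?q (k - b)) summable_on UNIV" for k
    proof -
      have "(\<lambda>b. ?q b * ?p (k - b)) summable_on UNIV"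
        by (rule Young_summable[OF sw(1) _ x2(1)]) auto
      then have "(\<lambda>b. (\<lambda>b. ?p b * ?q (k - b)) (k - b)) summable_on UNIV"
        by (simp add: mult_ac)
      then show ?thesis
        by (rule iffD1[OF summable_on_reflect[of "\<lambda>b. ?p b * ?q (k - b)" k]])
    qed
    show "B summable_on UNIV \<times> UNIV"
      unfolding B_def by (rule trilinear_summable[OF x2(1) _ _ _ s c c']) auto
    have "infsum B (UNIV \<times> UNIV) \<le> E * (kappa * W * E)"
      unfolding B_def x2(2)[symmetric] by (rule trilinear_le[OF x2(1) _ _ _ s c c'[unfolded x2(2)[symmetric]]]) auto
    then show "infsum B (UNIV \<times> UNIV) \<le> kappa * E\<^sup>2 * W" by (simp add: power2_eq_square mult_ac)
  qed
  have normAB: "norm (Z k b + cnj (Z b k)) \<le> \<tau> / 2 * (A (k, b) + 3 * B (k, b))" for k b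
  proof -
    define N where "N = norm (e k) * (norm (e b) * norm (w (k - b)))"
    have N: "0 \<le> N" by (simp add: N_def)
    have "norm (S k b) = N / 2 * norm (phase_integral t \<tau> (k * b * (k - b)))"
      unfolding S_def N_def by (simp add: norm_mult norm_divide)
    also have "\<dots> \<le> N / 2 * \<tau>" using norm_phase_integral_le[OF \<tau>] N by (intro mult_left_mono) auto
    finally have S: "norm (S k b) \<le> N / 2 * \<tau>" .
    have "norm (Z k b + cnj (Z b k)) = \<bar>(bracket k)\<^sup>2 * real_of_int k - (bracket b)\<^sup>2 * real_of_int b\<bar> * norm (S k b)"
      unfolding anti norm_mult norm_of_real ..
    also have "\<dots> \<le> (bracket (k - b) ^ 3 + 3 * (bracket k * bracket b * bracket (k - b))) * (N / 2 * \<tau>)"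
      by (intro mult_mono symmetrised_weight_le S) auto
    also have "\<dots> = \<tau> / 2 * (A (k, b) + 3 * B (k, b))"
      by (simp add: A_def B_def N_def algebra_simps)
    finally show ?thesis .
  qed
  have AB: "(\<lambda>p. \<tau> / 2 * (A p + 3 * B p)) summable_on UNIV \<times> UNIV"
    by (intro summable_on_cmult_right summable_on_add A B)
  have "norm (X + cnj X) \<le> (\<Sum>\<^sub>\<infinity>p\<in>UNIV \<times> UNIV. \<tau> / 2 * (A p + 3 * B p))"
    by (rule norm_infsum_le[OF hs2 has_sum_infsum[OF AB]]) (use normAB in auto)
  also have "\<dots> = \<tau> / 2 * (infsum A (UNIV \<times> UNIV) + 3 * infsum B (UNIV \<times> UNIV))"
    by (intro infsumI has_sum_cmult_right has_sum_add has_sum_infsum A B)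
  also have "\<dots> \<le> \<tau> / 2 * (kappa * E\<^sup>2 * W + 3 * (kappa * E\<^sup>2 * W))"
    using A(2) B(2) \<tau> by (intro mult_left_mono add_mono) auto
  also have "norm (X + cnj X) = 2 * \<bar>Re X\<bar>"
    by (simp add: complex_add_cnj norm_mult)
  finally have "\<bar>Re X\<bar> \<le> kappa * W * \<tau> * E\<^sup>2" by (simp add: algebra_simps)
  then show ?thesis unfolding inner E_def W_def .
qed

text \<open>
  Chosen so that the square of \<open>1 + L \<tau>\<close>, with this value of \<open>L\<close>, dominates
  \<open>1 + (4 \<kappa> M + 2 C + C\<^sup>2 (2 M + 1)\<^sup>2) \<tau>\<close>, the growth of the squared error in one step.
\<close>
definition growth_rate :: "real \<Rightarrow> real" where
  "growth_rate M = 2 * kappa * M + conv_const 1 + (conv_const 1 * (2 * M + 1))\<^sup>2"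

text \<open>
  Expanding \<open>\<parallel>e + r\<parallel>\<^sup>2\<close>: the energy estimate bounds the part of the scalar product with \<open>w\<close>, the part
  quadratic in \<open>e\<close> is at most \<open>C \<surd>\<tau> \<parallel>e\<parallel>\<^sup>3 \<le> C \<tau> \<parallel>e\<parallel>\<^sup>2\<close> by the smallness assumption, and
  \<open>\<parallel>r\<parallel>\<^sup>2\<close> is of order \<open>\<tau> \<parallel>e\<parallel>\<^sup>2\<close>.
\<close>
lemma stability:
  fixes t :: real
  assumes e: "in_H 1 e" "e 0 = 0" and w: "in_H 3 w" "w 0 = 0" "hermitian w" and \<tau>: "0 \<le> \<tau>" "\<tau> \<le> 1"
    and M: "H_norm 3 w \<le> M" and small: "H_norm 1 e \<le> sqrt \<tau>"
  defines "r \<equiv> \<lambda>k. 2 * exp_step t \<tau> e w k - exp_step t \<tau> e e k"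
  shows "in_H 1 (\<lambda>k. e k + r k)"
    and "H_norm 1 (\<lambda>k. e k + r k)
      \<le> (1 + growth_rate M * \<tau>) * H_norm 1 e"
proof -
  define E where "E = H_norm 1 e"
  define C where "C = conv_const 1"
  have C: "0 \<le> C" by (simp add: C_def)
  have E: "0 \<le> E" "E \<le> sqrt \<tau>" "E \<le> 1"
    using small \<tau> by (auto simp: E_def intro: order_trans real_sqrt_le_1_iff[THEN iffD2])
  have M0: "0 \<le> M" using M order_trans[OF H_norm_nonneg] by blast
  have w1: "in_H 1 w" "H_norm 1 w \<le> M"
    using in_H_le[OF w(1), of 1] H_norm_le[OF w(1), of 1] M by auto
  let ?p = "exp_step t \<tau> e w" and ?q = "exp_step t \<tau> e e"
  have p: "in_H 1 ?p" and q: "in_H 1 ?q"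
    by (intro in_H_exp_step e w w1 \<tau> order_refl)+
  have p_le: "H_norm 1 ?p \<le> sqrt \<tau> * (C * E * M)"
  proof -
    have "H_norm 1 ?p \<le> sqrt \<tau> * (C * E * H_norm 1 w)"
      unfolding C_def E_def by (intro H_norm_exp_step e w w1 \<tau> order_refl)
    also have "\<dots> \<le> sqrt \<tau> * (C * E * M)"
      using w1(2) C E \<tau> by (intro mult_left_mono) auto
    finally show ?thesis .
  qed
  have q_le: "H_norm 1 ?q \<le> sqrt \<tau> * (C * E * E)"
    unfolding C_def E_def by (intro H_norm_exp_step e \<tau> order_refl)
  have p2: "in_H 1 (\<lambda>k. ?p k + ?p k)" by (rule in_H_add[OF p p])
  have r_eq: "r = (\<lambda>k. (?p k + ?p k) - ?q k)" by (simp add: r_def)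
  have r: "in_H 1 r" unfolding r_eq by (rule in_H_diff[OF p2 q])
  show "in_H 1 (\<lambda>k. e k + r k)" by (rule in_H_add[OF e(1) r])
  have r_le: "H_norm 1 r \<le> sqrt \<tau> * (C * (2 * M + 1) * E)"
  proof -
    have "H_norm 1 r \<le> (H_norm 1 ?p + H_norm 1 ?p) + H_norm 1 ?q"
      unfolding r_eq using H_norm_triangle_diff[OF p2 q] H_norm_triangle[OF p p] by linarith
    also have "\<dots> \<le> 2 * (sqrt \<tau> * (C * E * M)) + sqrt \<tau> * (C * E * E)" using p_le q_le by linarith
    also have "\<dots> \<le> 2 * (sqrt \<tau> * (C * E * M)) + sqrt \<tau> * (C * E * 1)"
      using C E \<tau> by (intro add_mono mult_left_mono order_refl mult_nonneg_nonneg) auto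
    finally show ?thesis by (simp add: algebra_simps)
  qed
  have inner: "H1_inner e r \<le> 2 * (kappa * M * \<tau> * E\<^sup>2) + C * \<tau> * E\<^sup>2"
  proof -
    have "H1_inner e r = H1_inner e ?p + H1_inner e ?p - H1_inner e ?q"
      unfolding r_eq using H1_inner_diff[OF e(1) p2 q] H1_inner_add[OF e(1) p p] by simp
    also have "\<dots> \<le> 2 * \<bar>H1_inner e ?p\<bar> + \<bar>H1_inner e ?q\<bar>" by linarith
    also have "\<bar>H1_inner e ?p\<bar> \<le> kappa * M * \<tau> * E\<^sup>2"
    proof -
      have "\<bar>H1_inner e ?p\<bar> \<le> kappa * H_norm 3 w * \<tau> * E\<^sup>2"
        unfolding E_def by (rule energy_estimate[OF e w \<tau>(1)])
      also have "\<dots> \<le> kappa * M * \<tau> * E\<^sup>2"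
        using M \<tau> by (intro mult_right_mono mult_left_mono) auto
      finally show ?thesis .
    qed
    also have "\<bar>H1_inner e ?q\<bar> \<le> C * \<tau> * E\<^sup>2"
    proof -
      have "\<bar>H1_inner e ?q\<bar> \<le> E * H_norm 1 ?q"
        unfolding E_def by (rule H1_inner_le[OF e(1) q])
      also have "\<dots> \<le> E * (sqrt \<tau> * (C * E * E))" using q_le E by (intro mult_left_mono) auto
      also have "\<dots> = (C * sqrt \<tau> * E\<^sup>2) * E" by (simp add: power2_eq_square)
      also have "\<dots> \<le> (C * sqrt \<tau> * E\<^sup>2) * sqrt \<tau>"
        using E C \<tau> by (intro mult_left_mono) auto
      also have "\<dots> = C * \<tau> * E\<^sup>2" using \<tau> by (simp add: mult_ac)
      finally show ?thesis .
    qed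
    finally show ?thesis by linarith
  qed
  define L where "L = 2 * kappa * M + C + (C * (2 * M + 1))\<^sup>2"
  have L: "0 \<le> L" using M0 C by (simp add: L_def)
  have split: "(H_norm 1 (\<lambda>k. e k + r k))\<^sup>2 = E\<^sup>2 + 2 * H1_inner e r + (H_norm 1 r)\<^sup>2"
    unfolding E_def by (rule H_norm1_add_power2[OF e(1) r])
  have "(H_norm 1 r)\<^sup>2 \<le> (sqrt \<tau> * (C * (2 * M + 1) * E))\<^sup>2"
    by (rule power_mono[OF r_le]) simp
  also have "\<dots> = \<tau> * (C * (2 * M + 1))\<^sup>2 * E\<^sup>2"
    using \<tau> by (simp add: power_mult_distrib)
  finally have r_sq: "(H_norm 1 r)\<^sup>2 \<le> \<tau> * (C * (2 * M + 1))\<^sup>2 * E\<^sup>2" .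
  have "(H_norm 1 (\<lambda>k. e k + r k))\<^sup>2
      \<le> E\<^sup>2 + 2 * (2 * (kappa * M * \<tau> * E\<^sup>2) + C * \<tau> * E\<^sup>2) + \<tau> * (C * (2 * M + 1))\<^sup>2 * E\<^sup>2"
    unfolding split by (intro add_mono mult_left_mono inner r_sq order_refl) simp
  also have "\<dots> \<le> ((1 + L * \<tau>) * E)\<^sup>2"
  proof -
    have "((1 + (2 * kappa * M + C + P) * \<tau>) * E)\<^sup>2 = E\<^sup>2 + 2 * (2 * (kappa * M * \<tau> * E\<^sup>2) + C * \<tau> * E\<^sup>2)
        + \<tau> * P * E\<^sup>2 + (\<tau> * P * E\<^sup>2 + ((2 * kappa * M + C + P) * \<tau> * E)\<^sup>2)" for P
      by (simp add: power2_eq_square algebra_simps)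
    from this[of "(C * (2 * M + 1))\<^sup>2"]
    have "((1 + L * \<tau>) * E)\<^sup>2 = E\<^sup>2 + 2 * (2 * (kappa * M * \<tau> * E\<^sup>2) + C * \<tau> * E\<^sup>2)
        + \<tau> * (C * (2 * M + 1))\<^sup>2 * E\<^sup>2 + (\<tau> * (C * (2 * M + 1))\<^sup>2 * E\<^sup>2 + (L * \<tau> * E)\<^sup>2)"
      unfolding L_def .
    moreover have "0 \<le> \<tau> * (C * (2 * M + 1))\<^sup>2 * E\<^sup>2 + (L * \<tau> * E)\<^sup>2" using \<tau> by simp
    ultimately show ?thesis by linarith
  qed
  finally have "H_norm 1 (\<lambda>k. e k + r k) \<le> (1 + L * \<tau>) * E"
    by (rule power2_le_imp_le) (use L \<tau> E in simp)
  then show "H_norm 1 (\<lambda>k. e k + r k)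
      \<le> (1 + growth_rate M * \<tau>) * H_norm 1 e"
    unfolding L_def C_def E_def growth_rate_def .
qed

section \<open>The scheme in Fourier variables and its convergence\<close>

lemma fourier_series_combine:
  assumes "(\<lambda>k. norm (a k)) summable_on UNIV" "(\<lambda>k. norm (b k)) summable_on UNIV" "(\<lambda>k. norm (d k)) summable_on UNIV"
  shows "fourier_series (\<lambda>k. a k + \<alpha> * b k - \<alpha> * d k) x = fourier_series a x + \<alpha> * fourier_series b x - \<alpha> * fourier_series d x"
proof -
  have "((\<lambda>k. a k * exp (\<i> * of_int k * of_real x) + \<alpha> * (b k * exp (\<i> * of_int k * of_real x))
      - \<alpha> * (d k * exp (\<i> * of_int k * of_real x))) has_sum (fourier_series a x + \<alpha> * fourier_series b x - \<alpha> * fourier_series d x)) UNIV"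
    unfolding fourier_series_def
    by (intro has_sum_minus has_sum_add has_sum_cmult_right has_sum_infsum fourier_series_summable assms)
  then show ?thesis
    unfolding fourier_series_def[of "\<lambda>k. a k + \<alpha> * b k - \<alpha> * d k"]
    by (intro infsumI) (simp add: algebra_simps)
qed

lemma fourier_series_in_sobolev_space:
  assumes c: "in_H r c" "1 \<le> r" "hermitian c"
  shows "(\<lambda>x. Re (fourier_series c x)) \<in> sobolev_space r"
proof -
  have s: "(\<lambda>k. norm (c k)) summable_on UNIV" by (rule in_H_summable_norm[OF c(1,2)])
  have cf: "fourier_coeff (\<lambda>x. Re (fourier_series c x)) = c"
    using fourier_coeff_fourier_series[OF s c(3)] by auto
  have m: "fourier_series c \<in> borel_measurable borel" by (rule fourier_series_measurable[OF s])
  have "continuous_on {-pi..pi} (\<lambda>x. (Re (fourier_series c x))\<^sup>2)"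
    by (intro continuous_intros continuous_on_fourier_series s)
  then have "set_integrable lborel {-pi..pi} (\<lambda>x. (Re (fourier_series c x))\<^sup>2)"
    by (rule borel_integrable_atLeastAtMost')
  moreover have "(\<lambda>k. (1 + (real_of_int k)\<^sup>2) ^ r * (norm (c k))\<^sup>2) summable_on UNIV"
    using c(1) unfolding in_H_def square_summable_def weight_eq .
  ultimately show ?thesis
    unfolding sobolev_space_def mem_Collect_eq cf using m by (auto simp: fourier_series_periodic)
qed

lemma sobolev_space_mult_char_integrable:
  assumes f: "f \<in> sobolev_space r"
  shows "set_integrable lborel {-pi..pi} (\<lambda>x. complex_of_real (f x) * exp (- (\<i> * of_int k * of_real x)))"
proof -
  have "integrable lborel (\<lambda>x. complex_of_real (indicator {-pi..pi} x *\<^sub>R f x) * exp (- (\<i> * of_int k * of_real x)))"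
    using sobolev_space_set_integrable[OF f] unfolding set_integrable_def
    by (intro integrable_mult_bounded[where B=1] integrable_of_real) auto
  then show ?thesis by (simp add: set_integrable_def scaleR_conv_of_real mult.assoc)
qed

lemma
  assumes f: "f \<in> sobolev_space r" and g: "g \<in> sobolev_space r"
  shows fourier_coeff_diff: "fourier_coeff (\<lambda>x. f x - g x) = (\<lambda>k. fourier_coeff f k - fourier_coeff g k)"
    and sobolev_space_diff: "(\<lambda>x. f x - g x) \<in> sobolev_space r"
proof -
  have [measurable]: "f \<in> borel_measurable borel" "g \<in> borel_measurable borel"
    and f2: "set_integrable lborel {-pi..pi} (\<lambda>x. (f x)\<^sup>2)" and g2: "set_integrable lborel {-pi..pi} (\<lambda>x. (g x)\<^sup>2)"
    and per: "\<And>x. f (x + 2 * pi) = f x" "\<And>x. g (x + 2 * pi) = g x"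
    using f g by (auto simp: sobolev_space_def)
  have "fourier_coeff (\<lambda>x. f x - g x) k = fourier_coeff f k - fourier_coeff g k" for k
    unfolding fourier_coeff_def of_real_diff left_diff_distrib
    using set_integral_diff(2)[OF sobolev_space_mult_char_integrable[OF f] sobolev_space_mult_char_integrable[OF g], of k k]
    by (simp add: diff_divide_distrib)
  then show cf: "fourier_coeff (\<lambda>x. f x - g x) = (\<lambda>k. fourier_coeff f k - fourier_coeff g k)" by auto
  have "in_H r (\<lambda>k. fourier_coeff f k - fourier_coeff g k)"
    by (intro in_H_diff in_H_fourier_coeff f g)
  then have s: "(\<lambda>k. (1 + (real_of_int k)\<^sup>2) ^ r * (norm (fourier_coeff (\<lambda>x. f x - g x) k))\<^sup>2) summable_on UNIV"
    unfolding cf in_H_def square_summable_def weight_eq .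
  have "set_integrable lborel {-pi..pi} (\<lambda>x. 2 * (f x)\<^sup>2 + 2 * (g x)\<^sup>2)"
    by (intro set_integral_add set_integrable_mult_right f2 g2)
  then have 1: "integrable lborel (\<lambda>x. indicator {-pi..pi} x *\<^sub>R (2 * (f x)\<^sup>2 + 2 * (g x)\<^sup>2))"
    by (simp add: set_integrable_def)
  have le: "(x - y)\<^sup>2 \<le> 2 * x\<^sup>2 + 2 * y\<^sup>2" for x y :: real
    using zero_le_power2[of "x + y"] unfolding power2_sum power2_diff by linarith
  have "set_integrable lborel {-pi..pi} (\<lambda>x. (f x - g x)\<^sup>2)"
    unfolding set_integrable_def
  proof (rule Bochner_Integration.integrable_bound[OF 1])
    show "AE x in lborel. norm (indicator {-pi..pi} x *\<^sub>R (f x - g x)\<^sup>2)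
        \<le> norm (indicator {-pi..pi} x *\<^sub>R (2 * (f x)\<^sup>2 + 2 * (g x)\<^sup>2))"
      using le by (intro AE_I2) (auto simp: indicator_def abs_of_nonneg add_nonneg_nonneg)
  qed measurable
  with s show "(\<lambda>x. f x - g x) \<in> sobolev_space r"
    unfolding sobolev_space_def by (auto simp: per)
qed

lemma sobolev_space_le: "f \<in> sobolev_space r \<Longrightarrow> s \<le> r \<Longrightarrow> f \<in> sobolev_space s"
  using in_H_le[OF in_H_fourier_coeff, of f r s]
  unfolding sobolev_space_def in_H_def square_summable_def weight_eq by simp

definition dx_inv_symbol :: "int \<Rightarrow> complex" where
  "dx_inv_symbol k = (if k = 0 then 0 else inverse (\<i> * of_int k))"

lemma norm_dx_inv_symbol: "norm (dx_inv_symbol k) \<le> 1"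
proof (cases "k = 0")
  case False
  then have "1 \<le> \<bar>k\<bar>" by simp
  then have "1 \<le> \<bar>real_of_int k\<bar>" by linarith
  then show ?thesis using False by (simp add: dx_inv_symbol_def norm_inverse norm_mult inverse_le_1_iff)
qed (simp add: dx_inv_symbol_def)

text \<open>
  The algebra behind the scheme: \<open>(i k / 2) / (- 3 i k a b) = (1/6) (i a)\<^sup>-\<^sup>1 (i b)\<^sup>-\<^sup>1\<close>. For
  \<open>a = 0\<close> or \<open>b = 0\<close> both sides vanish because of the zero mean, for \<open>k = 0\<close> because the phase is constant.
\<close>
lemma resonance_identity:
  assumes \<tau>: "0 \<le> \<tau>" and f: "f 0 = 0"
  shows "1/6 * ((phase (t + \<tau>) (k * a * (k - a)) - phase t (k * a * (k - a)))
        * ((dx_inv_symbol a * f a) * (dx_inv_symbol (k - a) * f (k - a))))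
      = \<i> * of_int k / 2 * (phase_integral t \<tau> (k * a * (k - a)) * (f a * f (k - a)))"
proof -
  consider "a = 0 \<or> k - a = 0" | "k = 0" "a \<noteq> 0" | "k \<noteq> 0" "a \<noteq> 0" "k - a \<noteq> 0" by blast
  then show ?thesis
  proof cases
    case 1
    then show ?thesis using f by auto
  next
    case 2
    then show ?thesis by (simp add: phase_def)
  next
    case 3
    define y where "y = k * a * (k - a)"
    have y: "y \<noteq> 0" using 3 by (simp add: y_def)
    have yc: "complex_of_int y = of_int k * of_int a * of_int (k - a)" by (simp only: y_def of_int_mult)
    define A where "A = complex_of_int a"
    define B where "B = complex_of_int (k - a)"
    define K where "K = complex_of_int k"
    have nz: "A \<noteq> 0" "B \<noteq> 0" "K \<noteq> 0" using 3 unfolding A_def B_def K_def of_int_eq_0_iff by auto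
    have s: "dx_inv_symbol a = inverse (\<i> * A)" "dx_inv_symbol (k - a) = inverse (\<i> * B)"
      using 3 by (simp_all add: dx_inv_symbol_def A_def B_def)
    have D: "1/6 * (D * ((inverse (\<i> * A) * x) * (inverse (\<i> * B) * z)))
        = \<i> * K / 2 * ((- D) / (3 * \<i> * (K * A * B)) * (x * z))" for D x z
      using nz by (simp add: field_simps)
    show ?thesis
      unfolding y_def[symmetric] phase_integral_eq[OF \<tau> y] yc s A_def[symmetric] B_def[symmetric] K_def[symmetric] D
      by simp
  qed
qed

text \<open>
  One step of the scheme is an absolutely convergent Fourier series. Twisting its coefficients turns each of the two
  squares into a convolution with a phase, at time \<open>t + \<tau>\<close> and \<open>t\<close> respectively, and the resonance identity
  recognises their difference as \<open>exp_step\<close>.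
\<close>
lemma
  assumes v: "in_H 1 (fourier_coeff v)" "fourier_coeff v 0 = 0" and \<tau>: "0 \<le> \<tau>"
  defines "v' \<equiv> \<lambda>x. airy_group (- \<tau>) v x + 1/6 * (airy_group (- \<tau>) (dx_inv v) x)\<^sup>2
     - 1/6 * airy_group (- \<tau>) (\<lambda>y. (dx_inv v y)\<^sup>2) x"
  shows twist_scheme_step: "twist (t + \<tau>) (fourier_coeff v')
      = (\<lambda>k. twist t (fourier_coeff v) k + exp_step t \<tau> (twist t (fourier_coeff v)) (twist t (fourier_coeff v)) k)"
    and scheme_step_in_sobolev_space: "v' \<in> sobolev_space 1"
proof -
  define c where "c = fourier_coeff v"
  define E where "E k = exp (- (\<i> * complex_of_real (- \<tau>) * of_int k ^ 3))" for k
  define q where "q k = dx_inv_symbol k * c k" for k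
  define p where "p k = E k * q k" for k
  have nE: "norm (E k) = 1" for k unfolding E_def by (rule norm_exp_cube(1))
  have hc: "hermitian c" unfolding c_def by (rule hermitian_fourier_coeff)
  have hm: "cnj (dx_inv_symbol k) = dx_inv_symbol (- k)" for k
    by (simp add: dx_inv_symbol_def)
  have hE: "cnj (E k) = E (- k)" for k by (simp add: E_def exp_cnj)
  have hq: "hermitian q" using hc by (simp add: hermitian_def q_def hm)
  have hp: "hermitian p" using hq by (simp add: hermitian_def p_def hE)
  have sc: "(\<lambda>k. norm (c k)) summable_on UNIV"
    using in_H_summable_norm[OF v(1)] by (simp add: c_def)
  have sq: "(\<lambda>k. norm (q k)) summable_on UNIV"
    by (rule summable_on_comparison_test[OF sc])
       (use norm_dx_inv_symbol in \<open>auto simp: q_def norm_mult intro!: mult_left_le_one_le\<close>)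
  have sp: "(\<lambda>k. norm (p k)) summable_on UNIV"
    using sq by (simp add: p_def norm_mult nE)
  have sEc: "(\<lambda>k. norm (E k * c k)) summable_on UNIV"
    using sc by (simp add: norm_mult nE)
  have spp: "(\<lambda>k. norm (conv p p k)) summable_on UNIV" by (rule conv_abs_summable[OF sp sp])
  have sqq: "(\<lambda>k. norm (conv q q k)) summable_on UNIV" by (rule conv_abs_summable[OF sq sq])
  have sEqq: "(\<lambda>k. norm (E k * conv q q k)) summable_on UNIV"
    using sqq by (simp add: norm_mult nE)
  have hpp: "hermitian (conv p p)" and hqq: "hermitian (conv q q)"
    by (intro hermitian_conv hp hq)+
  have dxi: "dx_inv v = (\<lambda>x. Re (fourier_series q x))"
    unfolding dx_inv_def fourier_multiplier_eq_fourier_series q_def c_def dx_inv_symbol_def ..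
  have fq: "fourier_coeff (dx_inv v) = q"
    unfolding dxi using fourier_coeff_fourier_series[OF sq hq] by auto
  have a1: "airy_group (- \<tau>) v = (\<lambda>x. Re (fourier_series (\<lambda>k. E k * c k) x))"
    unfolding airy_group_def fourier_multiplier_eq_fourier_series E_def c_def ..
  have a2: "airy_group (- \<tau>) (dx_inv v) = (\<lambda>x. Re (fourier_series p x))"
    unfolding airy_group_def fourier_multiplier_eq_fourier_series E_def p_def fq ..
  have sqr: "fourier_coeff (\<lambda>y. (dx_inv v y)\<^sup>2) = conv q q"
    unfolding dxi by (rule fourier_coeff_square[OF sq hq])
  have a3: "airy_group (- \<tau>) (\<lambda>y. (dx_inv v y)\<^sup>2) = (\<lambda>x. Re (fourier_series (\<lambda>k. E k * conv q q k) x))"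
    unfolding airy_group_def fourier_multiplier_eq_fourier_series E_def sqr ..
  define c' where "c' k = E k * c k + complex_of_real (1/6) * conv p p k - complex_of_real (1/6) * (E k * conv q q k)" for k
  have v': "v' = (\<lambda>x. Re (fourier_series c' x))"
  proof
    fix x
    have "fourier_series c' x = fourier_series (\<lambda>k. E k * c k) x + complex_of_real (1/6) * fourier_series (conv p p) x - complex_of_real (1/6) * fourier_series (\<lambda>k. E k * conv q q k) x"
      unfolding c'_def[abs_def] by (rule fourier_series_combine[OF sEc spp sEqq])
    then show "v' x = Re (fourier_series c' x)"
      unfolding v'_def a1 a2 a3 power2_fourier_series[OF sp hp] minus_complex.sel plus_complex.sel Re_of_real_mult by simp
  qed
  have tw: "twist (t + \<tau>) c' k = twist t c k + exp_step t \<tau> (twist t c) (twist t c) k" for k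
  proof -
    define F where "F s k = exp (- (\<i> * complex_of_real s * of_int k ^ 3))" for s and k :: int
    define f where "f = twist t c"
    have FE: "F (t + \<tau>) k * E k = F t k" for k
      unfolding F_def E_def exp_add[symmetric] by (rule arg_cong[where f=exp]) (simp add: algebra_simps)
    have Fq: "F t a * q a = dx_inv_symbol a * f a" for a
      by (simp add: q_def f_def twist_def F_def)
    have Fp: "F (t + \<tau>) a * p a = dx_inv_symbol a * f a" for a
      unfolding p_def mult.assoc[symmetric] FE Fq ..
    let ?g = "\<lambda>a. (dx_inv_symbol a * f a) * (dx_inv_symbol (k - a) * f (k - a))"
    have abs_q: "(\<lambda>a. norm (q a * q (k - a))) summable_on UNIV"
    proof (rule summable_on_comparison_test)
      show "(\<lambda>a. norm (q a) * (\<Sum>\<^sub>\<infinity>b. norm (q b))) summable_on UNIV" by (rule summable_on_cmult_left[OF sq])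
      have "norm (q b) \<le> (\<Sum>\<^sub>\<infinity>b. norm (q b))" for b
        using finite_sum_le_infsum[OF sq, of "{b}"] by simp
      then show "norm (q a * q (k - a)) \<le> norm (q a) * (\<Sum>\<^sub>\<infinity>b. norm (q b))" for a
        unfolding norm_mult by (intro mult_left_mono) auto
    qed simp
    have nF: "norm (F s a) = 1" for s a unfolding F_def by (rule norm_exp_cube(1))
    have ng: "norm (?g a) = norm (q a * q (k - a))" for a
      unfolding Fq[symmetric] by (simp add: norm_mult nF)
    have sg: "(\<lambda>a. phase s (k * a * (k - a)) * ?g a) summable_on UNIV" for s
      by (rule abs_summable_summable) (use abs_q in \<open>simp only: norm_mult[of "phase _ _"] ng norm_phase mult_1\<close>)
    have c1: "F (t + \<tau>) k * conv p p k = (\<Sum>\<^sub>\<infinity>a. phase (t + \<tau>) (k * a * (k - a)) * ?g a)"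
      unfolding conv_def infsum_cmult_right'[symmetric] F_def phase_cube
      unfolding F_def[symmetric] Fp ..
    have c2: "F t k * conv q q k = (\<Sum>\<^sub>\<infinity>a. phase t (k * a * (k - a)) * ?g a)"
      unfolding conv_def infsum_cmult_right'[symmetric] F_def phase_cube
      unfolding F_def[symmetric] Fq ..
    have "twist (t + \<tau>) c' k = (F (t + \<tau>) k * E k) * c k + 1/6 * (F (t + \<tau>) k * conv p p k) - 1/6 * ((F (t + \<tau>) k * E k) * conv q q k)"
      unfolding twist_def F_def[symmetric] c'_def by (simp add: algebra_simps)
    also have "\<dots> = f k + 1/6 * ((\<Sum>\<^sub>\<infinity>a. phase (t + \<tau>) (k * a * (k - a)) * ?g a) - (\<Sum>\<^sub>\<infinity>a. phase t (k * a * (k - a)) * ?g a))"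
      unfolding FE c1 c2 by (simp add: f_def twist_def F_def algebra_simps)
    also have "(\<Sum>\<^sub>\<infinity>a. phase (t + \<tau>) (k * a * (k - a)) * ?g a) - (\<Sum>\<^sub>\<infinity>a. phase t (k * a * (k - a)) * ?g a)
       = (\<Sum>\<^sub>\<infinity>a. phase (t + \<tau>) (k * a * (k - a)) * ?g a - phase t (k * a * (k - a)) * ?g a)"
      by (rule infsumI[symmetric]) (intro has_sum_minus has_sum_infsum sg)
    also have "1/6 * \<dots> = (\<Sum>\<^sub>\<infinity>a. 1/6 * ((phase (t + \<tau>) (k * a * (k - a)) - phase t (k * a * (k - a))) * ?g a))"
      unfolding infsum_cmult_right' left_diff_distrib ..
    also have "\<dots> = exp_step t \<tau> f f k"
      unfolding exp_step_def infsum_cmult_right'[symmetric]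
      by (intro infsum_cong resonance_identity \<tau>) (use v(2) in \<open>simp add: f_def twist_def c_def\<close>)
    finally show ?thesis unfolding f_def .
  qed
  have twc: "in_H 1 (twist t c)" "twist t c 0 = 0" for t
    using v in_H_cong_norm[of "twist t c" c 1, OF norm_twist] by (simp_all add: c_def twist_def)
  have "in_H 1 (\<lambda>k. twist t c k + exp_step t \<tau> (twist t c) (twist t c) k)"
    by (intro in_H_add in_H_exp_step twc \<tau> order_refl)
  then have "in_H 1 (twist (t + \<tau>) c')" unfolding tw[symmetric] .
  then have c'1: "in_H 1 c'"
    using in_H_cong_norm[of "twist (t + \<tau>) c'" c' 1, OF norm_twist] by simp
  have hc': "hermitian c'"
    using hc hpp hqq unfolding hermitian_def c'_def by (simp add: hE)
  show "v' \<in> sobolev_space 1"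
    unfolding v' by (rule fourier_series_in_sobolev_space[OF c'1 order_refl hc'])
  have "fourier_coeff v' = c'"
    unfolding v' using fourier_coeff_fourier_series[OF in_H_summable_norm[OF c'1 order_refl] hc'] by auto
  then show "twist (t + \<tau>) (fourier_coeff v')
      = (\<lambda>k. twist t (fourier_coeff v) k + exp_step t \<tau> (twist t (fourier_coeff v)) (twist t (fourier_coeff v)) k)"
    using tw unfolding c_def by auto
qed

definition consistency_const :: "real \<Rightarrow> real" where
  "consistency_const M = conv_const 2 * conv_const 3 * M ^ 3"

text \<open>
  The cut-offs at 0 make the constant monotone on all of \<open>\<real> \<times> \<real>\<close>.
\<close>
definition error_const :: "real \<Rightarrow> real \<Rightarrow> real" where
  "error_const M t = consistency_const (max 0 M) * max 0 t * exp (growth_rate (max 0 M) * max 0 t)"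

lemma error_const_nonneg: "0 \<le> error_const M t"
  by (simp add: error_const_def consistency_const_def)

lemma growth_rate_nonneg: "0 \<le> M \<Longrightarrow> 0 \<le> growth_rate M"
  by (simp add: growth_rate_def)

lemma growth_rate_mono: "0 \<le> M \<Longrightarrow> M \<le> M' \<Longrightarrow> growth_rate M \<le> growth_rate M'"
  unfolding growth_rate_def
  by (intro add_mono mult_left_mono power_mono order_refl) auto

lemma error_const_mono:
  assumes "M \<le> M'" "t \<le> t'"
  shows "error_const M t \<le> error_const M' t'"
proof -
  have m: "max 0 M \<le> max 0 M'" "max 0 t \<le> max 0 t'" using assms by auto
  have "consistency_const (max 0 M) \<le> consistency_const (max 0 M')"
    unfolding consistency_const_def by (intro mult_left_mono power_mono m mult_nonneg_nonneg) auto
  moreover have "growth_rate (max 0 M) * max 0 t \<le> growth_rate (max 0 M') * max 0 t'"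
    by (intro mult_mono growth_rate_mono m growth_rate_nonneg) auto
  moreover have "0 \<le> consistency_const (max 0 M')" "0 \<le> consistency_const (max 0 M)"
    by (simp_all add: consistency_const_def)
  ultimately show ?thesis
    unfolding error_const_def using m by (intro mult_mono mult_nonneg_nonneg) auto
qed

lemma discrete_Gronwall_step:
  fixes L D \<tau> :: real
  assumes "x \<le> D * \<tau>\<^sup>2 * real m * (1 + L * \<tau>) ^ m" "y \<le> (1 + L * \<tau>) * x + D * \<tau>\<^sup>2"
    "0 \<le> D" "0 \<le> L" "0 \<le> \<tau>"
  shows "y \<le> D * \<tau>\<^sup>2 * real (Suc m) * (1 + L * \<tau>) ^ Suc m"
proof -
  have ge1: "1 \<le> (1 + L * \<tau>) ^ Suc m" using assms by (intro one_le_power) simp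
  have "y \<le> (1 + L * \<tau>) * (D * \<tau>\<^sup>2 * real m * (1 + L * \<tau>) ^ m) + D * \<tau>\<^sup>2 * 1"
    using assms(2) mult_left_mono[OF assms(1), of "1 + L * \<tau>"] assms(4,5) by simp
  also have "\<dots> \<le> (1 + L * \<tau>) * (D * \<tau>\<^sup>2 * real m * (1 + L * \<tau>) ^ m) + D * \<tau>\<^sup>2 * (1 + L * \<tau>) ^ Suc m"
    using ge1 assms by (intro add_left_mono mult_left_mono) auto
  also have "\<dots> = D * \<tau>\<^sup>2 * real (Suc m) * (1 + L * \<tau>) ^ Suc m"
    by (simp add: algebra_simps)
  finally show ?thesis .
qed

context kdv_bounded
begin

lemma hermitian_w: "hermitian (w t)"
  using hermitian_fourier_coeff[of "u t"] by (simp add: hermitian_def w_def twist_def exp_cnj)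

definition scheme_w :: "real \<Rightarrow> nat \<Rightarrow> int \<Rightarrow> complex" where
  "scheme_w \<tau> n = twist (real n * \<tau>) (fourier_coeff (kdv_scheme \<tau> u0 n))"

definition err :: "real \<Rightarrow> nat \<Rightarrow> int \<Rightarrow> complex" where
  "err \<tau> n k = w (real n * \<tau>) k - scheme_w \<tau> n k"

text \<open>
  Discrete Gronwall argument. The last conjunct is carried along because, by the assumption \<open>small\<close>, it keeps the
  error below \<open>\<surd>\<tau>\<close>, as the stability estimate of the next step requires.
\<close>
lemma error_bound:
  assumes \<tau>: "0 < \<tau>" "\<tau> \<le> 1" and small: "error_const M T * \<tau> \<le> sqrt \<tau>"
    and n: "real n * \<tau> \<le> T"
  shows "in_H 1 (err \<tau> n) \<and> err \<tau> n 0 = 0 \<and> kdv_scheme \<tau> u0 n \<in> sobolev_space 1 \<and>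
    H_norm 1 (err \<tau> n) \<le> consistency_const M * \<tau>\<^sup>2 * real n * (1 + growth_rate M * \<tau>) ^ n \<and>
    H_norm 1 (err \<tau> n) \<le> error_const M T * \<tau>"
  using n
proof (induction n)
  case 0
  then have T: "0 \<in> {0..T}" by simp
  have u00: "u 0 = u0" using sol by (simp add: kdv_solution_def)
  have "err \<tau> 0 = (\<lambda>k. 0)" by (rule ext) (simp add: err_def scheme_w_def w_def u00)
  moreover have "u0 \<in> sobolev_space 1"
    using sobolev_space_le[OF H3[OF T], of 1] by (simp add: u00)
  moreover have "in_H 1 (\<lambda>k. 0 :: complex)" "H_norm 1 (\<lambda>k. 0 :: complex) = 0"
    by (simp_all add: in_H_def square_summable_def H_norm_def l2_norm_def)
  ultimately show ?case
    using \<tau> error_const_nonneg[of M T] by simp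
next
  case (Suc m)
  define t where "t = real m * \<tau>"
  have t: "0 \<le> t" "t + \<tau> \<le> T" "t \<in> {0..T}" and St: "real (Suc m) * \<tau> = t + \<tau>"
    using Suc.prems \<tau> by (auto simp: t_def algebra_simps)
  have M: "0 \<le> M" using t \<tau> by (intro M_nonneg) auto
  define e where "e = err \<tau> m"
  have IH: "in_H 1 e" "e 0 = 0" "kdv_scheme \<tau> u0 m \<in> sobolev_space 1"
    "H_norm 1 e \<le> consistency_const M * \<tau>\<^sup>2 * real m * (1 + growth_rate M * \<tau>) ^ m"
    "H_norm 1 e \<le> error_const M T * \<tau>"
    using Suc.IH t by (auto simp: e_def t_def)
  let ?v = "kdv_scheme \<tau> u0 m"
  let ?W = "scheme_w \<tau> m"
  have W_eq: "?W = (\<lambda>k. w t k - e k)" by (simp add: e_def err_def t_def)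
  have W0: "?W 0 = 0" unfolding W_eq using w_zero_mode[OF t(3)] IH(2) by simp
  have v: "in_H 1 (fourier_coeff ?v)" "fourier_coeff ?v 0 = 0"
    using in_H_fourier_coeff[OF IH(3)] W0 by (simp_all add: scheme_w_def twist_def)
  have \<tau>0: "0 \<le> \<tau>" using \<tau> by simp
  have W': "scheme_w \<tau> (Suc m) = (\<lambda>k. ?W k + exp_step t \<tau> ?W ?W k)"
    unfolding scheme_w_def St kdv_scheme.simps twist_scheme_step[OF v \<tau>0] t_def ..
  have v': "kdv_scheme \<tau> u0 (Suc m) \<in> sobolev_space 1"
    unfolding kdv_scheme.simps by (rule scheme_step_in_sobolev_space[OF v \<tau>0])
  define r where "r = (\<lambda>k. 2 * exp_step t \<tau> e (w t) k - exp_step t \<tau> e e k)"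
  define d where "d = (\<lambda>k. w (t + \<tau>) k - w t k - exp_step t \<tau> (w t) (w t) k)"
  have err_eq: "err \<tau> (Suc m) = (\<lambda>k. (e k + r k) + d k)"
  proof
    fix k
    have "err \<tau> (Suc m) k = w (t + \<tau>) k - (?W k + exp_step t \<tau> ?W ?W k)"
      unfolding err_def W' St ..
    also have "\<dots> = (e k + r k) + d k"
      unfolding W_eq exp_step_diff_square[OF in_H1_w[OF t(3)] IH(1) order_refl \<tau>0] r_def d_def by simp
    finally show "err \<tau> (Suc m) k = (e k + r k) + d k" .
  qed
  have sm: "H_norm 1 e \<le> sqrt \<tau>" using IH(5) small by linarith
  have st: "in_H 1 (\<lambda>k. e k + r k)" "H_norm 1 (\<lambda>k. e k + r k) \<le> (1 + growth_rate M * \<tau>) * H_norm 1 e"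
    unfolding r_def
    by (rule stability[OF IH(1,2) in_H_w[OF t(3)] w_zero_mode[OF t(3)] hermitian_w \<tau>0 \<tau>(2) H_norm_w[OF t(3)] sm])+
  have d: "in_H 1 d" "H_norm 1 d \<le> consistency_const M * \<tau>\<^sup>2"
    unfolding d_def consistency_const_def using in_H_local_error[OF t(1) \<tau>0 t(2)] local_error[OF t(1) \<tau>0 t(2)] .
  have 1: "in_H 1 (err \<tau> (Suc m))" unfolding err_eq by (rule in_H_add[OF st(1) d(1)])
  have 2: "err \<tau> (Suc m) 0 = 0"
    unfolding err_eq using IH(2) w_zero_mode[OF t(3)] w_zero_mode[of "t + \<tau>"] t \<tau>
    by (simp add: r_def d_def exp_step_def)
  have step: "H_norm 1 (err \<tau> (Suc m)) \<le> (1 + growth_rate M * \<tau>) * H_norm 1 e + consistency_const M * \<tau>\<^sup>2"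
    unfolding err_eq using H_norm_triangle[OF st(1) d(1)] st(2) d(2) by linarith
  have D: "0 \<le> consistency_const M" using M by (simp add: consistency_const_def)
  have 3: "H_norm 1 (err \<tau> (Suc m)) \<le> consistency_const M * \<tau>\<^sup>2 * real (Suc m) * (1 + growth_rate M * \<tau>) ^ Suc m"
    by (rule discrete_Gronwall_step[OF IH(4) step D growth_rate_nonneg[OF M] \<tau>0])
  also have "\<dots> \<le> error_const M T * \<tau>"
  proof -
    have T0: "0 \<le> T" using t by auto
    have "1 + growth_rate M * \<tau> \<le> exp (growth_rate M * \<tau>)" by (rule exp_ge_add_one_self)
    then have "(1 + growth_rate M * \<tau>) ^ Suc m \<le> exp (growth_rate M * \<tau>) ^ Suc m"
      using growth_rate_nonneg[OF M] \<tau>0 by (intro power_mono) auto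
    also have "\<dots> = exp (growth_rate M * (real (Suc m) * \<tau>))"
      unfolding exp_of_nat_mult[symmetric] by (simp add: mult_ac)
    also have "\<dots> \<le> exp (growth_rate M * T)"
      using Suc.prems growth_rate_nonneg[OF M] by (simp add: mult_left_mono)
    finally have e: "(1 + growth_rate M * \<tau>) ^ Suc m \<le> exp (growth_rate M * T)" .
    have "consistency_const M * \<tau>\<^sup>2 * real (Suc m) * (1 + growth_rate M * \<tau>) ^ Suc m
        = (consistency_const M * \<tau>) * ((real (Suc m) * \<tau>) * (1 + growth_rate M * \<tau>) ^ Suc m)"
      by (simp add: power2_eq_square mult_ac)
    also have "\<dots> \<le> (consistency_const M * \<tau>) * (T * exp (growth_rate M * T))"
      using Suc.prems e D \<tau>0 growth_rate_nonneg[OF M] T0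
      by (intro mult_left_mono mult_mono) auto
    also have "\<dots> = error_const M T * \<tau>"
      using M T0 by (simp add: error_const_def mult_ac)
    finally show ?thesis .
  qed
  finally have 4: "H_norm 1 (err \<tau> (Suc m)) \<le> error_const M T * \<tau>" .
  show ?case using 1 2 3 4 v' by blast
qed

lemma scheme_error:
  assumes \<tau>: "0 < \<tau>" "\<tau> \<le> 1" and small: "error_const M T * \<tau> \<le> sqrt \<tau>"
    and n: "real n * \<tau> \<le> T"
  shows "(\<lambda>x. u (real n * \<tau>) x - kdv_scheme \<tau> u0 n x) \<in> sobolev_space 1"
    and "sobolev_norm 1 (\<lambda>x. u (real n * \<tau>) x - kdv_scheme \<tau> u0 n x) \<le> error_const M T * \<tau>"
proof -
  note E = error_bound[OF assms]
  have "real n * \<tau> \<in> {0..T}" using n \<tau> by simp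
  then have u: "u (real n * \<tau>) \<in> sobolev_space 1" by (intro sobolev_space_le[OF H3]) auto
  have s: "kdv_scheme \<tau> u0 n \<in> sobolev_space 1" using E by blast
  show "(\<lambda>x. u (real n * \<tau>) x - kdv_scheme \<tau> u0 n x) \<in> sobolev_space 1"
    by (rule sobolev_space_diff[OF u s])
  have "norm (fourier_coeff (u (real n * \<tau>)) k - fourier_coeff (kdv_scheme \<tau> u0 n) k) = norm (err \<tau> n k)" for k
    unfolding err_def scheme_w_def w_def twist_def right_diff_distrib[symmetric] norm_mult norm_exp_cube by simp
  from H_norm_cong_norm[OF this]
  show "sobolev_norm 1 (\<lambda>x. u (real n * \<tau>) x - kdv_scheme \<tau> u0 n x) \<le> error_const M T * \<tau>"
    unfolding sobolev_norm_eq_H_norm fourier_coeff_diff[OF u s] using E by simp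
qed

end

lemma kdv_solution_restrict: "kdv_solution T u0 u \<Longrightarrow> t \<le> T \<Longrightarrow> kdv_solution t u0 u"
  unfolding kdv_solution_def by auto

theorem corollary2p8:
  "\<exists>c :: real \<Rightarrow> real \<Rightarrow> real.
     (\<forall>M M' t t'. M \<le> M' \<and> t \<le> t' \<longrightarrow> c M t \<le> c M' t') \<and>
     (\<forall>(T::real) (u0 :: real \<Rightarrow> real) (u :: real \<Rightarrow> real \<Rightarrow> real).
        T > 0 \<and>
        kdv_solution T u0 u \<and>
        (LINT x:{-pi..pi}|lborel. u0 x) = 0 \<and>
        (\<forall>t\<in>{0..T}. u t \<in> sobolev_space 3) \<and>
        bdd_above ((\<lambda>t. sobolev_norm 3 (u t)) ` {0..T}) \<longrightarrow>
        (\<exists>\<tau>0>0. \<forall>(\<tau>::real) (n::nat).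
           0 < \<tau> \<and> \<tau> \<le> \<tau>0 \<and> real n * \<tau> \<le> T \<longrightarrow>
           (\<lambda>x. u (real n * \<tau>) x - kdv_scheme \<tau> u0 n x) \<in> sobolev_space 1 \<and>
           sobolev_norm 1 (\<lambda>x. u (real n * \<tau>) x - kdv_scheme \<tau> u0 n x)
             \<le> c (SUP t\<in>{0..real n * \<tau>}. sobolev_norm 3 (u t)) (real n * \<tau>) * \<tau>))"
proof (rule exI[of _ error_const], intro conjI allI impI)
  show "error_const M t \<le> error_const M' t'" if "M \<le> M' \<and> t \<le> t'" for M M' t t'
    using that error_const_mono by blast
next
  fix T :: real and u0 :: "real \<Rightarrow> real" and u :: "real \<Rightarrow> real \<Rightarrow> real"
  assume A: "T > 0 \<and>
        kdv_solution T u0 u \<and>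
        (LINT x:{-pi..pi}|lborel. u0 x) = 0 \<and>
        (\<forall>t\<in>{0..T}. u t \<in> sobolev_space 3) \<and>
        bdd_above ((\<lambda>t. sobolev_norm 3 (u t)) ` {0..T})"
  define Sup3 where "Sup3 t = (SUP s\<in>{0..t}. sobolev_norm 3 (u s))" for t
  define C where "C = error_const (Sup3 T) T"
  have C: "0 \<le> C" unfolding C_def by (rule error_const_nonneg)
  \<comment> \<open>for \<open>\<tau> \<le> \<tau>0\<close> the first-order bound \<open>C \<tau>\<close> is at most \<open>\<surd>\<tau>\<close>\<close>
  define \<tau>0 where "\<tau>0 = (1 / (C + 1))\<^sup>2"
  have \<tau>0: "0 < \<tau>0" "\<tau>0 \<le> 1" using C by (auto simp: \<tau>0_def power_le_one)
  show "\<exists>\<tau>0>0. \<forall>(\<tau>::real) (n::nat).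
           0 < \<tau> \<and> \<tau> \<le> \<tau>0 \<and> real n * \<tau> \<le> T \<longrightarrow>
           (\<lambda>x. u (real n * \<tau>) x - kdv_scheme \<tau> u0 n x) \<in> sobolev_space 1 \<and>
           sobolev_norm 1 (\<lambda>x. u (real n * \<tau>) x - kdv_scheme \<tau> u0 n x)
             \<le> error_const (SUP t\<in>{0..real n * \<tau>}. sobolev_norm 3 (u t)) (real n * \<tau>) * \<tau>"
  proof (rule exI[of _ \<tau>0], rule conjI[OF \<tau>0(1)], intro allI impI)
    fix \<tau> :: real and n :: nat
    assume \<tau>: "0 < \<tau> \<and> \<tau> \<le> \<tau>0 \<and> real n * \<tau> \<le> T"
    define t where "t = real n * \<tau>"
    have t: "0 \<le> t" "t \<le> T" using \<tau> by (auto simp: t_def)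
    have bdd: "bdd_above ((\<lambda>t. sobolev_norm 3 (u t)) ` {0..t})"
      by (rule bdd_above_mono[of "(\<lambda>t. sobolev_norm 3 (u t)) ` {0..T}"]) (use A t in auto)
    have Sup_le: "Sup3 t \<le> Sup3 T"
      unfolding Sup3_def by (rule cSUP_subset_mono) (use A t in auto)
    have "error_const (Sup3 t) t * \<tau> \<le> C * \<tau>"
      unfolding C_def using \<tau> by (intro mult_right_mono error_const_mono Sup_le t) auto
    also have "\<dots> = (C * sqrt \<tau>) * sqrt \<tau>" using \<tau> by simp
    also have "\<dots> \<le> 1 * sqrt \<tau>"
    proof (intro mult_right_mono)
      have "sqrt \<tau> \<le> sqrt \<tau>0" using \<tau> by simp
      also have "\<dots> = 1 / (C + 1)" using C by (simp add: \<tau>0_def)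
      finally have "C * sqrt \<tau> \<le> C * (1 / (C + 1))" using C by (rule mult_left_mono)
      also have "\<dots> \<le> 1" using C by (simp add: divide_le_eq)
      finally show "C * sqrt \<tau> \<le> 1" .
    qed (use \<tau> in simp)
    finally have small: "error_const (Sup3 t) t * \<tau> \<le> sqrt \<tau>" by simp
    interpret kdv_bounded t u0 u "Sup3 t"
    proof
      show "kdv_solution t u0 u" using A t by (auto intro: kdv_solution_restrict)
      show "(LINT x:{-pi..pi}|lborel. u0 x) = 0" using A by blast
      show "u s \<in> sobolev_space 3" if "s \<in> {0..t}" for s using A t that by auto
      show "sobolev_norm 3 (u s) \<le> Sup3 t" if "s \<in> {0..t}" for s
        unfolding Sup3_def by (rule cSUP_upper[OF that bdd])
    qed
    show "(\<lambda>x. u (real n * \<tau>) x - kdv_scheme \<tau> u0 n x) \<in> sobolev_space 1 \<and>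
           sobolev_norm 1 (\<lambda>x. u (real n * \<tau>) x - kdv_scheme \<tau> u0 n x)
             \<le> error_const (SUP t\<in>{0..real n * \<tau>}. sobolev_norm 3 (u t)) (real n * \<tau>) * \<tau>"
      using scheme_error[of \<tau> n] small \<tau> \<tau>0(2) unfolding t_def Sup3_def by auto
  qed
qed

end
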